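(* Let $K$ be an algebraically closed field of characteristic $0$ and let $d \geq e \geq f \geq 1$ be integers. The Segre-Veronese embedding of $\mathbb{P}^1 \times \mathbb{P}^1 \times \mathbb{P}^1$ of degree $(d,e,f)$ is non-defective unless (1) $e=f=1$ and $d$ is even, in which case the $(d+1)$-st secant variety has codimension $1$ rather than the expected $0$, or (2) $d=e=f=2$, in which case the $7$-th secant variety has codimension $1$ instead of the expected $0$.
   Context: All varieties are over $K$. The Segre-Veronese embedding of $\mathbb{P}^1\times\mathbb{P}^1\times\mathbb{P}^1$ of degree $(d,e,f)$ is the map $\iota$ into $\mathbb{P}(V)$, $V=S^d(K^2)\otimes S^e(K^2)\otimes S^f(K^2)$, given by $([u],[v],[w])\mapsto [u^d\otimes v^e\otimes w^f]$. For an embedding $\iota:X\to\mathbb{P}(V)$ of a projective variety $X$ whose image spans $\mathbb{P}(V)$, and for an integer $k\ge 1$, the $k$-th (higher) secant variety $k\iota(X)$ is the closure in $\mathbb{P}(V)$ of the union of all subspaces of $\mathbb{P}(V)$ spanned by $k$ points on $\iota(X)$. The expected dimension of $k\iota(X)$ is $\min\{k(\dim X+1)-1,\ \dim V-1\}$ (always an upper bound for $\dim k\iota(X)$). $k\iota(X)$ is called non-defective if it has the expected dimension and defective otherwise. The embedding $\iota$ is called non-defective if $k\iota(X)$ is non-defective for all $k$, and defective otherwise. Codimensions are taken in $\mathbb{P}(V)$; the expected codimension is $\dim V-1$ minus the expected dimension. *)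

theory Defs
  imports
    "HOL-Analysis.Abstract_Topology"
    "HOL-Computational_Algebra.Polynomial"
    "HOL-Library.Function_Algebras"
    "HOL-Library.Poly_Mapping"
    "HOL-Library.Extended_Nat"
begin

section \<open>Coordinate vectors\<close>

definition vec_scale :: "'k::field \<Rightarrow> ('i \<Rightarrow> 'k) \<Rightarrow> 'i \<Rightarrow> 'k" where
  "vec_scale c v = (\<lambda>i. c * v i)"

global_interpretation coord: vector_space vec_scale
  defines coord_span = coord.span and coord_subspace = coord.subspace and coord_dim = coord.dim
  by unfold_locales (auto simp: vec_scale_def algebra_simps)

section \<open>Polynomials in the coordinates\<close>

type_synonym ('i, 'k) cpoly = "('i \<Rightarrow>\<^sub>0 nat) \<Rightarrow>\<^sub>0 'k"

definition monom_eval :: "('i \<Rightarrow>\<^sub>0 nat) \<Rightarrow> ('i \<Rightarrow> 'k::field) \<Rightarrow> 'k" where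
  "monom_eval m v = (\<Prod>i\<in>Poly_Mapping.keys m. v i ^ Poly_Mapping.lookup m i)"

definition cpoly_eval :: "('i, 'k::field) cpoly \<Rightarrow> ('i \<Rightarrow> 'k) \<Rightarrow> 'k" where
  "cpoly_eval F v = (\<Sum>m\<in>Poly_Mapping.keys F. Poly_Mapping.lookup F m * monom_eval m v)"

definition homogeneous :: "('i, 'k::field) cpoly \<Rightarrow> bool" where
  "homogeneous F \<longleftrightarrow> (\<exists>n. \<forall>m\<in>Poly_Mapping.keys F.
     (\<Sum>i\<in>Poly_Mapping.keys m. Poly_Mapping.lookup m i) = n)"

section \<open>Projective space and its Zariski topology\<close>

text \<open>Throughout, \<open>V\<close> is a linear subspace of the space of functions \<open>'i \<Rightarrow> 'k\<close>, and a
  point of \<open>P(V)\<close> is a line through the origin in \<open>V\<close>, as a set of vectors.\<close>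

definition proj_point :: "('i \<Rightarrow> 'k::field) \<Rightarrow> ('i \<Rightarrow> 'k) set" where
  "proj_point v = coord_span {v}"

definition proj_space :: "('i \<Rightarrow> 'k::field) set \<Rightarrow> ('i \<Rightarrow> 'k) set set" where
  "proj_space V = {proj_point v | v. v \<in> V \<and> v \<noteq> 0}"

definition zero_locus :: "('i \<Rightarrow> 'k::field) set \<Rightarrow> ('i, 'k) cpoly set \<Rightarrow> ('i \<Rightarrow> 'k) set set" where
  "zero_locus V S = {p \<in> proj_space V. \<forall>F\<in>S. \<forall>v\<in>p. cpoly_eval F v = 0}"

definition zariski :: "('i \<Rightarrow> 'k::field) set \<Rightarrow> ('i \<Rightarrow> 'k) set topology" where
  "zariski V = topology (\<lambda>U. \<exists>S. (\<forall>F\<in>S. homogeneous F) \<and> U = proj_space V - zero_locus V S)"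

text \<open>The lemmas up to \<open>closedin_zariski\<close> show that the above family of sets is indeed a
  topology, so that \<open>zariski\<close> is the intended one.\<close>

lemma cpoly_eval_superset:
  assumes "finite A" "Poly_Mapping.keys F \<subseteq> A"
  shows "cpoly_eval F v = (\<Sum>m\<in>A. Poly_Mapping.lookup F m * monom_eval m v)"
  unfolding cpoly_eval_def using assms
  by (intro sum.mono_neutral_left) (auto simp: in_keys_iff)

lemma cpoly_eval_0 [simp]: "cpoly_eval 0 v = 0"
  by (simp add: cpoly_eval_def)

lemma cpoly_eval_add: "cpoly_eval (F + G) v = cpoly_eval F v + cpoly_eval G v"
proof -
  let ?A = "Poly_Mapping.keys F \<union> Poly_Mapping.keys G"
  have "Poly_Mapping.keys (F + G) \<subseteq> ?A"
    by (rule Poly_Mapping.keys_add)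
  then show ?thesis
    by (simp add: cpoly_eval_superset[of ?A] lookup_add ring_distribs sum.distrib)
qed

lemma cpoly_eval_sum: "cpoly_eval (sum g A) v = (\<Sum>x\<in>A. cpoly_eval (g x) v)"
  by (induction A rule: infinite_finite_induct) (auto simp: cpoly_eval_add)

lemma cpoly_eval_single [simp]: "cpoly_eval (Poly_Mapping.single m a) v = a * monom_eval m v"
  by (subst cpoly_eval_superset[of "{m}"]) auto

lemma monom_eval_superset:
  assumes "finite A" "Poly_Mapping.keys m \<subseteq> A"
  shows "monom_eval m v = (\<Prod>i\<in>A. v i ^ Poly_Mapping.lookup m i)"
  unfolding monom_eval_def using assms
  by (intro prod.mono_neutral_left) (auto simp: in_keys_iff)

lemma monom_eval_add: "monom_eval (m + n) v = monom_eval m v * monom_eval n v"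
proof -
  let ?A = "Poly_Mapping.keys m \<union> Poly_Mapping.keys n"
  have "Poly_Mapping.keys (m + n) \<subseteq> ?A"
    by (rule Poly_Mapping.keys_add)
  then show ?thesis
    by (simp add: monom_eval_superset[of ?A] lookup_add power_add prod.distrib)
qed

lemma cpoly_expand:
  "(F :: ('i, 'k::field) cpoly) =
     (\<Sum>m\<in>Poly_Mapping.keys F. Poly_Mapping.single m (Poly_Mapping.lookup F m))"
  by (rule poly_mapping_eqI) (auto simp: lookup_sum lookup_single when_def in_keys_iff)

lemma cpoly_eval_mult: "cpoly_eval (F * G) v = cpoly_eval F v * cpoly_eval G v"
proof -
  let ?s = "\<lambda>F m. Poly_Mapping.single m (Poly_Mapping.lookup F m)"
  have "F * G = (\<Sum>m\<in>Poly_Mapping.keys F. ?s F m) * (\<Sum>n\<in>Poly_Mapping.keys G. ?s G n)"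
    using cpoly_expand[of F] cpoly_expand[of G] by simp
  also have "\<dots> = (\<Sum>m\<in>Poly_Mapping.keys F. \<Sum>n\<in>Poly_Mapping.keys G. ?s F m * ?s G n)"
    by (rule sum_product)
  finally show ?thesis
    by (simp add: cpoly_eval_sum mult_single monom_eval_add)
       (simp add: cpoly_eval_def sum_product algebra_simps)
qed

lemma monom_degree_add:
  "(\<Sum>i\<in>Poly_Mapping.keys (m + n). Poly_Mapping.lookup (m + n) i) =
   (\<Sum>i\<in>Poly_Mapping.keys m. Poly_Mapping.lookup m i) +
   (\<Sum>i\<in>Poly_Mapping.keys n. Poly_Mapping.lookup n i :: nat)"
proof -
  let ?A = "Poly_Mapping.keys m \<union> Poly_Mapping.keys n"
  have *: "(\<Sum>i\<in>Poly_Mapping.keys q. Poly_Mapping.lookup q i) = (\<Sum>i\<in>?A. Poly_Mapping.lookup q i)"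
    if "Poly_Mapping.keys q \<subseteq> ?A" for q :: "'a \<Rightarrow>\<^sub>0 nat"
    using that by (intro sum.mono_neutral_left) (auto simp: in_keys_iff)
  have "Poly_Mapping.keys (m + n) \<subseteq> ?A"
    by (rule Poly_Mapping.keys_add)
  then have "(\<Sum>i\<in>Poly_Mapping.keys (m + n). Poly_Mapping.lookup (m + n) i) =
      (\<Sum>i\<in>?A. Poly_Mapping.lookup (m + n) i)"
    by (rule *)
  also have "\<dots> = (\<Sum>i\<in>?A. Poly_Mapping.lookup m i) + (\<Sum>i\<in>?A. Poly_Mapping.lookup n i)"
    by (simp only: lookup_add sum.distrib)
  finally show ?thesis
    using *[of m] *[of n] by simp
qed

lemma homogeneous_mult:
  assumes "homogeneous F" "homogeneous G"
  shows "homogeneous (F * G)"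
proof -
  obtain a b where
    a: "\<forall>m\<in>Poly_Mapping.keys F. (\<Sum>i\<in>Poly_Mapping.keys m. Poly_Mapping.lookup m i) = a" and
    b: "\<forall>m\<in>Poly_Mapping.keys G. (\<Sum>i\<in>Poly_Mapping.keys m. Poly_Mapping.lookup m i) = b"
    using assms unfolding homogeneous_def by blast
  show ?thesis
    unfolding homogeneous_def
  proof (intro exI[of _ "a + b"] ballI)
    fix m assume "m \<in> Poly_Mapping.keys (F * G)"
    then obtain m1 m2 where "m = m1 + m2" "m1 \<in> Poly_Mapping.keys F" "m2 \<in> Poly_Mapping.keys G"
      using keys_mult[of F G] by blast
    then show "(\<Sum>i\<in>Poly_Mapping.keys m. Poly_Mapping.lookup m i) = a + b"
      using a b by (simp add: monom_degree_add)
  qed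
qed

lemma monom_eval_scale:
  "monom_eval m (vec_scale c v) =
     c ^ (\<Sum>i\<in>Poly_Mapping.keys m. Poly_Mapping.lookup m i) * monom_eval m v"
  by (simp add: monom_eval_def vec_scale_def power_mult_distrib prod.distrib power_sum)

lemma homogeneous_eval_scale:
  assumes "homogeneous F"
  obtains n where "\<And>c v. cpoly_eval F (vec_scale c v) = c ^ n * cpoly_eval F v"
proof -
  obtain n where
    "\<forall>m\<in>Poly_Mapping.keys F. (\<Sum>i\<in>Poly_Mapping.keys m. Poly_Mapping.lookup m i) = n"
    using assms unfolding homogeneous_def by blast
  then have "cpoly_eval F (vec_scale c v) = c ^ n * cpoly_eval F v" for c v
    by (simp add: cpoly_eval_def monom_eval_scale sum_distrib_left algebra_simps)
  then show ?thesis
    using that by blast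
qed

lemma proj_point_eq: "proj_point v = {vec_scale c v | c. True}"
  by (auto simp: proj_point_def coord.span_singleton)

lemma vanish_on_proj_point:
  assumes "homogeneous F"
  shows "(\<forall>w\<in>proj_point v. cpoly_eval F w = 0) \<longleftrightarrow> cpoly_eval F v = 0"
proof -
  obtain n where n: "\<And>c v. cpoly_eval F (vec_scale c v) = c ^ n * cpoly_eval F v"
    using homogeneous_eval_scale[OF assms] by blast
  show ?thesis
  proof
    assume "\<forall>w\<in>proj_point v. cpoly_eval F w = 0"
    moreover have "v \<in> proj_point v"
      by (simp add: proj_point_def coord.span_base)
    ultimately show "cpoly_eval F v = 0" ..
  next
    assume "cpoly_eval F v = 0"
    then show "\<forall>w\<in>proj_point v. cpoly_eval F w = 0"
      by (auto simp: proj_point_eq n)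
  qed
qed

lemma proj_point_in_zero_locus:
  assumes "\<forall>F\<in>S. homogeneous F" "proj_point v \<in> proj_space V"
  shows "proj_point v \<in> zero_locus V S \<longleftrightarrow> (\<forall>F\<in>S. cpoly_eval F v = 0)"
proof -
  have "proj_point v \<in> zero_locus V S \<longleftrightarrow> (\<forall>F\<in>S. \<forall>w\<in>proj_point v. cpoly_eval F w = 0)"
    using assms(2) by (simp only: zero_locus_def mem_Collect_eq simp_thms)
  also have "\<dots> \<longleftrightarrow> (\<forall>F\<in>S. cpoly_eval F v = 0)"
    using assms(1) by (intro ball_cong refl vanish_on_proj_point) (rule bspec)
  finally show ?thesis .
qed

lemma zero_locus_Un:
  assumes S: "\<forall>F\<in>S. homogeneous F" and T: "\<forall>F\<in>T. homogeneous F"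
  shows "zero_locus V S \<union> zero_locus V T = zero_locus V ((\<lambda>(F, G). F * G) ` (S \<times> T))"
    (is "?L = ?R")
proof (rule set_eqI)
  have ST: "\<forall>H\<in>(\<lambda>(F, G). F * G) ` (S \<times> T). homogeneous H"
    using S T by (auto intro: homogeneous_mult)
  fix p
  show "p \<in> ?L \<longleftrightarrow> p \<in> ?R"
  proof (cases "p \<in> proj_space V")
    case True
    then obtain v where p: "p = proj_point v"
      unfolding proj_space_def by blast
    have "p \<in> ?R \<longleftrightarrow> (\<forall>F\<in>S. \<forall>G\<in>T. cpoly_eval F v = 0 \<or> cpoly_eval G v = 0)"
      unfolding p using proj_point_in_zero_locus[OF ST] True
      by (simp add: p cpoly_eval_mult)
    also have "\<dots> \<longleftrightarrow> (\<forall>F\<in>S. cpoly_eval F v = 0) \<or> (\<forall>G\<in>T. cpoly_eval G v = 0)"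
      by blast
    finally show ?thesis
      using proj_point_in_zero_locus[OF S] proj_point_in_zero_locus[OF T] True
      by (simp only: p Un_iff)
  next
    case False
    then show ?thesis
      by (simp add: zero_locus_def)
  qed
qed

lemma istopology_zariski:
  "istopology (\<lambda>U. \<exists>S. (\<forall>F\<in>S. homogeneous F) \<and> U = proj_space V - zero_locus V S)"
  (is "istopology ?P")
  unfolding istopology_def
proof (intro conjI allI impI)
  fix A B assume A: "?P A" and B: "?P B"
  from A obtain S where S: "\<forall>F\<in>S. homogeneous F" "A = proj_space V - zero_locus V S"
    by (elim exE conjE)
  from B obtain T where T: "\<forall>F\<in>T. homogeneous F" "B = proj_space V - zero_locus V T"
    by (elim exE conjE)
  have "A \<inter> B = proj_space V - (zero_locus V S \<union> zero_locus V T)"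
    by (simp only: S(2) T(2) Diff_Un)
  then have "A \<inter> B = proj_space V - zero_locus V ((\<lambda>(F, G). F * G) ` (S \<times> T))"
    by (simp only: zero_locus_Un[OF S(1) T(1)])
  moreover have "\<forall>H\<in>(\<lambda>(F, G). F * G) ` (S \<times> T). homogeneous H"
    using S(1) T(1) by (auto intro: homogeneous_mult)
  ultimately show "?P (A \<inter> B)"
    by (intro exI conjI)
next
  fix \<K> assume "\<forall>U\<in>\<K>. ?P U"
  from bchoice[OF this] obtain S
    where S: "\<forall>U\<in>\<K>. (\<forall>F\<in>S U. homogeneous F) \<and> U = proj_space V - zero_locus V (S U)" ..
  have "\<Union>\<K> = (\<Union>U\<in>\<K>. U)"
    by simp
  also have "\<dots> = (\<Union>U\<in>\<K>. proj_space V - zero_locus V (S U))"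
    by (rule SUP_cong[OF refl]) (rule bspec[OF S, THEN conjunct2])
  also have "\<dots> = proj_space V - zero_locus V (\<Union>(S ` \<K>))"
    by (auto simp: zero_locus_def)
  finally have "\<Union>\<K> = proj_space V - zero_locus V (\<Union>(S ` \<K>))" .
  moreover have "\<forall>F\<in>\<Union>(S ` \<K>). homogeneous F"
    using bspec[OF S, THEN conjunct1] by (intro ballI) (elim UN_E, rule bspec)
  ultimately show "?P (\<Union>\<K>)"
    by (intro exI conjI)
qed

lemma openin_zariski:
  "openin (zariski V) U \<longleftrightarrow>
     (\<exists>S. (\<forall>F\<in>S. homogeneous F) \<and> U = proj_space V - zero_locus V S)"
  unfolding zariski_def using istopology_zariski[of V] by (simp add: topology_inverse')

lemma topspace_zariski [simp]: "topspace (zariski V) = proj_space V"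
proof
  show "topspace (zariski V) \<subseteq> proj_space V"
    using openin_topspace[of "zariski V"] unfolding openin_zariski by blast
  have one: "cpoly_eval 1 v = 1" for v :: "'a \<Rightarrow> 'b"
    using cpoly_eval_single[of 0 1 v] by (simp add: monom_eval_def)
  have "homogeneous (1 :: ('a, 'b) cpoly)"
    by (simp add: homogeneous_def)
  moreover have "zero_locus V {1} = {}"
  proof -
    have "p \<notin> zero_locus V {1}" for p
    proof
      assume p: "p \<in> zero_locus V {1}"
      then obtain v where "p = proj_point v"
        unfolding zero_locus_def proj_space_def by blast
      then have "v \<in> p"
        by (simp add: proj_point_def coord.span_base)
      with p have "cpoly_eval 1 v = 0"
        unfolding zero_locus_def by blast
      then show False
        by (simp add: one)
    qed
    then show ?thesis
      by blast
  qed
  ultimately have "openin (zariski V) (proj_space V)"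
    unfolding openin_zariski by (intro exI[of _ "{1}"]) auto
  then show "proj_space V \<subseteq> topspace (zariski V)"
    by (rule openin_subset)
qed

lemma closedin_zariski:
  "closedin (zariski V) Z \<longleftrightarrow> (\<exists>S. (\<forall>F\<in>S. homogeneous F) \<and> Z = zero_locus V S)"
proof -
  have "zero_locus V S \<subseteq> proj_space V" for S
    by (auto simp: zero_locus_def)
  then show ?thesis
    unfolding closedin_def openin_zariski topspace_zariski by blast
qed

section \<open>Dimension\<close>

definition irreducible_space :: "'a topology \<Rightarrow> bool" where
  "irreducible_space X \<longleftrightarrow> topspace X \<noteq> {} \<and>
     (\<forall>A B. closedin X A \<longrightarrow> closedin X B \<longrightarrow> A \<union> B = topspace X \<longrightarrow>
        A = topspace X \<or> B = topspace X)"

text \<open>The Krull dimension of a topological space. As \<open>enat\<close> has no negative elements, the empty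
  space gets dimension \<open>0\<close>.\<close>

definition krull_dim :: "'a topology \<Rightarrow> enat" where
  "krull_dim X = Sup {enat n | n. \<exists>Z :: nat \<Rightarrow> 'a set.
     (\<forall>i\<le>n. closedin X (Z i) \<and> irreducible_space (subtopology X (Z i))) \<and>
     (\<forall>i<n. Z i \<subset> Z (Suc i))}"

definition proj_dim :: "('i \<Rightarrow> 'k::field) set \<Rightarrow> ('i \<Rightarrow> 'k) set set \<Rightarrow> enat" where
  "proj_dim V Y = krull_dim (subtopology (zariski V) Y)"

section \<open>Secant varieties\<close>

text \<open>In the following, \<open>Y\<close> is the image in \<open>P(V)\<close> of an embedding of a projective variety \<open>X\<close>.
  All notions depend on \<open>Y\<close> only; in particular \<open>dim X = dim Y\<close>.\<close>

definition proj_span :: "('i \<Rightarrow> 'k::field) set \<Rightarrow> ('i \<Rightarrow> 'k) set set \<Rightarrow> ('i \<Rightarrow> 'k) set set" where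
  "proj_span V P = {q \<in> proj_space V. q \<subseteq> coord_span (\<Union>P)}"

text \<open>The \<open>k\<close> points need not be distinct. For infinite \<open>Y\<close> this makes no difference.\<close>

definition secant_variety ::
  "('i \<Rightarrow> 'k::field) set \<Rightarrow> ('i \<Rightarrow> 'k) set set \<Rightarrow> nat \<Rightarrow> ('i \<Rightarrow> 'k) set set" where
  "secant_variety V Y k =
     zariski V closure_of (\<Union>{proj_span V (p ` {..<k}) | p. \<forall>j<k. p j \<in> Y})"

definition expected_dim ::
  "('i \<Rightarrow> 'k::field) set \<Rightarrow> ('i \<Rightarrow> 'k) set set \<Rightarrow> nat \<Rightarrow> enat" where
  "expected_dim V Y k = min (enat k * (proj_dim V Y + 1) - 1) (enat (coord_dim V - 1))"

definition nondefective :: "('i \<Rightarrow> 'k::field) set \<Rightarrow> ('i \<Rightarrow> 'k) set set \<Rightarrow> bool" where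
  "nondefective V Y \<longleftrightarrow> (\<forall>k\<ge>1. proj_dim V (secant_variety V Y k) = expected_dim V Y k)"

definition secant_codim ::
  "('i \<Rightarrow> 'k::field) set \<Rightarrow> ('i \<Rightarrow> 'k) set set \<Rightarrow> nat \<Rightarrow> enat" where
  "secant_codim V Y k = enat (coord_dim V - 1) - proj_dim V (secant_variety V Y k)"

definition expected_codim ::
  "('i \<Rightarrow> 'k::field) set \<Rightarrow> ('i \<Rightarrow> 'k) set set \<Rightarrow> nat \<Rightarrow> enat" where
  "expected_codim V Y k = enat (coord_dim V - 1) - expected_dim V Y k"

section \<open>The Segre-Veronese embedding of \<open>P\<^sup>1 \<times> P\<^sup>1 \<times> P\<^sup>1\<close>\<close>

text \<open>Let \<open>x, y\<close> be the standard basis of \<open>K\<^sup>2\<close>. An element of \<open>S\<^sup>d(K\<^sup>2)\<close> is given by its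
  coordinates in the basis \<open>x\<^bsup>d-i\<^esup> y\<^sup>i\<close>, \<open>0 \<le> i \<le> d\<close>, extended by \<open>0\<close> to all \<open>i\<close>.
  An element of \<open>S\<^sup>d(K\<^sup>2) \<otimes> S\<^sup>e(K\<^sup>2) \<otimes> S\<^sup>f(K\<^sup>2)\<close> is given by its coordinates in the tensor
  products of these basis elements.\<close>

definition sym_pow_elem :: "nat \<Rightarrow> 'k \<times> 'k \<Rightarrow> nat \<Rightarrow> 'k::field" where
  "sym_pow_elem d u i = of_nat (d choose i) * fst u ^ (d - i) * snd u ^ i"

lemma sym_pow_elem_eq_power:
  "(\<Sum>i\<le>d. sym_pow_elem d u i * (x ^ (d - i) * y ^ i)) = (fst u * x + snd u * y) ^ d"
proof -
  have "(fst u * x + snd u * y) ^ d = (snd u * y + fst u * x) ^ d"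
    by (simp add: add.commute)
  also have "\<dots> = (\<Sum>i\<le>d. sym_pow_elem d u i * (x ^ (d - i) * y ^ i))"
    by (simp add: binomial_ring sym_pow_elem_def power_mult_distrib mult_ac)
  finally show ?thesis ..
qed

definition tensor3 ::
  "(nat \<Rightarrow> 'k) \<Rightarrow> (nat \<Rightarrow> 'k) \<Rightarrow> (nat \<Rightarrow> 'k) \<Rightarrow> nat \<times> nat \<times> nat \<Rightarrow> 'k::field" where
  "tensor3 a b c = (\<lambda>(i, j, l). a i * b j * c l)"

definition sv_space :: "nat \<Rightarrow> nat \<Rightarrow> nat \<Rightarrow> (nat \<times> nat \<times> nat \<Rightarrow> 'k::field) set" where
  "sv_space d e f = {v. \<forall>t. t \<notin> {..d} \<times> {..e} \<times> {..f} \<longrightarrow> v t = 0}"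

text \<open>The image of the embedding, i.e. the set of all points \<open>[u\<^sup>d \<otimes> v\<^sup>e \<otimes> w\<^sup>f]\<close>.\<close>

definition segre_veronese ::
  "nat \<Rightarrow> nat \<Rightarrow> nat \<Rightarrow> (nat \<times> nat \<times> nat \<Rightarrow> 'k::field) set set" where
  "segre_veronese d e f =
     {proj_point (tensor3 (sym_pow_elem d u) (sym_pow_elem e v) (sym_pow_elem f w)) | u v w.
        u \<noteq> (0, 0) \<and> v \<noteq> (0, 0) \<and> w \<noteq> (0, 0)}"

end

theory Submission
  imports Defs "Jordan_Normal_Form.Determinant"
begin

text \<open>On an affine chart of \<open>(P\<^sup>1)\<^sup>3\<close> the coordinate of \<open>u\<^sup>d \<otimes> v\<^sup>e \<otimes> w\<^sup>f\<close> at an exponent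
  \<open>\<alpha> = (i, j, l)\<close> of the box \<open>{0..d} \<times> {0..e} \<times> {0..f}\<close> is the monomial \<open>x\<^sup>i y\<^sup>j z\<^sup>l\<close> times a
  product of binomial coefficients. So the affine cone over the \<open>k\<close>-th secant variety is the
  closure of the image of an explicit polynomial map in \<open>4k\<close> parameters. The proof has three
  parts.

  The first part is the dimension theory of closures of images of polynomial maps \<open>\<phi>\<close>, for the
  Krull dimension of the Zariski topology. It rests on one count: the monomials of degree at most
  \<open>D\<close> in each of \<open>n\<close> polynomials in \<open>m < n\<close> variables are more numerous, for large \<open>D\<close>, than the
  dimension of the space in which they lie, so the polynomials satisfy an algebraic relation
  (\<open>algebraic_relation\<close>). For the upper bound, a chain \<open>Z\<^sub>0 \<subset> \<dots> \<subset> Z\<^sub>n\<close> of irreducible closed sets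
  gives homogeneous polynomials \<open>F\<^sub>i\<close> vanishing on \<open>Z\<^bsub>i-1\<^esub>\<close> but not on \<open>Z\<^sub>i\<close>, and these \<open>n + 1\<close>
  polynomials are algebraically independent on \<open>Z\<^sub>n\<close> (\<open>chain_alg_indep\<close>), hence \<open>n + 1\<close> is at most
  the number of parameters. For the lower bound, if the derivative of \<open>\<phi>\<close> at some point maps onto
  the coordinates in a set \<open>A\<close>, then the cones over the images of the members of a flag of affine
  subspaces through that point give a chain of irreducible closed sets of length \<open>card A - 1\<close>: two
  consecutive members cannot coincide, because the relation that the smaller one satisfies would
  hold on the larger one, contrary to the independence of the terms of lowest order
  (\<open>krull_dim_ge_tangent\<close>).

  By duality (\<open>secant_param_tangent\<close>, which is Terracini's lemma) the derivative of the
  parametrization maps onto the coordinates in \<open>A\<close> as soon as no nonzero polynomial with monomials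
  in \<open>A\<close> is singular at all \<open>k\<close> points. The second part finds such points by a tropical
  degeneration. If a plane separates the exponent sets \<open>A\<close> and \<open>B\<close>, then moving the points chosen
  for \<open>B\<close> towards infinity in the direction of its normal decouples the two sets of conditions,
  and the points for \<open>A\<close> together with those for \<open>B\<close> work for \<open>A \<union> B\<close>
  (\<open>none_singular_at_separated\<close>). A single point works for any subset of a tetrahedron. So it
  suffices to cut the box by successive planes into tetrahedra with integral vertices that use up
  all of its points, except for at most three that lie in a further tetrahedron. Boxes can be
  stacked when one of them has a number of points divisible by four, which reduces all boxes
  except those of the two exceptions to eleven small ones (\<open>nondefective_box\<close>); explicit planes
  cut these.

  The third part treats the two exceptions. There the polarization of forms to a square matrix of
  size \<open>k + 1\<close> sends a \<open>k\<close>-secant point to a sum of \<open>k\<close> matrices of rank one, so its determinant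
  vanishes on the secant variety, which therefore is a proper closed subset of the ambient space.
  Its codimension is not larger than one since the box without one point still can be cut into
  tetrahedra and a smaller rest.\<close>

section \<open>Polynomial functions and algebraic relations\<close>

text \<open>Exponent vectors are lists, so that an induction on the number of variables splits off
  the last entry. Every single exponent is bounded, instead of the total degree, because the
  number of such vectors is simply a power.\<close>

definition exps :: "nat \<Rightarrow> nat \<Rightarrow> nat list set" where
  "exps n D = {as. set as \<subseteq> {..D} \<and> length as = n}"

definition monomial :: "(nat \<Rightarrow> 'a::comm_monoid_mult) \<Rightarrow> nat list \<Rightarrow> 'a" where
  "monomial x as = (\<Prod>i<length as. x i ^ (as ! i))"

lemma finite_exps [simp]: "finite (exps n D)"
  by (simp add: exps_def finite_lists_length_eq)

lemma card_exps: "card (exps n D) = Suc D ^ n"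
  by (simp add: exps_def card_lists_length_eq)

lemma length_exps: "as \<in> exps n D \<Longrightarrow> length as = n"
  by (simp add: exps_def)

lemma exps_nth: "as \<in> exps n D \<Longrightarrow> i < n \<Longrightarrow> as ! i \<le> D"
  by (auto simp: exps_def dest: nth_mem)

lemma exps_0 [simp]: "exps 0 D = {[]}"
  by (auto simp: exps_def)

lemma monomial_snoc: "monomial x (as @ [j]) = monomial x as * x (length as) ^ j"
  by (simp add: monomial_def nth_append)

lemma monomial_cong: "(\<And>i. i < length as \<Longrightarrow> x i = y i) \<Longrightarrow> monomial x as = monomial y as"
  by (simp add: monomial_def)

lemma monomial_Nil [simp]: "monomial x [] = 1"
  by (simp add: monomial_def)

lemma exps_Suc: "exps (Suc n) D = (\<lambda>(as, j). as @ [j]) ` (exps n D \<times> {..D})"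
proof
  show "exps (Suc n) D \<subseteq> (\<lambda>(as, j). as @ [j]) ` (exps n D \<times> {..D})"
  proof
    fix as assume a: "as \<in> exps (Suc n) D"
    then obtain bs j where as: "as = bs @ [j]"
      by (cases as rule: rev_cases) (auto simp: exps_def)
    with a have "(bs, j) \<in> exps n D \<times> {..D}"
      by (auto simp: exps_def)
    then show "as \<in> (\<lambda>(as, j). as @ [j]) ` (exps n D \<times> {..D})"
      using as by (intro image_eqI[of _ _ "(bs, j)"]) auto
  qed
qed (auto simp: exps_def)

lemma snoc_in_exps [simp]: "as @ [j] \<in> exps (Suc n) D \<longleftrightarrow> as \<in> exps n D \<and> j \<le> D"
  by (auto simp: exps_def)

lemma exps_SucE:
  assumes "as \<in> exps (Suc n) D"
  obtains bs j where "as = bs @ [j]" "bs \<in> exps n D" "j \<le> D"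
  using assms by (auto simp: exps_Suc)

lemma sum_exps_Suc:
  "(\<Sum>as\<in>exps (Suc n) D. g as) = (\<Sum>j\<le>D. \<Sum>as\<in>exps n D. g (as @ [j]))"
proof -
  have "(\<Sum>as\<in>exps (Suc n) D. g as) = (\<Sum>(as, j)\<in>exps n D \<times> {..D}. g (as @ [j]))"
    unfolding exps_Suc by (subst sum.reindex) (auto simp: inj_on_def case_prod_unfold)
  also have "\<dots> = (\<Sum>as\<in>exps n D. \<Sum>j\<le>D. g (as @ [j]))"
    by (simp add: sum.cartesian_product)
  also have "\<dots> = (\<Sum>j\<le>D. \<Sum>as\<in>exps n D. g (as @ [j]))"
    by (rule sum.swap)
  finally show ?thesis .
qed

lemma coeffs_zero:
  fixes a :: "nat \<Rightarrow> 'k::field_char_0"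
  assumes "\<And>t. (\<Sum>j\<le>D. a j * t ^ j) = 0" "j \<le> D"
  shows "a j = 0"
proof -
  let ?p = "\<Sum>j\<le>D. monom (a j) j"
  have "poly ?p t = 0" for t
    using assms(1)[of t] by (simp add: poly_sum poly_monom)
  then have "?p = 0"
    using poly_all_0_iff_0 by blast
  then have "coeff ?p j = 0"
    by simp
  then show ?thesis
    using assms(2) by (simp add: coeff_sum sum.delta)
qed

text \<open>For fixed values of the other variables the relation is a polynomial in the last variable
  with infinitely many zeros.\<close>

lemma monomial_independent:
  fixes c :: "nat list \<Rightarrow> 'k::field_char_0"
  assumes "\<And>x. (\<Sum>as\<in>exps n D. c as * monomial x as) = 0" "as \<in> exps n D"
  shows "c as = 0"
  using assms
proof (induction n arbitrary: c as)
  case 0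
  then show ?case by simp
next
  case (Suc n)
  obtain bs j where as: "as = bs @ [j]" "bs \<in> exps n D" "j \<le> D"
    using Suc.prems(2) by (rule exps_SucE)
  show ?case unfolding as(1)
  proof (rule Suc.IH[of "\<lambda>bs. c (bs @ [j])"])
    show "bs \<in> exps n D" by fact
    fix x :: "nat \<Rightarrow> 'k"
    show "(\<Sum>as\<in>exps n D. c (as @ [j]) * monomial x as) = 0"
    proof (rule coeffs_zero[where a = "\<lambda>j. \<Sum>as\<in>exps n D. c (as @ [j]) * monomial x as"])
      show "j \<le> D" by fact
      fix t
      have "monomial (x(n := t)) (as @ [j]) = monomial x as * t ^ j" if "as \<in> exps n D" for as j
        using length_exps[OF that] by (auto simp: monomial_snoc intro!: arg_cong2[where f =
          "(*)"] monomial_cong)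
      then show "(\<Sum>j\<le>D. (\<Sum>as\<in>exps n D. c (as @ [j]) * monomial x as) * t ^ j) = 0"
        using Suc.prems(1)[of "x(n := t)"]
        by (simp del: fun_upd_apply add: sum_exps_Suc sum_distrib_right mult.assoc)
    qed
  qed
qed

definition polyfuns :: "nat \<Rightarrow> nat \<Rightarrow> ((nat \<Rightarrow> 'k::field) \<Rightarrow> 'k) set" where
  "polyfuns m D = coord_span ((\<lambda>as x. monomial x as) ` exps m D)"

lemma polyfuns_monom: "as \<in> exps m D \<Longrightarrow> (\<lambda>x. monomial x as) \<in> polyfuns m D"
  unfolding polyfuns_def by (intro coord.span_base) auto

lemma polyfuns_add: "f \<in> polyfuns m D \<Longrightarrow> g \<in> polyfuns m D \<Longrightarrow> (\<lambda>x. f x + g x) \<in> polyfuns m D"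
  unfolding polyfuns_def using coord.span_add[of f _ g] by (simp add: plus_fun_def)

lemma polyfuns_scale: "f \<in> polyfuns m D \<Longrightarrow> (\<lambda>x. c * f x) \<in> polyfuns m D"
  unfolding polyfuns_def using coord.span_scale[of f _ c] by (simp add: vec_scale_def)

lemma polyfuns_mono: "D \<le> D' \<Longrightarrow> polyfuns m D \<subseteq> polyfuns m D'"
  unfolding polyfuns_def by (intro coord.span_mono image_mono) (auto simp: exps_def)

lemma polyfuns_zero: "(\<lambda>x. 0) \<in> polyfuns m D"
  unfolding polyfuns_def using coord.span_zero by (simp add: zero_fun_def)

lemma polyfuns_induct [consumes 1, case_names zero step]:
  assumes "f \<in> polyfuns m D" "P (\<lambda>x. 0)"
    "\<And>c as g. as \<in> exps m D \<Longrightarrow> P g \<Longrightarrow> P (\<lambda>x. c * monomial x as + g x)"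
  shows "P f"
  using assms(1) unfolding polyfuns_def
proof (induction rule: coord.span_induct_alt)
  case base
  then show ?case using assms(2) by (simp add: zero_fun_def)
next
  case (step c h g)
  then obtain as where as: "as \<in> exps m D" "h = (\<lambda>x. monomial x as)" by auto
  have "P (\<lambda>x. c * monomial x as + g x)"
    by (rule assms(3)) (use step as(1) in auto)
  then show ?case
    by (simp add: as(2) plus_fun_def vec_scale_def)
qed

lemma monomial_mult:
  assumes "as \<in> exps m D" "bs \<in> exps m D'"
  shows "monomial x as * monomial x bs = monomial x (map2 (+) as bs)" "map2 (+) as bs \<in> exps m (D +
    D')"
proof -
  have l: "length as = m" "length bs = m"
    using assms by (auto simp: length_exps)
  then show "monomial x as * monomial x bs = monomial x (map2 (+) as bs)"
    by (simp add: monomial_def power_add prod.distrib)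
  have "map2 (+) as bs ! i \<le> D + D'" if "i < m" for i
    using that l exps_nth[OF assms(1)] exps_nth[OF assms(2)] by (simp add: add_mono)
  then show "map2 (+) as bs \<in> exps m (D + D')"
    using l by (auto simp: exps_def in_set_conv_nth)
qed

lemma polyfuns_mult:
  assumes "f \<in> polyfuns m D" "g \<in> polyfuns m D'"
  shows "(\<lambda>x. f x * g x) \<in> polyfuns m (D + D')"
  using assms(1)
proof (induction rule: polyfuns_induct)
  case zero
  then show ?case by (simp add: polyfuns_zero)
next
  case (step c as f)
  have "(\<lambda>x. monomial x as * g x) \<in> polyfuns m (D + D')"
    using assms(2)
  proof (induction rule: polyfuns_induct)
    case zero
    then show ?case by (simp add: polyfuns_zero)
  next
    case (step c' bs g)
    have "(\<lambda>x. monomial x (map2 (+) as bs)) \<in> polyfuns m (D + D')"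
      using monomial_mult(2)[OF \<open>as \<in> _\<close> \<open>bs \<in> _\<close>] by (rule polyfuns_monom)
    from polyfuns_add[OF polyfuns_scale[OF this, of c'] step(2)] show ?case
      by (simp add: monomial_mult(1)[OF \<open>as \<in> _\<close> \<open>bs \<in> _\<close>, symmetric] algebra_simps)
  qed
  from polyfuns_add[OF polyfuns_scale[OF this, of c] step(2)] show ?case
    by (simp add: algebra_simps)
qed

definition polyfun :: "nat \<Rightarrow> ((nat \<Rightarrow> 'k::field) \<Rightarrow> 'k) \<Rightarrow> bool" where
  "polyfun m f \<longleftrightarrow> (\<exists>D. f \<in> polyfuns m D)"

lemma polyfun_const [simp, intro]: "polyfun m (\<lambda>x. c)"
proof -
  have "(\<lambda>x. monomial x (replicate m 0)) \<in> polyfuns m 0"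
    by (rule polyfuns_monom) (auto simp: exps_def)
  from polyfuns_scale[OF this, of c] show ?thesis
    unfolding polyfun_def by (auto simp: monomial_def)
qed

lemma polyfun_var: assumes "i < m" shows "polyfun m (\<lambda>x. x i)"
proof -
  let ?as = "(replicate m 0)[i := 1]"
  have "monomial x ?as = x i" for x :: "nat \<Rightarrow> 'a"
  proof -
    have "monomial x ?as = (\<Prod>j<m. if j = i then x i else 1)"
      unfolding monomial_def by (intro prod.cong) (auto simp: nth_list_update)
    then show ?thesis using assms by simp
  qed
  moreover have "(\<lambda>x :: nat \<Rightarrow> 'a. monomial x ?as) \<in> polyfuns m 1"
    by (rule polyfuns_monom) (auto simp: exps_def dest!: set_update_subset_insert[THEN subsetD])
  ultimately show ?thesis
    unfolding polyfun_def by auto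
qed

lemma polyfun_add: assumes "polyfun m f" "polyfun m g" shows "polyfun m (\<lambda>x. f x + g x)"
proof -
  from assms obtain D D' where "f \<in> polyfuns m D" "g \<in> polyfuns m D'"
    unfolding polyfun_def by blast
  then have "f \<in> polyfuns m (max D D')" "g \<in> polyfuns m (max D D')"
    using polyfuns_mono[of D "max D D'" m] polyfuns_mono[of D' "max D D'" m] by auto
  then show ?thesis unfolding polyfun_def using polyfuns_add by blast
qed

lemma polyfun_mult: "polyfun m f \<Longrightarrow> polyfun m g \<Longrightarrow> polyfun m (\<lambda>x. f x * g x)"
  unfolding polyfun_def using polyfuns_mult by blast

lemma polyfun_power: "polyfun m f \<Longrightarrow> polyfun m (\<lambda>x. f x ^ n)"
  by (induction n) (auto intro: polyfun_mult)

lemma polyfun_sum: "(\<And>a. a \<in> A \<Longrightarrow> polyfun m (f a)) \<Longrightarrow> polyfun m (\<lambda>x. \<Sum>a\<in>A. f a x)"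
  by (induction A rule: infinite_finite_induct) (auto intro: polyfun_add)

lemma polyfun_prod: "(\<And>a. a \<in> A \<Longrightarrow> polyfun m (f a)) \<Longrightarrow> polyfun m (\<lambda>x. \<Prod>a\<in>A. f a x)"
  by (induction A rule: infinite_finite_induct) (auto intro: polyfun_mult)

lemma polyfun_monomial:
  "(\<And>i. i < length as \<Longrightarrow> polyfun m (h i)) \<Longrightarrow> polyfun m (\<lambda>x. monomial (\<lambda>i. h i x) as)"
  unfolding monomial_def by (intro polyfun_prod polyfun_power) auto

lemma polyfun_cpoly_eval:
  assumes "\<And>t. polyfun m (\<lambda>x. \<phi> x t)"
  shows "polyfun m (\<lambda>x. cpoly_eval F (\<phi> x))"
  unfolding cpoly_eval_def monom_eval_def
  by (intro polyfun_sum polyfun_mult polyfun_const polyfun_prod polyfun_power assms)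

lemma polyfun_subst:
  assumes "polyfun r g" "\<And>i. i < r \<Longrightarrow> polyfun k (h i)"
  shows "polyfun k (\<lambda>x. g (\<lambda>i. h i x))"
proof -
  obtain D where "g \<in> polyfuns r D" using assms(1) unfolding polyfun_def by blast
  then show ?thesis
  proof (induction rule: polyfuns_induct)
    case (step c as g)
    then show ?case
      by (intro polyfun_add polyfun_mult polyfun_const polyfun_monomial assms(2))
        (auto simp: length_exps)
  qed auto
qed

lemma polyfun_on_line:
  assumes "polyfun m f"
  shows "\<exists>q. \<forall>t. f (\<lambda>i. x i + t * y i) = poly q t"
proof -
  obtain D where "f \<in> polyfuns m D" using assms unfolding polyfun_def by blast
  then show ?thesis
  proof (induction rule: polyfuns_induct)
    case zero
    show ?case by (intro exI[of _ 0]) auto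
  next
    case (step c as g)
    then obtain q where q: "\<And>t. g (\<lambda>i. x i + t * y i) = poly q t" by blast
    show ?case
      by (intro exI[of _ "Polynomial.smult c (monomial (\<lambda>i. [:x i, y i:]) as) + q"])
         (auto simp: q monomial_def poly_prod)
  qed
qed

text \<open>On the line through \<open>x\<close> and \<open>y\<close> both functions become univariate polynomials, one of
  which must be zero.\<close>

lemma polyfun_mult_eq_0:
  fixes f g :: "(nat \<Rightarrow> 'k::field_char_0) \<Rightarrow> 'k"
  assumes "polyfun m f" "polyfun m g" "\<And>x. f x * g x = 0" "f x \<noteq> 0"
  shows "g y = 0"
proof -
  obtain p where p: "\<And>t. f (\<lambda>i. x i + t * (y i - x i)) = poly p t"
    using polyfun_on_line[OF assms(1), of x "\<lambda>i. y i - x i"] by blast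
  obtain q where q: "\<And>t. g (\<lambda>i. x i + t * (y i - x i)) = poly q t"
    using polyfun_on_line[OF assms(2), of x "\<lambda>i. y i - x i"] by blast
  have "poly (p * q) t = 0" for t
    using assms(3)[of "\<lambda>i. x i + t * (y i - x i)"] by (simp add: p q)
  then have "p * q = 0"
    using poly_all_0_iff_0 by blast
  moreover have "p \<noteq> 0"
    using p[of 0] assms(4) by auto
  ultimately have "q = 0" by simp
  then show ?thesis using q[of 1] by simp
qed

lemma sum_fun_apply: "(\<Sum>i\<in>I. f i) x = (\<Sum>i\<in>I. f i x)"
  by (induction I rule: infinite_finite_induct) auto

lemma family_dependent:
  fixes f :: "'a \<Rightarrow> 'i \<Rightarrow> 'k::field"
  assumes "finite I" "finite B" "f ` I \<subseteq> coord_span B" "card B < card I"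
  obtains c where "\<exists>i\<in>I. c i \<noteq> 0" "\<And>x. (\<Sum>i\<in>I. c i * f i x) = 0"
proof (cases "inj_on f I")
  case True
  have "coord.dependent (f ` I)"
    using coord.independent_span_bound[OF assms(2) _ assms(3)] assms(4) card_image[OF True] by auto
  then obtain u where u: "\<exists>v\<in>f ` I. u v \<noteq> 0" "(\<Sum>v\<in>f ` I. vec_scale (u v) v) = 0"
    using coord.dependent_finite[of "f ` I"] assms(1) by auto
  from u(2) True have "(\<Sum>i\<in>I. vec_scale (u (f i)) (f i)) = 0"
    by (simp add: sum.reindex)
  then have "(\<Sum>i\<in>I. vec_scale (u (f i)) (f i)) x = 0" for x
    by simp
  then have "(\<Sum>i\<in>I. u (f i) * f i x) = 0" for x
    by (simp only: sum_fun_apply) (simp add: vec_scale_def)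
  then show ?thesis using u(1) by (intro that[of "\<lambda>i. u (f i)"]) auto
next
  case False
  then obtain i j where ij: "i \<in> I" "j \<in> I" "i \<noteq> j" "f i = f j"
    unfolding inj_on_def by blast
  let ?c = "\<lambda>l. if l = i then 1 else if l = j then -1 else (0::'k)"
  have "(\<Sum>l\<in>I. ?c l * f l x) = (\<Sum>l\<in>{i, j}. ?c l * f l x)" for x
    using ij assms(1) by (intro sum.mono_neutral_right) auto
  then have "(\<Sum>l\<in>I. ?c l * f l x) = 0" for x
    using ij by simp
  then show ?thesis using ij by (intro that[of ?c]) auto
qed

lemma polyfuns_monomial_comp:
  assumes "\<And>i. i < n \<Longrightarrow> G i \<in> polyfuns m e" "as \<in> exps n D"
  shows "(\<lambda>x. monomial (\<lambda>i. G i x) as) \<in> polyfuns m (n * (D * e))"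
proof -
  have pow: "(\<lambda>x. g x ^ j) \<in> polyfuns m (j * e)" if "g \<in> polyfuns m e" for g :: "(nat \<Rightarrow> 'a) \<Rightarrow> 'a"
    and j
  proof (induction j)
    case 0
    have "(\<lambda>x. monomial x (replicate m 0)) \<in> polyfuns m 0"
      by (rule polyfuns_monom) (auto simp: exps_def)
    then show ?case by (simp add: monomial_def)
  next
    case (Suc j)
    from polyfuns_mult[OF that this] show ?case by simp
  qed
  have "(\<lambda>x. \<Prod>i<k. G i x ^ (as ! i)) \<in> polyfuns m (k * (D * e))" if "k \<le> n" for k
    using that
  proof (induction k)
    case 0
    show ?case using pow[OF polyfuns_zero, of 0] by simp
  next
    case (Suc k)
    have "(\<lambda>x. G k x ^ (as ! k)) \<in> polyfuns m (D * e)"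
      using pow[OF assms(1)[of k], of "as ! k"] exps_nth[OF assms(2), of k] Suc.prems
        polyfuns_mono[of "as ! k * e" "D * e" m] by auto
    from polyfuns_mult[OF Suc.IH this] Suc.prems show ?case
      by (simp add: algebra_simps)
  qed
  from this[of n] show ?thesis
    using length_exps[OF assms(2)] by (simp add: monomial_def)
qed

text \<open>The monomials in the functions \<open>G i\<close> with exponents at most \<open>D\<close> form a family of size
  \<open>(D + 1)\<^sup>n\<close>, whereas their span has dimension of order \<open>D\<^sup>m\<close>.\<close>

lemma algebraic_relation:
  fixes G :: "nat \<Rightarrow> (nat \<Rightarrow> 'k::field) \<Rightarrow> 'k"
  assumes G: "\<And>i. i < n \<Longrightarrow> polyfun m (G i)" and "m < n"
  obtains D c where "\<exists>as\<in>exps n D. c as \<noteq> 0"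
    "\<And>x. (\<Sum>as\<in>exps n D. c as * monomial (\<lambda>i. G i x) as) = 0"
proof -
  from G obtain d where d: "\<And>i. i < n \<Longrightarrow> G i \<in> polyfuns m (d i)"
    unfolding polyfun_def by metis
  define e where "e = Suc (\<Sum>i<n. d i)"
  have Ge: "G i \<in> polyfuns m e" if "i < n" for i
  proof -
    have "d i \<le> (\<Sum>i<n. d i)" using that by (intro member_le_sum) auto
    then show ?thesis using d[OF that] polyfuns_mono[of "d i" e m] by (auto simp: e_def)
  qed
  \<comment> \<open>The dimension is at most \<open>(n * e * (D + 1))\<^sup>m\<close>, and this value of \<open>D\<close> makes it
      \<open>D * (D + 1)\<^sup>m\<close>.\<close>
  define D where "D = (n * e) ^ m"
  have ne: "n * e \<ge> 1" using assms(2) by (auto simp: e_def)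
  have "Suc (n * (D * e)) \<le> n * e * Suc D"
    using ne by (simp add: algebra_simps)
  then have "Suc (n * (D * e)) ^ m \<le> (n * e * Suc D) ^ m"
    by (rule power_mono) simp
  also have "\<dots> = D * Suc D ^ m"
    by (simp only: D_def power_mult_distrib)
  also have "\<dots> < Suc D ^ Suc m"
    by simp
  also have "\<dots> \<le> Suc D ^ n"
    using assms(2) by (intro power_increasing) auto
  finally have lt: "Suc (n * (D * e)) ^ m < Suc D ^ n" .
  let ?B = "(\<lambda>as x :: nat \<Rightarrow> 'k. monomial x as) ` exps m (n * (D * e))"
  have "card ?B \<le> Suc (n * (D * e)) ^ m"
    using card_image_le[OF finite_exps] card_exps by metis
  with lt have card: "card ?B < card (exps n D)"
    by (simp add: card_exps)
  have sub: "(\<lambda>as x. monomial (\<lambda>i. G i x) as) ` exps n D \<subseteq> coord_span ?B"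
    unfolding polyfuns_def[symmetric] using polyfuns_monomial_comp[of n G m e, OF Ge] by auto
  show ?thesis
    by (rule family_dependent[OF finite_exps[of n D] _ sub card]) (auto intro: that)
qed

text \<open>Along the line through the origin in direction \<open>s\<close> a relation becomes a polynomial in
  \<open>t\<close>; its coefficient of lowest possible degree is the lowest homogeneous part of the relation,
  evaluated at \<open>s\<close>. As this holds for all \<open>s\<close>, the lowest homogeneous part is zero.\<close>

lemma lowest_terms_independent:
  fixes G :: "nat \<Rightarrow> (nat \<Rightarrow> 'k::field_char_0) \<Rightarrow> 'k"
  assumes G: "\<And>s i. i < n \<Longrightarrow> \<exists>q. \<forall>t. G i (\<lambda>j. t * s j) = t * (s i + t * poly q t)"
    and rel: "\<And>x. (\<Sum>as\<in>exps n D. c as * monomial (\<lambda>i. G i x) as) = 0"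
    and as: "as \<in> exps n D"
  shows "c as = 0"
proof (rule ccontr)
  assume "c as \<noteq> 0"
  define N where "N = (LEAST k. \<exists>as\<in>exps n D. c as \<noteq> 0 \<and> sum_list as = k)"
  have "\<exists>as\<in>exps n D. c as \<noteq> 0 \<and> sum_list as = N"
    unfolding N_def by (rule LeastI_ex) (use \<open>c as \<noteq> 0\<close> as in blast)
  then obtain bs where bs: "bs \<in> exps n D" "c bs \<noteq> 0" "sum_list bs = N" by blast
  have low: "sum_list as \<ge> N" if "as \<in> exps n D" "c as \<noteq> 0" for as
    unfolding N_def using that by (intro Least_le) blast
  let ?c = "\<lambda>as. if sum_list as = N then c as else 0"
  have "(\<Sum>as\<in>exps n D. ?c as * monomial s as) = 0" for s
  proof -
    have "\<forall>i. \<exists>q. i < n \<longrightarrow> (\<forall>t. G i (\<lambda>j. t * s j) = t * (s i + t * poly q t))"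
      using G[of _ s] by blast
    from choice[OF this] obtain q
      where q: "\<And>i t. i < n \<Longrightarrow> G i (\<lambda>j. t * s j) = t * (s i + t * poly (q i) t)"
      by blast
    let ?h = "\<lambda>i. [:s i, 1:] + pCons 0 (q i) - [:0, 1:]"
    have h: "poly (?h i) t = s i + t * poly (q i) t" for i t by simp
    have monomial: "monomial (\<lambda>i. G i (\<lambda>j. t * s j)) as = t ^ sum_list as * poly (monomial ?h as) t"
      if "as \<in> exps n D" for as t
    proof -
      have "monomial (\<lambda>i. G i (\<lambda>j. t * s j)) as = (\<Prod>i<n. (t * poly (?h i) t) ^ (as ! i))"
        unfolding monomial_def length_exps[OF that] by (intro prod.cong refl) (simp add: q h)
      also have "\<dots> = t ^ (\<Sum>i<n. as ! i) * (\<Prod>i<n. poly (?h i) t ^ (as ! i))"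
        by (simp only: power_mult_distrib prod.distrib power_sum)
      also have "(\<Sum>i<n. as ! i) = sum_list as"
        using length_exps[OF that] by (simp add: sum_list_sum_nth atLeast0LessThan)
      finally show ?thesis
        unfolding monomial_def length_exps[OF that] by (simp add: poly_prod)
    qed
    let ?P = "\<Sum>as\<in>exps n D. Polynomial.smult (c as) (monom 1 (sum_list as - N) * monomial ?h as)"
    have "poly (monom 1 N * ?P) t = 0" for t
    proof -
      have "poly (monom 1 N * ?P) t =
          (\<Sum>as\<in>exps n D. c as * (t ^ N * t ^ (sum_list as - N) * poly (monomial ?h as) t))"
        by (simp add: poly_sum poly_monom sum_distrib_left mult_ac)
      also have "\<dots> = (\<Sum>as\<in>exps n D. c as * monomial (\<lambda>i. G i (\<lambda>j. t * s j)) as)"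
      proof (intro sum.cong refl)
        fix as assume as: "as \<in> exps n D"
        show "c as * (t ^ N * t ^ (sum_list as - N) * poly (monomial ?h as) t) =
          c as * monomial (\<lambda>i. G i (\<lambda>j. t * s j)) as"
          using low[OF as] monomial[OF as, of t] by (cases "c as = 0") (auto simp flip: power_add)
      qed
      finally show ?thesis using rel by simp
    qed
    then have "monom 1 N * ?P = 0" using poly_all_0_iff_0 by blast
    then have "?P = 0" by (simp add: monom_eq_0_iff)
    then have "poly ?P 0 = 0" by simp
    moreover have "poly ?P 0 = (\<Sum>as\<in>exps n D. ?c as * monomial s as)"
      unfolding poly_sum
    proof (intro sum.cong refl)
      fix as assume as: "as \<in> exps n D"
      have "poly (monomial ?h as) 0 = monomial s as"
        unfolding monomial_def by (simp add: poly_prod)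
      then show "poly (Polynomial.smult (c as) (monom 1 (sum_list as - N) * monomial ?h as)) 0 =
        ?c as * monomial s as"
        using low[OF as] by (cases "c as = 0") (auto simp: poly_monom)
    qed
    ultimately show ?thesis by simp
  qed
  from monomial_independent[OF this bs(1)] bs show False by simp
qed

section \<open>Polynomials vanishing on cones\<close>

definition vanishes :: "('i, 'k::field) cpoly \<Rightarrow> ('i \<Rightarrow> 'k) set \<Rightarrow> bool" where
  "vanishes F C \<longleftrightarrow> (\<forall>v\<in>C. cpoly_eval F v = 0)"

text \<open>The Zariski topology is defined by homogeneous polynomials, but the algebraic relations
  in the following are not homogeneous. On cones this makes no difference, because a polynomial
  vanishes on a cone if and only if its homogeneous components do.\<close>

definition hom_component :: "nat \<Rightarrow> ('i, 'k::field) cpoly \<Rightarrow> ('i, 'k) cpoly" where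
  "hom_component n F =
     (\<Sum>m | m \<in> Poly_Mapping.keys F \<and> (\<Sum>i\<in>Poly_Mapping.keys m. Poly_Mapping.lookup m i) = n.
        Poly_Mapping.single m (Poly_Mapping.lookup F m))"

abbreviation mdeg :: "('i \<Rightarrow>\<^sub>0 nat) \<Rightarrow> nat" where
  "mdeg m \<equiv> (\<Sum>i\<in>Poly_Mapping.keys m. Poly_Mapping.lookup m i)"

lemma homogeneous_hom_component: "homogeneous (hom_component n F)"
  unfolding homogeneous_def
proof (intro exI[of _ n] ballI)
  fix m assume "m \<in> Poly_Mapping.keys (hom_component n F)"
  moreover have "Poly_Mapping.keys (hom_component n F) \<subseteq>
      (\<Union>m\<in>{m. m \<in> Poly_Mapping.keys F \<and> mdeg m = n}.
        Poly_Mapping.keys (Poly_Mapping.single m (Poly_Mapping.lookup F m)))"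
    unfolding hom_component_def by (rule Poly_Mapping.keys_sum)
  ultimately show "mdeg m = n" by (auto split: if_splits)
qed

lemma eval_hom_component:
  "cpoly_eval (hom_component n F) v =
     (\<Sum>m | m \<in> Poly_Mapping.keys F \<and> mdeg m = n. Poly_Mapping.lookup F m * monom_eval m v)"
  by (simp add: hom_component_def cpoly_eval_sum)

lemma eval_scale_components:
  obtains N where
    "\<And>c v. cpoly_eval F (vec_scale c v) = (\<Sum>n\<le>N. cpoly_eval (hom_component n F) v * c ^ n)"
    "\<And>n. n > N \<Longrightarrow> hom_component n F = 0"
proof -
  define N where "N = Max (insert 0 (mdeg ` Poly_Mapping.keys F))"
  have N: "mdeg m \<le> N" if "m \<in> Poly_Mapping.keys F" for m
    unfolding N_def using that by (intro Max_ge) auto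
  have "cpoly_eval F (vec_scale c v) = (\<Sum>n\<le>N. cpoly_eval (hom_component n F) v * c ^ n)" for c v
  proof -
    have "cpoly_eval F (vec_scale c v) =
        (\<Sum>m\<in>Poly_Mapping.keys F. Poly_Mapping.lookup F m * monom_eval m v * c ^ mdeg m)"
      by (simp add: cpoly_eval_def monom_eval_scale mult_ac)
    also have "\<dots> = (\<Sum>n\<le>N. \<Sum>m | m \<in> Poly_Mapping.keys F \<and> mdeg m = n.
        Poly_Mapping.lookup F m * monom_eval m v * c ^ mdeg m)"
      using N by (intro sum.group[symmetric]) auto
    also have "\<dots> = (\<Sum>n\<le>N. cpoly_eval (hom_component n F) v * c ^ n)"
      unfolding eval_hom_component sum_distrib_right by (intro sum.cong refl) auto
    finally show ?thesis .
  qed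
  moreover have "hom_component n F = 0" if "n > N" for n
  proof -
    have none: "{m. m \<in> Poly_Mapping.keys F \<and> mdeg m = n} = {}"
      using that by (auto dest!: N)
    show ?thesis unfolding hom_component_def none by simp
  qed
  ultimately show ?thesis by (rule that)
qed

definition cone :: "('i \<Rightarrow> 'k::field) set \<Rightarrow> bool" where
  "cone C \<longleftrightarrow> (\<forall>c. \<forall>v\<in>C. vec_scale c v \<in> C)"

text \<open>On the line through \<open>v\<close> the polynomial \<open>F\<close> is a univariate polynomial in the scalar, with
  the values of the homogeneous components at \<open>v\<close> as coefficients.\<close>

lemma vanishes_cone_iff:
  fixes F :: "('i, 'k::field_char_0) cpoly"
  assumes "cone C"
  shows "vanishes F C \<longleftrightarrow> (\<forall>n. vanishes (hom_component n F) C)"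
proof -
  obtain N where N:
    "\<And>c v. cpoly_eval F (vec_scale c v) = (\<Sum>n\<le>N. cpoly_eval (hom_component n F) v * c ^ n)"
    "\<And>n. n > N \<Longrightarrow> hom_component n F = 0"
    by (rule eval_scale_components[of F]) blast
  have one: "vec_scale 1 v = v" for v :: "'i \<Rightarrow> 'k"
    by (simp add: vec_scale_def)
  show ?thesis
  proof
    assume F: "vanishes F C"
    show "\<forall>n. vanishes (hom_component n F) C"
      unfolding vanishes_def
    proof (intro allI ballI)
      fix n v assume v: "v \<in> C"
      then have "(\<Sum>n\<le>N. cpoly_eval (hom_component n F) v * c ^ n) = 0" for c
        using assms F unfolding N(1)[symmetric] cone_def vanishes_def by blast
      then show "cpoly_eval (hom_component n F) v = 0"
        using coeffs_zero[where D = N and j = n and a = "\<lambda>n. cpoly_eval (hom_component n F)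
          v"] N(2)[of n]
        by (cases "n \<le> N") auto
    qed
  next
    assume "\<forall>n. vanishes (hom_component n F) C"
    then show "vanishes F C"
      unfolding vanishes_def using N(1)[of 1] by (simp add: one)
  qed
qed

lemma cone_proj_points: "Z \<subseteq> proj_space V \<Longrightarrow> cone (\<Union>Z)"
  unfolding cone_def proj_space_def proj_point_def
  by (blast intro: coord.span_scale)

lemma vanishes_mono: "vanishes F C \<Longrightarrow> C' \<subseteq> C \<Longrightarrow> vanishes F C'"
  by (auto simp: vanishes_def)

lemma in_zero_locus_iff: "p \<in> zero_locus V S \<longleftrightarrow> p \<in> proj_space V \<and> (\<forall>F\<in>S. vanishes F p)"
  by (simp add: zero_locus_def vanishes_def)

lemma zero_locus_inter:
  assumes "Z \<subseteq> proj_space V"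
  shows "Z \<subseteq> zero_locus V S \<longleftrightarrow> (\<forall>F\<in>S. vanishes F (\<Union>Z))"
  using assms unfolding zero_locus_def vanishes_def by blast

lemma closedin_subtopology_zariski:
  "closedin (subtopology (zariski V) Y) A \<longleftrightarrow>
     (\<exists>S. (\<forall>F\<in>S. homogeneous F) \<and> A = zero_locus V S \<inter> Y)"
  unfolding closedin_subtopology closedin_zariski by blast

lemma vanishes_closure:
  fixes F :: "('i, 'k::field_char_0) cpoly"
  assumes "P \<subseteq> proj_space V" "vanishes F (\<Union>P)"
  shows "vanishes F (\<Union>(zariski V closure_of P))"
proof -
  have sub: "zariski V closure_of P \<subseteq> proj_space V"
    using closure_of_subset_topspace[of "zariski V" P] by simp
  have "vanishes (hom_component n F) (\<Union>(zariski V closure_of P))" for n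
  proof -
    have "vanishes (hom_component n F) (\<Union>P)"
      using assms vanishes_cone_iff[OF cone_proj_points[OF assms(1)]] by blast
    then have "P \<subseteq> zero_locus V {hom_component n F}"
      using zero_locus_inter[OF assms(1)] by blast
    moreover have "closedin (zariski V) (zero_locus V {hom_component n F})"
      unfolding closedin_zariski
      by (intro exI[of _ "{hom_component n F}"]) (simp add: homogeneous_hom_component)
    ultimately have "zariski V closure_of P \<subseteq> zero_locus V {hom_component n F}"
      by (rule closure_of_minimal)
    then show ?thesis
      using zero_locus_inter[OF sub] by blast
  qed
  then show ?thesis
    using vanishes_cone_iff[OF cone_proj_points[OF sub]] by blast
qed

section \<open>Irreducibility\<close>

text \<open>For homogeneous \<open>G\<close> this is the irreducibility of \<open>Z\<close>. In general \<open>F\<close> times a component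
  of \<open>G\<close> vanishes on \<open>Z\<close>, since on every line in the cone \<open>F\<close> is either zero or a nonzero multiple
  of a power of the scalar.\<close>

lemma irreducible_vanishes:
  fixes V :: "('i \<Rightarrow> 'k::field_char_0) set"
  assumes Z: "Z \<subseteq> proj_space V" and irr: "irreducible_space (subtopology (zariski V) Z)"
    and F: "homogeneous F" "\<not> vanishes F (\<Union>Z)" and FG: "vanishes (F * G) (\<Union>Z)"
  shows "vanishes G (\<Union>Z)"
proof -
  have cone: "cone (\<Union>Z)" using Z by (rule cone_proj_points)
  have top: "topspace (subtopology (zariski V) Z) = Z"
    using Z by auto
  have "vanishes (hom_component n G) (\<Union>Z)" for n
  proof -
    let ?G = "hom_component n G"
    have FGn: "cpoly_eval F v * cpoly_eval ?G v = 0" if v: "v \<in> \<Union>Z" for v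
    proof (cases "cpoly_eval F v = 0")
      case False
      obtain d where d: "\<And>c v. cpoly_eval F (vec_scale c v) = c ^ d * cpoly_eval F v"
        using homogeneous_eval_scale[OF F(1)] by blast
      obtain N where N:
        "\<And>c v. cpoly_eval G (vec_scale c v) = (\<Sum>n\<le>N. cpoly_eval (hom_component n G) v * c ^ n)"
        "\<And>n. n > N \<Longrightarrow> hom_component n G = 0"
        by (rule eval_scale_components[of G]) blast
      let ?p = "\<Sum>n\<le>N. monom (cpoly_eval (hom_component n G) v) n"
      have pG: "poly ?p c = cpoly_eval G (vec_scale c v)" for c
        by (simp add: N(1) poly_sum poly_monom)
      have "poly (monom 1 d * ?p) c = 0" for c
      proof -
        have "vec_scale c v \<in> \<Union>Z"
          using cone v unfolding cone_def by blast
        then have "cpoly_eval F (vec_scale c v) * cpoly_eval G (vec_scale c v) = 0"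
          using FG unfolding vanishes_def cpoly_eval_mult by blast
        then have "c ^ d * cpoly_eval G (vec_scale c v) = 0"
          using False by (simp add: d)
        then show ?thesis
          by (simp add: pG poly_monom del: poly_sum)
      qed
      then have "monom 1 d * ?p = 0"
        using poly_all_0_iff_0 by blast
      then have "?p = 0" by (simp add: monom_eq_0_iff)
      then have "coeff ?p n = 0" by simp
      then have "n \<le> N \<Longrightarrow> cpoly_eval ?G v = 0"
        by (simp add: coeff_sum)
      then show ?thesis using N(2)[of n] by (cases "n \<le> N") auto
    qed simp
    have "Z \<subseteq> zero_locus V {F} \<union> zero_locus V {?G}"
    proof
      fix p assume p: "p \<in> Z"
      then obtain v where v: "p = proj_point v"
        using Z unfolding proj_space_def by blast
      have "v \<in> p" by (simp add: v proj_point_def coord.span_base)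
      then have "cpoly_eval F v = 0 \<or> cpoly_eval ?G v = 0"
        using FGn[of v] p by auto
      then show "p \<in> zero_locus V {F} \<union> zero_locus V {?G}"
        using p Z proj_point_in_zero_locus[of "{F}" v V] F(1)
          proj_point_in_zero_locus[of "{?G}" v V] homogeneous_hom_component[of n G] v by auto
    qed
    then have "(zero_locus V {F} \<inter> Z) \<union> (zero_locus V {?G} \<inter> Z) = Z"
      by blast
    moreover have "closedin (subtopology (zariski V) Z) (zero_locus V {F} \<inter> Z)"
      unfolding closedin_subtopology_zariski using F(1) by (intro exI[of _ "{F}"]) simp
    moreover have "closedin (subtopology (zariski V) Z) (zero_locus V {?G} \<inter> Z)"
      unfolding closedin_subtopology_zariski
      by (intro exI[of _ "{?G}"]) (simp add: homogeneous_hom_component)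
    ultimately have "zero_locus V {F} \<inter> Z = Z \<or> zero_locus V {?G} \<inter> Z = Z"
      using irr unfolding irreducible_space_def top by blast
    moreover have "\<not> Z \<subseteq> zero_locus V {F}"
      using F(2) zero_locus_inter[OF Z] by blast
    ultimately have "Z \<subseteq> zero_locus V {?G}" by blast
    then show ?thesis
      using zero_locus_inter[OF Z] by blast
  qed
  then show ?thesis
    using vanishes_cone_iff[OF cone] by blast
qed

lemma irreducible_spaceI:
  fixes V :: "('i \<Rightarrow> 'k::field_char_0) set"
  assumes Z: "Z \<subseteq> proj_space V" "Z \<noteq> {}"
    and prime: "\<And>F G. homogeneous F \<Longrightarrow> homogeneous G \<Longrightarrow> vanishes (F * G) (\<Union>Z) \<Longrightarrow>
      vanishes F (\<Union>Z) \<or> vanishes G (\<Union>Z)"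
  shows "irreducible_space (subtopology (zariski V) Z)"
proof -
  have top: "topspace (subtopology (zariski V) Z) = Z"
    using Z by auto
  show ?thesis
    unfolding irreducible_space_def top
  proof (intro conjI allI impI)
    show "Z \<noteq> {}" by fact
    fix A B
    assume "closedin (subtopology (zariski V) Z) A" "closedin (subtopology (zariski V) Z) B"
      and AB: "A \<union> B = Z"
    then obtain S T where S: "\<forall>F\<in>S. homogeneous F" "A = zero_locus V S \<inter> Z"
      and T: "\<forall>F\<in>T. homogeneous F" "B = zero_locus V T \<inter> Z"
      unfolding closedin_subtopology_zariski by blast
    show "A = Z \<or> B = Z"
    proof (rule ccontr)
      assume "\<not> (A = Z \<or> B = Z)"
      then have "\<not> Z \<subseteq> zero_locus V S" "\<not> Z \<subseteq> zero_locus V T"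
        using S(2) T(2) by blast+
      then obtain F G where F: "F \<in> S" "\<not> vanishes F (\<Union>Z)" and G: "G \<in> T" "\<not> vanishes G (\<Union>Z)"
        unfolding zero_locus_inter[OF Z(1)] by blast
      have "vanishes (F * G) (\<Union>Z)"
        unfolding vanishes_def cpoly_eval_mult
      proof
        fix v assume "v \<in> \<Union>Z"
        then obtain p where p: "p \<in> Z" "v \<in> p" by blast
        with AB S(2) T(2) have "p \<in> zero_locus V S \<or> p \<in> zero_locus V T" by blast
        then show "cpoly_eval F v * cpoly_eval G v = 0"
          using p F(1) G(1) unfolding zero_locus_def by auto
      qed
      then show False
        using prime F G S(1) T(1) by blast
    qed
  qed
qed

section \<open>Upper bounds for the Krull dimension\<close>

lemma cpoly_eval_1 [simp]: "cpoly_eval 1 v = 1"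
  using cpoly_eval_single[of 0 1 v] by (simp add: monom_eval_def)

lemma cpoly_eval_power: "cpoly_eval (F ^ n) v = cpoly_eval F v ^ n"
  by (induction n) (auto simp: cpoly_eval_mult)

lemma cpoly_eval_prod: "cpoly_eval (\<Prod>a\<in>A. f a) v = (\<Prod>a\<in>A. cpoly_eval (f a) v)"
  by (induction A rule: infinite_finite_induct) (auto simp: cpoly_eval_mult)

lemma cpoly_eval_monomial: "cpoly_eval (monomial F as) v = monomial (\<lambda>i. cpoly_eval (F i) v) as"
  by (simp add: monomial_def cpoly_eval_prod cpoly_eval_power)

definition cconst :: "'k \<Rightarrow> ('i, 'k::field) cpoly" where
  "cconst c = Poly_Mapping.single 0 c"

lemma cpoly_eval_cconst [simp]: "cpoly_eval (cconst c) v = c"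
  by (simp add: cconst_def monom_eval_def)

definition cvar :: "'i \<Rightarrow> ('i, 'k::field) cpoly" where
  "cvar t = Poly_Mapping.single (Poly_Mapping.single t 1) 1"

lemma cpoly_eval_cvar [simp]: "cpoly_eval (cvar t) v = v t"
  by (simp add: cvar_def monom_eval_def)

lemma homogeneous_cvar: "homogeneous (cvar t)"
  by (auto simp: cvar_def homogeneous_def)

definition alg_indep_on :: "nat \<Rightarrow> (nat \<Rightarrow> ('i, 'k::field) cpoly) \<Rightarrow> ('i \<Rightarrow> 'k) set \<Rightarrow> bool" where
  "alg_indep_on n F C \<longleftrightarrow> (\<forall>D c. (\<forall>v\<in>C. (\<Sum>as\<in>exps n D. c as * monomial (\<lambda>i. cpoly_eval (F i) v) as) = 0)
     \<longrightarrow> (\<forall>as\<in>exps n D. c as = 0))"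

lemma alg_indep_on_0: "C \<noteq> {} \<Longrightarrow> alg_indep_on 0 F C"
  by (auto simp: alg_indep_on_def)

text \<open>The coefficients of a relation with respect to the powers of \<open>F n\<close> are polynomials in the
  earlier members. A power of \<open>F n\<close> that divides the relation can be cancelled on \<open>C\<close>; then the
  terms that still contain \<open>F n\<close> vanish on \<open>C'\<close>, and what remains there is a relation between the
  earlier members.\<close>

lemma alg_indep_on_Suc:
  fixes F :: "nat \<Rightarrow> ('i, 'k::field) cpoly"
  assumes indep: "alg_indep_on n F C'" and sub: "C' \<subseteq> C" and zero: "vanishes (F n) C'"
    and cancel: "\<And>G. vanishes (F n * G) C \<Longrightarrow> vanishes G C"
  shows "alg_indep_on (Suc n) F C"
  unfolding alg_indep_on_def
proof (intro allI impI)
  fix D and c :: "nat list \<Rightarrow> 'k"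
  assume rel: "\<forall>v\<in>C. (\<Sum>as\<in>exps (Suc n) D. c as * monomial (\<lambda>i. cpoly_eval (F i) v) as) = 0"
  define P where "P j = (\<Sum>as\<in>exps n D. cconst (c (as @ [j])) * monomial F as)" for j
  have P: "cpoly_eval (P j) v = (\<Sum>as\<in>exps n D. c (as @ [j]) * monomial (\<lambda>i. cpoly_eval (F i) v) as)"
    for j v by (simp add: P_def cpoly_eval_sum cpoly_eval_mult cpoly_eval_monomial)
  have cancel_pow: "vanishes G C" if "vanishes (F n ^ k * G) C" for k G
    using that
  proof (induction k)
    case (Suc k)
    then have "vanishes (F n * (F n ^ k * G)) C" by (simp add: mult.assoc)
    from Suc.IH[OF cancel[OF this]] show ?case .
  qed simp
  have coeffs: "\<forall>j<k. \<forall>as\<in>exps n D. c (as @ [j]) = 0" if "k \<le> Suc D" for k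
    using that
  proof (induction k)
    case (Suc k)
    then have k: "k \<le> D" and IH: "\<And>j as. j < k \<Longrightarrow> as \<in> exps n D \<Longrightarrow> c (as @ [j]) = 0" by auto
    let ?G = "\<Sum>j\<in>{k..D}. P j * F n ^ (j - k)"
    have "vanishes (F n ^ k * ?G) C"
      unfolding vanishes_def
    proof
      fix v assume v: "v \<in> C"
      have "cpoly_eval (F n ^ k * ?G) v = (\<Sum>j\<in>{k..D}. cpoly_eval (P j) v * cpoly_eval (F n) v ^ j)"
        unfolding cpoly_eval_mult cpoly_eval_sum cpoly_eval_power sum_distrib_left
        by (intro sum.cong refl) (simp add: mult_ac flip: power_add)
      also have "\<dots> = (\<Sum>j\<le>D. cpoly_eval (P j) v * cpoly_eval (F n) v ^ j)"
        using IH by (intro sum.mono_neutral_left) (auto simp: P)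
      also have "\<dots> = (\<Sum>as\<in>exps (Suc n) D. c as * monomial (\<lambda>i. cpoly_eval (F i) v) as)"
        unfolding sum_exps_Suc P sum_distrib_right
        by (intro sum.cong refl) (simp add: monomial_snoc length_exps)
      finally show "cpoly_eval (F n ^ k * ?G) v = 0"
        using rel v by simp
    qed
    then have "vanishes ?G C'"
      using cancel_pow sub vanishes_mono by blast
    have "cpoly_eval (P k) v = 0" if v: "v \<in> C'" for v
    proof -
      have z: "cpoly_eval (F n) v = 0"
        using zero v by (simp add: vanishes_def)
      have "cpoly_eval ?G v = (\<Sum>j\<in>{k..D}. if j = k then cpoly_eval (P k) v else 0)"
        unfolding cpoly_eval_sum cpoly_eval_mult cpoly_eval_power
        by (intro sum.cong refl) (auto simp: z)
      then have "cpoly_eval ?G v = cpoly_eval (P k) v"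
        using k by simp
      then show ?thesis
        using \<open>vanishes ?G C'\<close> v by (simp add: vanishes_def)
    qed
    then have "\<forall>as\<in>exps n D. c (as @ [k]) = 0"
      using indep[unfolded alg_indep_on_def, rule_format, where D = D and c = "\<lambda>as. c (as @ [k])"]
      unfolding P by blast
    then show ?case using IH by (auto simp: less_Suc_eq)
  qed simp
  show "\<forall>as\<in>exps (Suc n) D. c as = 0"
    using coeffs[of "Suc D"] by (auto elim!: exps_SucE)
qed

lemma zero_in_proj_points: "p \<in> proj_space V \<Longrightarrow> 0 \<in> p"
  by (auto simp: proj_space_def proj_point_def coord.span_zero)

text \<open>Every step of the chain adds an equation that holds on the smaller set but not on the
  larger one. The origin serves as a cone below that over \<open>Z 0\<close>: every coordinate vanishes there,
  and some coordinate does not vanish on \<open>Z 0\<close>. So the chain yields one polynomial more than it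
  has steps.\<close>

lemma chain_alg_indep:
  fixes V :: "('i \<Rightarrow> 'k::field_char_0) set"
  assumes Y: "Y \<subseteq> proj_space V"
    and Z: "\<And>i. i \<le> n \<Longrightarrow> closedin (subtopology (zariski V) Y) (Z i)"
    and irr: "\<And>i. i \<le> n \<Longrightarrow> irreducible_space (subtopology (subtopology (zariski V) Y) (Z i))"
    and strict: "\<And>i. i < n \<Longrightarrow> Z i \<subset> Z (Suc i)"
  shows "\<exists>F. alg_indep_on (Suc n) F (\<Union>(Z n))"
proof -
  have ZY: "Z i \<subseteq> Y" if "i \<le> n" for i
    using closedin_subset[OF Z[OF that]] by auto
  have ZP: "Z i \<subseteq> proj_space V" if "i \<le> n" for i
    using ZY[OF that] Y by blast
  have irr': "irreducible_space (subtopology (zariski V) (Z i))" if "i \<le> n" for i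
    using irr[OF that] ZY[OF that] by (simp add: subtopology_subtopology inf_absorb2)
  have "\<exists>F. alg_indep_on (Suc k) F (\<Union>(Z k))" if "k \<le> n" for k
    using that
  proof (induction k)
    case 0
    have "topspace (subtopology (zariski V) (Z 0)) \<noteq> {}"
      using irr'[OF 0] unfolding irreducible_space_def by blast
    then obtain p where p: "p \<in> Z 0" by auto
    then obtain v where v: "p = proj_point v" "v \<noteq> 0"
      using ZP[OF 0] unfolding proj_space_def by blast
    then obtain t where t: "v t \<noteq> 0" by (auto simp: fun_eq_iff)
    have "v \<in> \<Union>(Z 0)"
      using p v(1) by (auto simp: proj_point_def intro!: coord.span_base)
    then have nv: "\<not> vanishes (cvar t) (\<Union>(Z 0))"
      using t unfolding vanishes_def by auto
    let ?F = "\<lambda>i :: nat. cvar t :: ('i, 'k) cpoly"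
    have "alg_indep_on (Suc 0) ?F (\<Union>(Z 0))"
    proof (rule alg_indep_on_Suc)
      show "alg_indep_on 0 ?F {0}" by (rule alg_indep_on_0) simp
      show "{0} \<subseteq> \<Union>(Z 0)"
        using p zero_in_proj_points ZP[OF 0] by blast
      show "vanishes (cvar t :: ('i, 'k) cpoly) {0}"
        by (simp add: vanishes_def)
      show "vanishes G (\<Union>(Z 0))" if "vanishes (cvar t * G) (\<Union>(Z 0))" for G
        using irreducible_vanishes[OF ZP[OF 0] irr'[OF 0] homogeneous_cvar nv that] .
    qed
    then show ?case by blast
  next
    case (Suc k)
    then obtain F where F: "alg_indep_on (Suc k) F (\<Union>(Z k))" by auto
    obtain S where S: "\<forall>F\<in>S. homogeneous F" "Z k = zero_locus V S \<inter> Y"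
      using Z[of k] Suc.prems unfolding closedin_subtopology_zariski by auto
    have "Z k \<subset> Z (Suc k)" using strict Suc.prems by auto
    then have "\<not> Z (Suc k) \<subseteq> zero_locus V S" "Z k \<subseteq> zero_locus V S"
      using S(2) ZY[of "Suc k"] Suc.prems by blast+
    then obtain H where H: "H \<in> S" "\<not> vanishes H (\<Union>(Z (Suc k)))" "vanishes H (\<Union>(Z k))"
      using zero_locus_inter[OF ZP[of k]] zero_locus_inter[OF ZP[of "Suc k"]] Suc.prems by auto
    let ?F = "F(Suc k := H)"
    have "alg_indep_on (Suc (Suc k)) ?F (\<Union>(Z (Suc k)))"
    proof (rule alg_indep_on_Suc)
      have "monomial (\<lambda>i. cpoly_eval (?F i) v) as = monomial (\<lambda>i. cpoly_eval (F i) v) as"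
        if "as \<in> exps (Suc k) D" for v as D
        using length_exps[OF that] by (intro monomial_cong) auto
      then show "alg_indep_on (Suc k) ?F (\<Union>(Z k))"
        using F unfolding alg_indep_on_def by (simp cong: sum.cong del: fun_upd_apply)
      show "\<Union>(Z k) \<subseteq> \<Union>(Z (Suc k))" using \<open>Z k \<subset> Z (Suc k)\<close> by blast
      show "vanishes (?F (Suc k)) (\<Union>(Z k))" using H by simp
      show "vanishes G (\<Union>(Z (Suc k)))" if "vanishes (?F (Suc k) * G) (\<Union>(Z (Suc k)))" for G
        by (rule irreducible_vanishes[OF ZP[OF Suc.prems] irr'[OF Suc.prems]])
           (use H S(1) that in auto)
    qed
    then show ?case by blast
  qed
  then show ?thesis by blast
qed

lemma param_relation:
  fixes \<phi> :: "(nat \<Rightarrow> 'k::field_char_0) \<Rightarrow> 'i \<Rightarrow> 'k"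
  assumes \<phi>: "\<And>t. polyfun m (\<lambda>x. \<phi> x t)" and "m < n"
  obtains D c where "\<exists>as\<in>exps n D. c as \<noteq> 0"
    "\<And>x. cpoly_eval (\<Sum>as\<in>exps n D. cconst (c as) * monomial F as) (\<phi> x) = 0"
proof -
  have "polyfun m (\<lambda>x. cpoly_eval (F i) (\<phi> x))" for i
    by (rule polyfun_cpoly_eval) (rule \<phi>)
  then obtain D c where "\<exists>as\<in>exps n D. c as \<noteq> 0"
    "\<And>x. (\<Sum>as\<in>exps n D. c as * monomial (\<lambda>i. cpoly_eval (F i) (\<phi> x)) as) = 0"
    using algebraic_relation[of n m "\<lambda>i x. cpoly_eval (F i) (\<phi> x)"] assms(2) by blast
  then show ?thesis
    by (intro that[of D c]) (auto simp: cpoly_eval_sum cpoly_eval_mult cpoly_eval_monomial)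
qed

text \<open>The independent polynomials obtained from a chain in \<open>Y\<close> remain independent after
  composition with \<open>\<phi>\<close>, because a relation that holds on the image of \<open>\<phi>\<close> holds on \<open>Y\<close>.\<close>

theorem krull_dim_le_parameters:
  fixes V :: "('i \<Rightarrow> 'k::field_char_0) set"
  assumes Y: "Y \<subseteq> proj_space V" and \<phi>: "\<And>t. polyfun m (\<lambda>x. \<phi> x t)"
    and dense: "\<And>G. (\<And>x. cpoly_eval G (\<phi> x) = 0) \<Longrightarrow> vanishes G (\<Union>Y)"
  shows "krull_dim (subtopology (zariski V) Y) \<le> enat (m - 1)"
  unfolding krull_dim_def
proof (rule Sup_least, clarify)
  fix n :: nat and Z
  assume Z: "\<forall>i\<le>n. closedin (subtopology (zariski V) Y) (Z i) \<and>
      irreducible_space (subtopology (subtopology (zariski V) Y) (Z i))"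
    and strict: "\<forall>i<n. Z i \<subset> Z (Suc i)"
  obtain F where F: "alg_indep_on (Suc n) F (\<Union>(Z n))"
    using chain_alg_indep[OF Y, of n Z] Z strict by blast
  have "Z n \<subseteq> Y"
    using Z closedin_subset[of "subtopology (zariski V) Y" "Z n"] by auto
  have "\<not> m < Suc n"
  proof
    assume "m < Suc n"
    obtain D c where c: "\<exists>as\<in>exps (Suc n) D. c as \<noteq> 0"
      "\<And>x. cpoly_eval (\<Sum>as\<in>exps (Suc n) D. cconst (c as) * monomial F as) (\<phi> x) = 0"
      using param_relation[where \<phi> = \<phi> and F = F, OF \<phi> \<open>m < Suc n\<close>] by blast
    have "vanishes (\<Sum>as\<in>exps (Suc n) D. cconst (c as) * monomial F as) (\<Union>Y)"
      by (rule dense) (rule c(2))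
    then have "vanishes (\<Sum>as\<in>exps (Suc n) D. cconst (c as) * monomial F as) (\<Union>(Z n))"
      using \<open>Z n \<subseteq> Y\<close> by (meson Union_mono vanishes_mono)
    then have "\<forall>v\<in>\<Union>(Z n). (\<Sum>as\<in>exps (Suc n) D. c as * monomial (\<lambda>i. cpoly_eval (F i) v) as) = 0"
      unfolding vanishes_def cpoly_eval_sum cpoly_eval_mult cpoly_eval_monomial cpoly_eval_cconst .
    then have "\<forall>as\<in>exps (Suc n) D. c as = 0"
      using F unfolding alg_indep_on_def by blast
    then show False using c(1) by blast
  qed
  then show "enat n \<le> enat (m - 1)" by simp
qed

text \<open>A chain in \<open>Y\<close> can be prolonged by the whole space.\<close>

lemma krull_dim_closed_proper:
  assumes cl: "closedin X Y" and irr: "irreducible_space X" and ne: "Y \<noteq> topspace X"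
    and le: "krull_dim X \<le> enat (Suc N)"
  shows "krull_dim (subtopology X Y) \<le> enat N"
  unfolding krull_dim_def
proof (rule Sup_least, clarify)
  fix n :: nat and Z
  assume Z: "\<forall>i\<le>n. closedin (subtopology X Y) (Z i) \<and>
      irreducible_space (subtopology (subtopology X Y) (Z i))"
    and strict: "\<forall>i<n. Z i \<subset> Z (Suc i)"
  define W where "W = Z(Suc n := topspace X)"
  have "closedin X (W i) \<and> irreducible_space (subtopology X (W i))" if "i \<le> Suc n" for i
  proof (cases "i = Suc n")
    case True
    then show ?thesis using irr by (simp add: W_def)
  next
    case False
    with that Z have "closedin (subtopology X Y) (Z i)"
      and i: "irreducible_space (subtopology (subtopology X Y) (Z i))" by auto
    then have c: "closedin X (Z i)" "Z i \<subseteq> Y"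
      using cl closedin_closed_subtopology by blast+
    with i have "irreducible_space (subtopology X (Z i))"
      by (simp add: subtopology_subtopology inf_absorb2)
    then show ?thesis using c False by (simp add: W_def)
  qed
  moreover have "W i \<subset> W (Suc i)" if "i < Suc n" for i
  proof (cases "i = n")
    case True
    have "Z n \<subseteq> Y" "Y \<subseteq> topspace X"
      using Z closedin_subset[of "subtopology X Y" "Z n"] closedin_subset[OF cl] by auto
    then show ?thesis using ne True by (auto simp: W_def)
  next
    case False
    then show ?thesis using strict that by (auto simp: W_def)
  qed
  ultimately have "enat (Suc n) \<le> krull_dim X"
    unfolding krull_dim_def by (intro Sup_upper) blast
  also note le
  finally show "enat n \<le> enat N" by simp
qed

section \<open>Lower bounds for the Krull dimension\<close>

definition image_points :: "('a \<Rightarrow> 'i \<Rightarrow> 'k::field) \<Rightarrow> ('i \<Rightarrow> 'k) set set" where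
  "image_points \<psi> = {proj_point (\<psi> x) | x. \<psi> x \<noteq> 0}"

lemma image_points_subset: "(\<And>x. \<psi> x \<in> V) \<Longrightarrow> image_points \<psi> \<subseteq> proj_space V"
  by (auto simp: image_points_def proj_space_def)

lemma vanishes_image_points:
  "vanishes F (\<Union>(image_points \<psi>)) \<Longrightarrow> \<psi> x \<noteq> 0 \<Longrightarrow> cpoly_eval F (\<psi> x) = 0"
  by (force simp: vanishes_def image_points_def proj_point_def intro: coord.span_base)

lemma vanishes_image_pointsI:
  assumes "\<And>x c. cpoly_eval F (vec_scale c (\<psi> x)) = 0"
  shows "vanishes F (\<Union>(image_points \<psi>))"
  using assms by (auto simp: vanishes_def image_points_def proj_point_eq)

text \<open>The set \<open>Z\<close> lies between the image and its closure, so that the result applies to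
  closures relative to a subspace. The product of \<open>F\<close> and \<open>G\<close> is known to vanish only where \<open>\<psi>\<close> is
  nonzero, as the zero vector does not represent a point; multiplication with a coordinate of \<open>\<psi>\<close>
  takes care of this.\<close>

lemma irreducible_image:
  fixes \<psi> :: "(nat \<Rightarrow> 'k::field_char_0) \<Rightarrow> 'i \<Rightarrow> 'k"
  assumes \<psi>: "\<And>t. polyfun m (\<lambda>x. \<psi> x t)" and V: "\<And>x. \<psi> x \<in> V" and nz: "\<psi> x0 \<noteq> 0"
    and sub: "image_points \<psi> \<subseteq> Z" and cl: "Z \<subseteq> zariski V closure_of image_points \<psi>"
  shows "irreducible_space (subtopology (zariski V) Z)"
proof (rule irreducible_spaceI)
  have P: "image_points \<psi> \<subseteq> proj_space V"
    using V by (rule image_points_subset)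
  show "Z \<subseteq> proj_space V"
    using closure_of_subset_topspace[of "zariski V"] cl by auto
  show "Z \<noteq> {}"
    using sub nz unfolding image_points_def by blast
  fix F G :: "('i, 'k) cpoly"
  assume F: "homogeneous F" and G: "homogeneous G" and FG: "vanishes (F * G) (\<Union>Z)"
  obtain t where t: "\<psi> x0 t \<noteq> 0" using nz by (auto simp: fun_eq_iff)
  have FG0: "(cpoly_eval F (\<psi> x) * \<psi> x t) * cpoly_eval G (\<psi> x) = 0" for x
  proof (cases "\<psi> x = 0")
    case False
    then have "cpoly_eval (F * G) (\<psi> x) = 0"
      using FG sub by (intro vanishes_image_points[of _ \<psi>]) (auto intro: vanishes_mono)
    then show ?thesis by (auto simp: cpoly_eval_mult)
  qed simp
  have pF: "polyfun m (\<lambda>x. cpoly_eval F (\<psi> x) * \<psi> x t)"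
    by (intro polyfun_mult polyfun_cpoly_eval \<psi>)
  have pG: "polyfun m (\<lambda>x. cpoly_eval G (\<psi> x))"
    by (intro polyfun_cpoly_eval \<psi>)
  have hom: "vanishes H (\<Union>Z)" if "homogeneous H" "\<And>x. cpoly_eval H (\<psi> x) = 0" for H
  proof (rule vanishes_mono[OF vanishes_closure[OF P vanishes_image_pointsI]])
    show "\<Union>Z \<subseteq> \<Union>(zariski V closure_of image_points \<psi>)"
      using cl by (rule Union_mono)
    obtain n where "\<And>c v. cpoly_eval H (vec_scale c v) = c ^ n * cpoly_eval H v"
      using homogeneous_eval_scale[OF \<open>homogeneous H\<close>] by blast
    then show "cpoly_eval H (vec_scale c (\<psi> x)) = 0" for x c
      by (simp add: that(2))
  qed
  show "vanishes F (\<Union>Z) \<or> vanishes G (\<Union>Z)"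
  proof (cases "\<exists>x. cpoly_eval F (\<psi> x) * \<psi> x t \<noteq> 0")
    case True
    then have "cpoly_eval G (\<psi> y) = 0" for y
      using polyfun_mult_eq_0[OF pF pG FG0] by blast
    then show ?thesis using hom[OF G] by blast
  next
    case False
    have pF': "polyfun m (\<lambda>x. cpoly_eval F (\<psi> x))"
      by (intro polyfun_cpoly_eval \<psi>)
    have "cpoly_eval F (\<psi> y) = 0" for y
      by (rule polyfun_mult_eq_0[OF \<psi>[of t] pF' _ t]) (use False in \<open>simp add: mult.commute\<close>)
    then show ?thesis using hom[OF F] by blast
  qed
qed

text \<open>The chain consists of the closures, relative to \<open>X\<close>, of the images of the coordinate
  subspaces spanned by the first basis vectors. The first coordinate of the parameter is the
  scalar that makes these images cones, hence the base point \<open>e\<close>. The functions \<open>\<Gamma> i\<close> are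
  coordinates on the target in which \<open>\<Psi>\<close> agrees with the identity to first order at \<open>e\<close>.\<close>

theorem krull_dim_ge:
  fixes \<Psi> :: "(nat \<Rightarrow> 'k::field_char_0) \<Rightarrow> 'i \<Rightarrow> 'k" and \<Gamma> :: "nat \<Rightarrow> ('i, 'k) cpoly"
  defines "e \<equiv> (\<lambda>j :: nat. if j = 0 then 1 else 0 :: 'k)"
  assumes \<Psi>: "\<And>t. polyfun r (\<lambda>x. \<Psi> x t)" and V: "\<And>x. \<Psi> x \<in> V"
    and scale: "\<And>c x. \<Psi> (x(0 := c * x 0)) = vec_scale c (\<Psi> x)"
    and \<Gamma>: "\<And>s i. i < r \<Longrightarrow>
      \<exists>q. \<forall>t. cpoly_eval (\<Gamma> i) (\<Psi> (\<lambda>j. e j + t * s j)) = t * (s i + t * poly q t)"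
    and X: "image_points \<Psi> \<subseteq> X" and nz: "\<Psi> e \<noteq> 0"
  shows "enat (r - 1) \<le> krull_dim (subtopology (zariski V) X)"
proof -
  define \<tau> where "\<tau> j x = (\<lambda>i :: nat. if i \<le> j then x i else 0 :: 'k)" for j x
  define \<psi> where "\<psi> j x = \<Psi> (\<tau> j x)" for j x
  define Z where "Z j = (zariski V closure_of image_points (\<psi> j)) \<inter> X" for j
  have P: "image_points (\<psi> j) \<subseteq> proj_space V" for j
    by (rule image_points_subset) (simp add: \<psi>_def V)
  have sub: "image_points (\<psi> j) \<subseteq> Z j" for j
  proof -
    have "image_points (\<psi> j) \<subseteq> X"
      using X by (auto simp: image_points_def \<psi>_def)
    moreover have "image_points (\<psi> j) \<subseteq> zariski V closure_of image_points (\<psi> j)"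
      using P by (intro closure_of_subset) simp
    ultimately show ?thesis by (simp add: Z_def)
  qed
  have \<psi>_poly: "polyfun (Suc j) (\<lambda>x. \<psi> j x t)" for j t
  proof -
    have "polyfun (Suc j) (\<lambda>x. if i \<le> j then x i else 0 :: 'k)" for i
      by (cases "i \<le> j") (auto intro: polyfun_var)
    then show ?thesis
      unfolding \<psi>_def \<tau>_def by (rule polyfun_subst[OF \<Psi>])
  qed
  have \<tau>e: "\<tau> j e = e" for j
    by (auto simp: \<tau>_def e_def)
  have irr: "irreducible_space (subtopology (zariski V) (Z j))" for j
  proof (rule irreducible_image)
    show "polyfun (Suc j) (\<lambda>x. \<psi> j x t)" for t by (rule \<psi>_poly)
    show "\<psi> j x \<in> V" for x by (simp add: \<psi>_def V)
    show "\<psi> j e \<noteq> 0" by (simp add: \<psi>_def \<tau>e nz)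
    show "image_points (\<psi> j) \<subseteq> Z j" by (rule sub)
    show "Z j \<subseteq> zariski V closure_of image_points (\<psi> j)" by (simp add: Z_def)
  qed
  have \<psi>_scale: "vec_scale c (\<psi> j x) = \<psi> j (x(0 := c * x 0))" for c j x
  proof -
    have "\<tau> j (x(0 := c * x 0)) = (\<tau> j x)(0 := c * \<tau> j x 0)"
      by (auto simp: \<tau>_def fun_eq_iff)
    then show ?thesis by (simp add: \<psi>_def scale)
  qed
  have cl: "closedin (subtopology (zariski V) X) (Z j)" for j
    unfolding Z_def closedin_subtopology by (intro exI[of _ "zariski V closure_of image_points (\<psi>
      j)"]) simp
  have strict: "Z j \<subset> Z (Suc j)" if j: "Suc j < r" for j
  proof
    have "image_points (\<psi> j) \<subseteq> image_points (\<psi> (Suc j))"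
    proof -
      have "\<psi> j x = \<psi> (Suc j) (\<tau> j x)" for x
        by (auto simp: \<psi>_def \<tau>_def intro!: arg_cong[of _ _ \<Psi>])
      then show ?thesis by (auto simp: image_points_def)
    qed
    then show "Z j \<subseteq> Z (Suc j)" unfolding Z_def by (intro Int_mono closure_of_mono) simp_all
    show "Z j \<noteq> Z (Suc j)"
    proof
      assume eq: "Z j = Z (Suc j)"
      \<comment> \<open>The smaller image has \<open>j + 1\<close> parameters, hence \<open>j + 2\<close> of the coordinates satisfy a
          relation. If the closures agree, it also holds on the larger image, where these
          coordinates are independent by their terms of lowest order.\<close>
      obtain D c where c: "\<exists>as\<in>exps (j + 2) D. c as \<noteq> 0"
        "\<And>x. cpoly_eval (\<Sum>as\<in>exps (j + 2) D. cconst (c as) * monomial \<Gamma> as) (\<psi> j x) = 0"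
        using param_relation[where \<phi> = "\<psi> j" and F = \<Gamma> and m = "Suc j" and n = "j + 2"] \<psi>_poly by auto
      let ?Q = "\<Sum>as\<in>exps (j + 2) D. cconst (c as) * monomial \<Gamma> as"
      have "vanishes ?Q (\<Union>(zariski V closure_of image_points (\<psi> j)))"
        by (rule vanishes_closure[OF P vanishes_image_pointsI]) (simp only: \<psi>_scale c(2))
      then have "vanishes ?Q (\<Union>(Z j))"
        by (rule vanishes_mono) (auto simp: Z_def)
      then have QZ: "vanishes ?Q (\<Union>(image_points (\<psi> (Suc j))))"
        by (rule vanishes_mono) (use sub[of "Suc j"] in \<open>simp only: eq Union_mono\<close>)
      have Q: "cpoly_eval ?Q (\<psi> (Suc j) x) = 0" for x
      proof (cases "\<psi> (Suc j) x = 0")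
        case True
        have "vec_scale 0 (\<psi> j x) = 0" by (simp add: vec_scale_def fun_eq_iff)
        then have "\<psi> (Suc j) x = \<psi> j (x(0 := 0 * x 0))"
          using True \<psi>_scale[of 0 j x] by simp
        then show ?thesis using c(2) by simp
      qed (rule vanishes_image_points[OF QZ])
      have "c as = 0" if "as \<in> exps (j + 2) D" for as
      proof (rule lowest_terms_independent[where n = "j + 2" and D = D and c = c,
            OF _ _ that])
        fix s :: "nat \<Rightarrow> 'k" and i assume i: "i < j + 2"
        have "e l + t * \<tau> (Suc j) s l = \<tau> (Suc j) (\<lambda>l. e l + t * s l) l" for t l
          by (auto simp: \<tau>_def e_def)
        then have "\<psi> (Suc j) (\<lambda>l. e l + t * s l) = \<Psi> (\<lambda>l. e l + t * \<tau> (Suc j) s l)" for t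
          by (simp add: \<psi>_def)
        then show "\<exists>q. \<forall>t. cpoly_eval (\<Gamma> i) (\<psi> (Suc j) (\<lambda>l. e l + t * s l)) =
            t * (s i + t * poly q t)"
          using \<Gamma>[of i "\<tau> (Suc j) s"] i j by (simp add: \<tau>_def)
      next
        fix x :: "nat \<Rightarrow> 'k"
        show "(\<Sum>as\<in>exps (j + 2) D. c as *
            monomial (\<lambda>i. cpoly_eval (\<Gamma> i) (\<psi> (Suc j) (\<lambda>l. e l + x l))) as) = 0"
          using Q[of "\<lambda>l. e l + x l"] by (simp add: cpoly_eval_sum cpoly_eval_mult
            cpoly_eval_monomial)
      qed
      then show False using c(1) by blast
    qed
  qed
  have "Z i \<subset> Z (Suc i)" if "i < r - 1" for i
    using strict that by simp
  moreover have "irreducible_space (subtopology (subtopology (zariski V) X) (Z i))" for i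
    using irr[of i] by (simp add: subtopology_subtopology Z_def inf.commute inf.left_commute)
  ultimately show ?thesis
    unfolding krull_dim_def by (intro Sup_upper CollectI exI[of _ "r - 1"] conjI refl exI[of _ Z])
      (use cl in auto)
qed

text \<open>The derivative of a polynomial function of one variable at \<open>0\<close>, without limits: the
  remainder is the square of the variable times a polynomial.\<close>

definition first_order :: "('k::field \<Rightarrow> 'k) \<Rightarrow> 'k \<Rightarrow> 'k \<Rightarrow> bool" where
  "first_order f a b \<longleftrightarrow> (\<exists>q. \<forall>t. f t = a + t * (b + t * poly q t))"

lemma first_order_const: "first_order (\<lambda>t. a) a 0"
  unfolding first_order_def by (intro exI[of _ 0]) simp

lemma first_order_linear: "first_order (\<lambda>t. a + t * b) a b"
  unfolding first_order_def by (intro exI[of _ 0]) simp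

lemma first_order_add:
  assumes "first_order f a b" "first_order g c d"
  shows "first_order (\<lambda>t. f t + g t) (a + c) (b + d)"
proof -
  obtain p q where "\<And>t. f t = a + t * (b + t * poly p t)" "\<And>t. g t = c + t * (d + t * poly q t)"
    using assms unfolding first_order_def by blast
  then show ?thesis
    unfolding first_order_def by (intro exI[of _ "p + q"]) (simp add: algebra_simps)
qed

lemma first_order_mult:
  assumes "first_order f a b" "first_order g c d"
  shows "first_order (\<lambda>t. f t * g t) (a * c) (a * d + b * c)"
proof -
  obtain p q where "\<And>t. f t = a + t * (b + t * poly p t)" "\<And>t. g t = c + t * (d + t * poly q t)"
    using assms unfolding first_order_def by blast
  then show ?thesis
    unfolding first_order_def
    by (intro exI[of _ "Polynomial.smult c p + Polynomial.smult a q + [:b * d:] + [:0,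
      1:] * (Polynomial.smult b q + Polynomial.smult d p) +
         [:0, 0, 1:] * p * q"]) (simp add: algebra_simps)
qed

lemma first_order_sum:
  assumes "\<And>i. i \<in> A \<Longrightarrow> first_order (f i) (a i) (b i)"
  shows "first_order (\<lambda>t. \<Sum>i\<in>A. f i t) (\<Sum>i\<in>A. a i) (\<Sum>i\<in>A. b i)"
  using assms
proof (induction A rule: infinite_finite_induct)
  case (insert x F)
  then show ?case using first_order_add[of "f x" "a x" "b x"] by simp
qed (use first_order_const[of 0] in auto)

lemma first_order_power:
  assumes "first_order f a b"
  shows "first_order (\<lambda>t. f t ^ n) (a ^ n) (of_nat n * a ^ (n - 1) * b)"
proof (induction n)
  case 0
  then show ?case using first_order_const[of 1] by simp
next
  case (Suc n)
  from first_order_mult[OF assms Suc]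
  have "first_order (\<lambda>t. f t ^ Suc n) (a ^ Suc n) (a * (of_nat n * a ^ (n - 1) * b) + b * a ^ n)"
    by simp
  also have "a * (of_nat n * a ^ (n - 1) * b) + b * a ^ n = of_nat (Suc n) * a ^ (Suc n - 1) * b"
    by (cases n) (auto simp: algebra_simps)
  finally show ?case .
qed

text \<open>If \<open>\<phi>\<close> moves in the direction \<open>w \<beta>\<close>, then among the coordinates in \<open>A\<close> only that of \<open>\<beta>\<close>
  changes, to first order. One element \<open>\<alpha>0\<close> of \<open>A\<close> is given up for the direction of the scalar:
  moving along the ray through \<open>\<phi> p\<close> changes the coordinate of \<open>\<alpha>0\<close>, and the directions \<open>w \<beta>\<close> with
  \<open>\<beta> \<noteq> \<alpha>0\<close> do not.\<close>

theorem krull_dim_ge_tangent: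
  fixes \<phi> :: "(nat \<Rightarrow> 'k::field_char_0) \<Rightarrow> 'i \<Rightarrow> 'k"
  assumes \<phi>: "\<And>t. polyfun m (\<lambda>x. \<phi> x t)" and V: "\<And>x. \<phi> x \<in> V"
    and scale: "\<And>c x. vec_scale c (\<phi> x) = \<phi> (\<sigma> c x)"
    and X: "image_points \<phi> \<subseteq> X"
    and A: "finite A" "\<alpha>0 \<in> A" "\<phi> p \<alpha>0 \<noteq> 0"
    and tangent: "\<And>s \<alpha>. \<alpha> \<in> A \<Longrightarrow>
      first_order (\<lambda>t. \<phi> (\<lambda>j. p j + t * (\<Sum>\<beta>\<in>A. s \<beta> * w \<beta> j)) \<alpha>) (\<phi> p \<alpha>) (s \<alpha>)"
  shows "enat (card A - 1) \<le> krull_dim (subtopology (zariski V) X)"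
proof -
  define r where "r = card A"
  have "finite (A - {\<alpha>0})" using A by simp
  then obtain h where h: "bij_betw h {1..<r} (A - {\<alpha>0})"
    using ex_bij_betw_nat_finite[of "A - {\<alpha>0}"] A
      bij_betw_trans[of "\<lambda>i. i - 1" "{1..<r}" "{0..<r - 1}"]
    by (metis (no_types, lifting) bij_betw_iff_card card_Diff_singleton card_atLeastLessThan
        finite_atLeastLessThan r_def)
  define \<alpha> where "\<alpha> i = (if i = 0 then \<alpha>0 else h i)" for i :: nat
  have \<alpha>A: "\<alpha> i \<in> A" if "i < r" for i
    using that A h bij_betwE[OF h, rule_format, of i] by (auto simp: \<alpha>_def)
  define pt where "pt x = (\<lambda>j. p j + (\<Sum>i\<in>{1..<r}. x i * w (\<alpha> i) j))" for x :: "nat \<Rightarrow> 'k"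
  define \<Psi> where "\<Psi> x = vec_scale (x 0) (\<phi> (pt x))" for x :: "nat \<Rightarrow> 'k"
  define k where "k = \<phi> p \<alpha>0"
  \<comment> \<open>The derivative of the coordinates of \<open>A\<close> is triangular: the scalar changes all of them.
      Subtracting a multiple of the coordinate of \<open>\<alpha>0\<close> makes it the identity, and the constants
      move the base point to the origin.\<close>
  define \<Gamma> :: "nat \<Rightarrow> ('i, 'k) cpoly" where
    "\<Gamma> i = (if i = 0 then cconst (1 / k) * cvar \<alpha>0 + cconst (- 1)
       else cvar (\<alpha> i) + cconst (- \<phi> p (\<alpha> i) / k) * cvar \<alpha>0)" for i
  let ?e = "\<lambda>j :: nat. if j = 0 then 1 else 0 :: 'k"
  have k: "k \<noteq> 0" using A by (simp add: k_def)
  have r: "r > 0" using A card_gt_0_iff unfolding r_def by blast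
  have expand: "first_order (\<lambda>t. \<Psi> (\<lambda>j. ?e j + t * s j) (\<alpha> l)) (\<phi> p (\<alpha> l))
      (s 0 * \<phi> p (\<alpha> l) + (if l = 0 then 0 else s l))" if l: "l < r" for s l
  proof -
    define g where "g = inv_into {1..<r} h"
    define s' where "s' \<beta> = (if \<beta> = \<alpha>0 then 0 else s (g \<beta>))" for \<beta>
    have gh: "g (h i) = i" if "i \<in> {1..<r}" for i
      unfolding g_def using that h by (intro inv_into_f_f) (auto simp: bij_betw_def)
    have hn: "h i \<noteq> \<alpha>0" if "i \<in> {1..<r}" for i
      using bij_betwE[OF h, rule_format, OF that] by simp
    have s'\<alpha>: "s' (\<alpha> l) = (if l = 0 then 0 else s l)" if "l < r" for l
      using that gh[of l] hn[of l] by (auto simp: s'_def \<alpha>_def)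
    have sum: "(\<Sum>\<beta>\<in>A. s' \<beta> * w \<beta> j) = (\<Sum>i\<in>{1..<r}. s i * w (\<alpha> i) j)" for j
    proof -
      have "(\<Sum>\<beta>\<in>A. s' \<beta> * w \<beta> j) = (\<Sum>\<beta>\<in>A - {\<alpha>0}. s' \<beta> * w \<beta> j)"
        using A(1,2) by (intro sum.mono_neutral_right) (auto simp: s'_def)
      also have "\<dots> = (\<Sum>i\<in>{1..<r}. s' (h i) * w (h i) j)"
        using sum.reindex_bij_betw[OF h, of "\<lambda>\<beta>. s' \<beta> * w \<beta> j"] by simp
      also have "\<dots> = (\<Sum>i\<in>{1..<r}. s i * w (\<alpha> i) j)"
        using gh hn by (intro sum.cong) (auto simp: s'_def \<alpha>_def)
      finally show ?thesis .
    qed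
    have pt: "pt (\<lambda>j. ?e j + t * s j) = (\<lambda>j. p j + t * (\<Sum>\<beta>\<in>A. s' \<beta> * w \<beta> j))" for t
      unfolding pt_def sum sum_distrib_left by (intro ext arg_cong2[where f = "(+)"] sum.cong) auto
    have "first_order (\<lambda>t. (1 + t * s 0) * \<phi> (\<lambda>j. p j + t * (\<Sum>\<beta>\<in>A. s' \<beta> * w \<beta> j)) (\<alpha> l))
        (1 * \<phi> p (\<alpha> l)) (1 * s' (\<alpha> l) + s 0 * \<phi> p (\<alpha> l))"
      by (intro first_order_mult first_order_linear tangent \<alpha>A l)
    then show ?thesis
      using s'\<alpha>[OF l] unfolding \<Psi>_def pt by (simp add: vec_scale_def add.commute)
  qed
  show ?thesis
    unfolding r_def[symmetric]
  proof (rule krull_dim_ge[where \<Psi> = \<Psi> and \<Gamma> = \<Gamma>])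
    show "image_points \<Psi> \<subseteq> X"
      using X by (force simp: image_points_def \<Psi>_def scale)
    show "\<Psi> x \<in> V" for x by (simp add: \<Psi>_def scale V)
    show "\<Psi> ?e \<noteq> 0"
    proof
      assume "\<Psi> ?e = 0"
      then have "\<Psi> ?e \<alpha>0 = 0" by simp
      moreover have "pt ?e = p" by (simp add: pt_def)
      ultimately show False using A by (simp add: \<Psi>_def vec_scale_def)
    qed
    show "\<Psi> (x(0 := c * x 0)) = vec_scale c (\<Psi> x)" for c x
      by (simp add: \<Psi>_def pt_def vec_scale_def fun_eq_iff mult.assoc)
    show "polyfun r (\<lambda>x. \<Psi> x t)" for t
      unfolding \<Psi>_def vec_scale_def pt_def
      by (intro polyfun_mult polyfun_var r polyfun_subst[OF \<phi>] polyfun_add polyfun_sum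
        polyfun_const) auto
    fix s :: "nat \<Rightarrow> 'k" and i assume i: "i < r"
    let ?f = "\<lambda>t. cpoly_eval (\<Gamma> i) (\<Psi> (\<lambda>j. ?e j + t * s j))"
    have "first_order ?f 0 (s i)"
    proof (cases "i = 0")
      case True
      have "first_order (\<lambda>t. 1 / k * \<Psi> (\<lambda>j. ?e j + t * s j) (\<alpha> 0) + - 1) (1 / k * k + - 1)
          (1 / k * (s 0 * k + 0) + 0 * k + 0)"
        using first_order_add[OF first_order_mult[OF first_order_const expand[OF r]]
          first_order_const,
            of "1 / k" s "- 1"]
        by (simp add: k_def \<alpha>_def)
      moreover have "?f = (\<lambda>t. 1 / k * \<Psi> (\<lambda>j. ?e j + t * s j) (\<alpha> 0) + - 1)"
        using True by (simp add: \<Gamma>_def cpoly_eval_add cpoly_eval_mult \<alpha>_def)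
      ultimately show ?thesis using True k by simp
    next
      case False
      let ?b = "- \<phi> p (\<alpha> i) / k"
      have "first_order (\<lambda>t. \<Psi> (\<lambda>j. ?e j + t * s j) (\<alpha> i) + ?b * \<Psi> (\<lambda>j. ?e j + t * s j) (\<alpha> 0))
         (\<phi> p (\<alpha> i) + ?b * k) ((s 0 * \<phi> p (\<alpha> i) + s i) + (?b * (s 0 * k + 0) + 0 * k))"
        using first_order_add[OF expand[OF i, of s] first_order_mult[OF first_order_const expand[OF
          r, of s]],
            of ?b] False by (simp add: k_def \<alpha>_def)
      moreover have "?f = (\<lambda>t. \<Psi> (\<lambda>j. ?e j + t * s j) (\<alpha> i) + ?b * \<Psi> (\<lambda>j. ?e j + t * s j) (\<alpha> 0))"
        using False by (simp add: \<Gamma>_def cpoly_eval_add cpoly_eval_mult \<alpha>_def)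
      moreover have "(s 0 * \<phi> p (\<alpha> i) + s i) + (?b * (s 0 * k + 0) + 0 * k) = s i"
        using k by (simp add: field_simps)
      moreover have "\<phi> p (\<alpha> i) + ?b * k = 0" using k by simp
      ultimately show ?thesis by simp
    qed
    then show "\<exists>q. \<forall>t. ?f t = t * (s i + t * poly q t)"
      unfolding first_order_def by simp
  qed
qed

section \<open>Polynomials with given support and their singular points\<close>

fun monomial3 :: "'k::field \<times> 'k \<times> 'k \<Rightarrow> nat \<times> nat \<times> nat \<Rightarrow> 'k" where
  "monomial3 (x, y, z) (a, b, c) = x ^ a * y ^ b * z ^ c"

definition affine_coord :: "nat \<Rightarrow> nat \<times> nat \<times> nat \<Rightarrow> nat" where
  "affine_coord j \<alpha> = [1, fst \<alpha>, fst (snd \<alpha>), snd (snd \<alpha>)] ! j"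

definition torus :: "('k::field \<times> 'k \<times> 'k) set" where
  "torus = {(x, y, z). x \<noteq> 0 \<and> y \<noteq> 0 \<and> z \<noteq> 0}"

text \<open>The logarithmic derivatives of a monomial are its exponents. So at a point \<open>u\<close> of the
  torus, these are the value and the three logarithmic partial derivatives of the polynomial with
  coefficients \<open>c\<close>.\<close>

abbreviation jet ::
  "(nat \<times> nat \<times> nat) set \<Rightarrow> (nat \<times> nat \<times> nat \<Rightarrow> 'k::field) \<Rightarrow> 'k \<times> 'k \<times> 'k \<Rightarrow> nat \<Rightarrow> 'k" where
  "jet A c u j \<equiv> \<Sum>\<alpha>\<in>A. c \<alpha> * (monomial3 u \<alpha> * of_nat (affine_coord j \<alpha>))"

text \<open>The only polynomial with monomials in \<open>A\<close> that is singular at each of the \<open>k\<close> points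
  \<open>p i\<close> of the torus is zero.\<close>

definition none_singular_at ::
  "(nat \<Rightarrow> 'k::field \<times> 'k \<times> 'k) \<Rightarrow> nat \<Rightarrow> (nat \<times> nat \<times> nat) set \<Rightarrow> bool" where
  "none_singular_at p k A \<longleftrightarrow> (\<forall>i<k. p i \<in> torus) \<and>
     (\<forall>c. (\<forall>i<k. \<forall>j<4. jet A c (p i) j = 0) \<longrightarrow> (\<forall>\<alpha>\<in>A. c \<alpha> = 0))"

lemma all_less_4: "(\<forall>j<4. P j) \<longleftrightarrow> P 0 \<and> P 1 \<and> P 2 \<and> P (3::nat)"
  by (auto simp: numeral_eq_Suc less_Suc_eq)

text \<open>Linear independence of vectors with polynomial entries is an open condition: Gaussian
  elimination with a pivot that is nonzero at \<open>0\<close> works wherever the product of the pivots is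
  nonzero.\<close>

lemma independent_at_generic:
  fixes R :: "'a \<Rightarrow> 'j \<Rightarrow> 'k::field_char_0 poly"
  assumes "finite A"
    "\<And>c. (\<forall>j\<in>J. (\<Sum>\<alpha>\<in>A. c \<alpha> * poly (R \<alpha> j) 0) = 0) \<Longrightarrow> (\<forall>\<alpha>\<in>A. c \<alpha> = 0)"
  shows "\<exists>H. H \<noteq> 0 \<and> (\<forall>t c. poly H t \<noteq> 0 \<longrightarrow>
    (\<forall>j\<in>J. (\<Sum>\<alpha>\<in>A. c \<alpha> * poly (R \<alpha> j) t) = 0) \<longrightarrow> (\<forall>\<alpha>\<in>A. c \<alpha> = 0))"
  using assms
proof (induction A arbitrary: R rule: finite_induct)
  case empty
  show ?case by (intro exI[of _ 1]) simp
next
  case (insert a A)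
  have "\<exists>j0\<in>J. poly (R a j0) 0 \<noteq> 0"
  proof (rule ccontr)
    assume n: "\<not> (\<exists>j0\<in>J. poly (R a j0) 0 \<noteq> 0)"
    have "(\<Sum>\<alpha>\<in>A. (if \<alpha> = a then 1 else 0) * poly (R \<alpha> j) 0) = 0" for j
      using insert.hyps by (intro sum.neutral) auto
    then have "\<forall>j\<in>J. (\<Sum>\<alpha>\<in>insert a A. (if \<alpha> = a then 1 else 0) * poly (R \<alpha> j) 0) = 0"
      using insert.hyps n by simp
    from insert.prems[OF this] show False by simp
  qed
  then obtain j0 where j0: "j0 \<in> J" "poly (R a j0) 0 \<noteq> 0" by blast
  define R' where "R' \<alpha> j = R a j0 * R \<alpha> j - R \<alpha> j0 * R a j" for \<alpha> j
  have R': "(\<Sum>\<alpha>\<in>A. c \<alpha> * poly (R' \<alpha> j) t) =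
      poly (R a j0) t * (\<Sum>\<alpha>\<in>A. c \<alpha> * poly (R \<alpha> j) t) - (\<Sum>\<alpha>\<in>A. c \<alpha> * poly (R \<alpha> j0) t) * poly (R a j) t"
    for c j t
    by (simp add: R'_def sum_distrib_left sum_distrib_right sum_subtractf algebra_simps)
  have "\<exists>H. H \<noteq> 0 \<and> (\<forall>t c. poly H t \<noteq> 0 \<longrightarrow>
    (\<forall>j\<in>J. (\<Sum>\<alpha>\<in>A. c \<alpha> * poly (R' \<alpha> j) t) = 0) \<longrightarrow> (\<forall>\<alpha>\<in>A. c \<alpha> = 0))"
  proof (rule insert.IH)
    fix c assume c: "\<forall>j\<in>J. (\<Sum>\<alpha>\<in>A. c \<alpha> * poly (R' \<alpha> j) 0) = 0"
    let ?c = "\<lambda>\<alpha>. if \<alpha> = a then - (\<Sum>\<alpha>\<in>A. c \<alpha> * poly (R \<alpha> j0) 0) else poly (R a j0) 0 * c \<alpha>"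
    have "(\<Sum>\<alpha>\<in>insert a A. ?c \<alpha> * poly (R \<alpha> j) 0) = 0" if "j \<in> J" for j
    proof -
      have "(\<Sum>\<alpha>\<in>A. ?c \<alpha> * poly (R \<alpha> j) 0) = (\<Sum>\<alpha>\<in>A. poly (R a j0) 0 * (c \<alpha> * poly (R \<alpha> j) 0))"
        using insert.hyps by (intro sum.cong) auto
      then show ?thesis
        using insert.hyps c that by (simp add: R' sum_distrib_left)
    qed
    then have "\<forall>\<alpha>\<in>insert a A. ?c \<alpha> = 0"
      using insert.prems[of ?c] by blast
    then have "?c \<alpha> = 0" if "\<alpha> \<in> A" for \<alpha>
      using that by blast
    moreover have "\<alpha> \<noteq> a" if "\<alpha> \<in> A" for \<alpha>
      using that insert.hyps by blast
    ultimately have "poly (R a j0) 0 * c \<alpha> = 0" if "\<alpha> \<in> A" for \<alpha>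
      using that by (metis (lifting))
    then show "\<forall>\<alpha>\<in>A. c \<alpha> = 0"
      using j0 by auto
  qed
  then obtain H where H: "H \<noteq> 0" "\<And>t c. poly H t \<noteq> 0 \<Longrightarrow>
    (\<forall>j\<in>J. (\<Sum>\<alpha>\<in>A. c \<alpha> * poly (R' \<alpha> j) t) = 0) \<Longrightarrow> (\<forall>\<alpha>\<in>A. c \<alpha> = 0)" by blast
  show ?case
  proof (intro exI[of _ "H * R a j0"] conjI allI impI)
    show "H * R a j0 \<noteq> 0" using H j0 by auto
    fix t c
    assume t: "poly (H * R a j0) t \<noteq> 0"
      and c: "\<forall>j\<in>J. (\<Sum>\<alpha>\<in>insert a A. c \<alpha> * poly (R \<alpha> j) t) = 0"
    have sA: "(\<Sum>\<alpha>\<in>A. c \<alpha> * poly (R \<alpha> j) t) = - c a * poly (R a j) t" if "j \<in> J" for j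
      using c that insert.hyps by (simp add: eq_neg_iff_add_eq_0 add.commute)
    have "\<forall>\<alpha>\<in>A. c \<alpha> = 0"
      by (rule H(2)[of t]) (use t j0 in \<open>auto simp: R' sA\<close>)
    moreover from this have "c a = 0"
      using sA[OF j0(1)] t by simp
    ultimately show "\<forall>\<alpha>\<in>insert a A. c \<alpha> = 0" by simp
  qed
qed

fun lform :: "int \<times> int \<times> int \<Rightarrow> nat \<times> nat \<times> nat \<Rightarrow> int" where
  "lform (l, m, n) (a, b, c) = l * int a + m * int b + n * int c"

text \<open>The points \<open>q\<close> are moved along the one-parameter subgroup \<open>t\<close> to the power \<open>- 2 l\<close> of the
  torus. After rescaling every monomial, the conditions at \<open>p\<close> on monomials of \<open>B\<close> and the
  conditions at \<open>q\<close> on monomials of \<open>A\<close> carry positive powers of \<open>t\<close>. At \<open>t = 0\<close> the system splits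
  into those for \<open>A\<close> and for \<open>B\<close>, hence it has only the trivial solution for generic \<open>t\<close>.\<close>

lemma none_singular_at_separated:
  fixes p q :: "nat \<Rightarrow> 'k::field_char_0 \<times> 'k \<times> 'k"
  assumes p: "none_singular_at p k A" and q: "none_singular_at q k' B" and fin: "finite A" "finite B"
    and sepA: "\<And>\<alpha>. \<alpha> \<in> A \<Longrightarrow> lform l \<alpha> < s" and sepB: "\<And>\<alpha>. \<alpha> \<in> B \<Longrightarrow> lform l \<alpha> \<ge> s"
  shows "\<exists>r :: nat \<Rightarrow> 'k \<times> 'k \<times> 'k. none_singular_at r (k + k') (A \<union> B)"
proof -
  have disj: "A \<inter> B = {}" using sepA sepB by force
  \<comment> \<open>Doubling leaves room for an integer strictly between the values on \<open>A\<close> and those on \<open>B\<close>.\<close>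
  define h where "h \<alpha> = 2 * lform l \<alpha> - (2 * s - 1)" for \<alpha>
  have hA: "h \<alpha> < 0" if "\<alpha> \<in> A" for \<alpha> using sepA[OF that] by (simp add: h_def)
  have hB: "h \<alpha> > 0" if "\<alpha> \<in> B" for \<alpha> using sepB[OF that] by (simp add: h_def)
  define M where "M \<alpha> ij = (case ij of (i, j) \<Rightarrow>
    monomial3 (if i < k then p i else q (i - k)) \<alpha> * of_nat (affine_coord j \<alpha>))"
      for \<alpha> and ij :: "nat \<times> nat"
  \<comment> \<open>The two kinds of conditions on the two kinds of monomials; the mixed ones vanish for
      \<open>t = 0\<close>.\<close>
  define R :: "_ \<Rightarrow> _ \<Rightarrow> 'k poly" where
    "R \<alpha> ij = monom (M \<alpha> ij) (if (fst ij < k) = (\<alpha> \<in> A) then 0 else nat \<bar>h \<alpha>\<bar>)" for \<alpha> ij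
  let ?J = "{..<k + k'} \<times> {..<4::nat}"
  have "\<exists>H. H \<noteq> 0 \<and> (\<forall>t c. poly H t \<noteq> 0 \<longrightarrow>
    (\<forall>j\<in>?J. (\<Sum>\<alpha>\<in>A \<union> B. c \<alpha> * poly (R \<alpha> j) t) = 0) \<longrightarrow> (\<forall>\<alpha>\<in>A \<union> B. c \<alpha> = 0))"
  proof (rule independent_at_generic)
    fix c assume c: "\<forall>ij\<in>?J. (\<Sum>\<alpha>\<in>A \<union> B. c \<alpha> * poly (R \<alpha> ij) 0) = 0"
    have "jet A c (p i) j = 0" if "i < k" "j < 4" for i j
    proof -
      have "(\<Sum>\<alpha>\<in>B. c \<alpha> * poly (R \<alpha> (i, j)) 0) = 0"
        using disj hB that by (intro sum.neutral) (force simp: R_def poly_monom)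
      moreover have "(\<Sum>\<alpha>\<in>A. c \<alpha> * poly (R \<alpha> (i, j)) 0) =
          jet A c (p i) j"
        using that by (intro sum.cong) (auto simp: R_def M_def poly_monom)
      ultimately show ?thesis
        using c[rule_format, of "(i, j)"] that fin disj by (simp add: sum.union_disjoint)
    qed
    then have "\<forall>\<alpha>\<in>A. c \<alpha> = 0" using p unfolding none_singular_at_def by blast
    moreover have "jet B c (q i) j = 0" if "i < k'" "j < 4" for i j
    proof -
      have "(\<Sum>\<alpha>\<in>A. c \<alpha> * poly (R \<alpha> (k + i, j)) 0) = 0"
        using hA that by (intro sum.neutral) (force simp: R_def poly_monom)
      moreover have "(\<Sum>\<alpha>\<in>B. c \<alpha> * poly (R \<alpha> (k + i, j)) 0) =
          jet B c (q i) j"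
        using that disj by (intro sum.cong) (auto simp: R_def M_def poly_monom)
      ultimately show ?thesis
        using c[rule_format, of "(k + i, j)"] that fin disj by (simp add: sum.union_disjoint)
    qed
    then have "\<forall>\<alpha>\<in>B. c \<alpha> = 0" using q unfolding none_singular_at_def by blast
    ultimately show "\<forall>\<alpha>\<in>A \<union> B. c \<alpha> = 0" by blast
  qed (use fin in simp)
  then obtain H where H: "H \<noteq> 0" "\<And>t c. poly H t \<noteq> 0 \<Longrightarrow>
    (\<forall>j\<in>?J. (\<Sum>\<alpha>\<in>A \<union> B. c \<alpha> * poly (R \<alpha> j) t) = 0) \<Longrightarrow> (\<forall>\<alpha>\<in>A \<union> B. c \<alpha> = 0)" by blast
  have "H * [:0, 1:] \<noteq> 0" using H(1) by simp
  then obtain t where t: "poly (H * [:0, 1:]) t \<noteq> 0"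
    using poly_all_0_iff_0 by blast
  then have tH: "poly H t \<noteq> 0" and t0: "t \<noteq> 0" by auto
  obtain l1 l2 l3 where l: "l = (l1, l2, l3)" by (cases l)
  define sc where "sc = (\<lambda>(x, y, z). (x * t powi (- 2 * l1), y * t powi (- 2 * l2),
    z * t powi (- 2 * l3)))"
  define r where "r i = (if i < k then p i else sc (q (i - k)))" for i
  have monomial3_sc: "monomial3 (sc u) \<alpha> = t powi (- 2 * lform l \<alpha>) * monomial3 u \<alpha>" for u \<alpha>
  proof -
    obtain x y z a b c where u: "u = (x, y, z)" and \<alpha>: "\<alpha> = (a, b, c)"
      by (cases u, cases \<alpha>)
    have "t powi (- 2 * lform l \<alpha>) =
        t powi (- 2 * l1 * int a) * t powi (- 2 * l2 * int b) * t powi (- 2 * l3 * int c)"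
      using t0 by (simp add: l \<alpha> algebra_simps flip: power_int_add)
    also have "\<dots> = (t powi (- 2 * l1)) ^ a * (t powi (- 2 * l2)) ^ b * (t powi (- 2 * l3)) ^ c"
      by (simp only: power_int_mult power_int_of_nat)
    finally show ?thesis
      by (simp add: sc_def u \<alpha> power_mult_distrib mult_ac)
  qed
  have "none_singular_at r (k + k') (A \<union> B)"
    unfolding none_singular_at_def
  proof (intro conjI allI impI)
    fix i assume i: "i < k + k'"
    have "sc u \<in> torus" if "u \<in> torus" for u
      using that t0 by (auto simp: sc_def torus_def power_int_eq_0_iff)
    moreover have "i < k \<Longrightarrow> p i \<in> torus" "\<not> i < k \<Longrightarrow> q (i - k) \<in> torus"
      using p q i unfolding none_singular_at_def by auto
    ultimately show "r i \<in> torus"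
      by (simp add: r_def)
  next
    fix c :: "_ \<Rightarrow> 'k"
    assume c: "\<forall>i<k + k'. \<forall>j<4. jet (A \<union> B) c (r i) j = 0"
    \<comment> \<open>The rescaling of the monomials of \<open>B\<close> that turns negative powers of \<open>t\<close> into positive
        ones.\<close>
    define c' where "c' \<alpha> = (if \<alpha> \<in> A then c \<alpha> else c \<alpha> * t powi (- h \<alpha>))" for \<alpha>
    have "(\<Sum>\<alpha>\<in>A \<union> B. c' \<alpha> * poly (R \<alpha> (i, j)) t) = 0" if ij: "i < k + k'" "j < 4" for i j
    proof (cases "i < k")
      case True
      have "(\<Sum>\<alpha>\<in>A \<union> B. c' \<alpha> * poly (R \<alpha> (i, j)) t) =
          jet (A \<union> B) c (r i) j"
      proof (intro sum.cong refl)
        fix \<alpha> assume a: "\<alpha> \<in> A \<union> B"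
        have "t powi (- h \<alpha>) * t ^ nat \<bar>h \<alpha>\<bar> = 1" if "\<alpha> \<notin> A"
          using hB[of \<alpha>] a that t0 by (simp add: power_int_def power_inverse)
        then show "c' \<alpha> * poly (R \<alpha> (i, j)) t = c \<alpha> * (monomial3 (r i) \<alpha> * of_nat (affine_coord j \<alpha>))"
          using True by (auto simp: c'_def R_def M_def r_def poly_monom mult_ac)
      qed
      then show ?thesis using c ij by simp
    next
      case False
      have "(\<Sum>\<alpha>\<in>A \<union> B. c' \<alpha> * poly (R \<alpha> (i, j)) t) =
          (\<Sum>\<alpha>\<in>A \<union> B. t powi (2 * s - 1) * (c \<alpha> * (monomial3 (r i) \<alpha> * of_nat (affine_coord j \<alpha>))))"
      proof (intro sum.cong refl)
        fix \<alpha> assume a: "\<alpha> \<in> A \<union> B"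
        have h: "t powi (2 * s - 1) * t powi (- 2 * lform l \<alpha>) = t powi (- h \<alpha>)"
          using t0 by (simp add: h_def flip: power_int_add)
        have lr: "monomial3 (r i) \<alpha> = t powi (- 2 * lform l \<alpha>) * monomial3 (q (i - k)) \<alpha>"
          using False by (simp only: r_def if_False monomial3_sc)
        have e: "t powi (2 * s - 1) * (c \<alpha> * (monomial3 (r i) \<alpha> * of_nat (affine_coord j \<alpha>))) =
            t powi (- h \<alpha>) * (c \<alpha> * (monomial3 (q (i - k)) \<alpha> * of_nat (affine_coord j \<alpha>)))"
          unfolding h[symmetric] lr by (simp only: mult_ac)
        have "t ^ nat \<bar>h \<alpha>\<bar> = t powi (- h \<alpha>)" if "\<alpha> \<in> A"
          using hA[OF that] by (simp add: power_int_def)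
        then show "c' \<alpha> * poly (R \<alpha> (i, j)) t =
            t powi (2 * s - 1) * (c \<alpha> * (monomial3 (r i) \<alpha> * of_nat (affine_coord j \<alpha>)))"
          unfolding e using False by (auto simp: c'_def R_def M_def poly_monom mult_ac)
      qed
      then show ?thesis using c ij by (simp flip: sum_distrib_left)
    qed
    then have "\<forall>\<alpha>\<in>A \<union> B. c' \<alpha> = 0"
      using H(2)[OF tH, of c'] by auto
    then show "\<forall>\<alpha>\<in>A \<union> B. c \<alpha> = 0"
      using t0 by (auto simp: c'_def power_int_eq_0_iff split: if_splits)
  qed
  then show ?thesis by blast
qed

text \<open>For every \<open>k\<close> there are \<open>k\<close> points at which the conditions to be singular have the rank
  expected of \<open>4k\<close> conditions on \<open>card A\<close> coefficients. The rank is witnessed by a subset on which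
  the conditions have only the trivial solution.\<close>

definition nondefective_support :: "'k::field itself \<Rightarrow> (nat \<times> nat \<times> nat) set \<Rightarrow> bool" where
  "nondefective_support T A \<longleftrightarrow> finite A \<and> (\<forall>k. \<exists>A'\<subseteq>A. card A' = min (4 * k) (card A) \<and>
     (\<exists>p :: nat \<Rightarrow> 'k \<times> 'k \<times> 'k. none_singular_at p k A'))"

text \<open>The points available are spent on \<open>A\<close> first. As the size of \<open>A\<close> is divisible by four, no
  condition is wasted before the remaining points are spent on \<open>B\<close>.\<close>

lemma nondefective_support_separated:
  assumes A: "nondefective_support TYPE('k::field_char_0) A" and B: "nondefective_support TYPE('k) B"
    and dvd: "4 dvd card A"
    and sepA: "\<And>\<alpha>. \<alpha> \<in> A \<Longrightarrow> lform l \<alpha> < s" and sepB: "\<And>\<alpha>. \<alpha> \<in> B \<Longrightarrow> lform l \<alpha> \<ge> s"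
  shows "nondefective_support TYPE('k) (A \<union> B)"
proof -
  have fin: "finite A" "finite B" using A B by (auto simp: nondefective_support_def)
  have disj: "A \<inter> B = {}" using sepA sepB by force
  have card: "card (A \<union> B) = card A + card B"
    using fin disj by (rule card_Un_disjoint)
  obtain n where n: "card A = 4 * n" using dvd by (auto elim: dvdE)
  show ?thesis
    unfolding nondefective_support_def
  proof (intro conjI allI)
    show "finite (A \<union> B)" using fin by simp
    fix k
    show "\<exists>A'\<subseteq>A \<union> B. card A' = min (4 * k) (card (A \<union> B)) \<and>
      (\<exists>p :: nat \<Rightarrow> 'k \<times> 'k \<times> 'k. none_singular_at p k A')"
    proof (cases "k \<le> n")
      case True
      obtain A' where "A' \<subseteq> A" "card A' = min (4 * k) (card A)"
        "\<exists>p :: nat \<Rightarrow> 'k \<times> 'k \<times> 'k. none_singular_at p k A'"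
        using A unfolding nondefective_support_def by blast
      then show ?thesis
        using True n card by (intro exI[of _ A']) auto
    next
      case False
      obtain A' p where A': "A' \<subseteq> A" "card A' = min (4 * n) (card A)"
        "none_singular_at (p :: nat \<Rightarrow> 'k \<times> 'k \<times> 'k) n A'"
        using A unfolding nondefective_support_def by blast
      have "A' = A" using A' n fin by (intro card_subset_eq) auto
      obtain B' q where B': "B' \<subseteq> B" "card B' = min (4 * (k - n)) (card B)"
        "none_singular_at (q :: nat \<Rightarrow> 'k \<times> 'k \<times> 'k) (k - n) B'"
        using B unfolding nondefective_support_def by blast
      have "\<exists>r :: nat \<Rightarrow> 'k \<times> 'k \<times> 'k. none_singular_at r (n + (k - n)) (A \<union> B')"
        using A'(3) B'(1,3) fin sepA sepB unfolding \<open>A' = A\<close>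
        by (intro none_singular_at_separated[where l = l and s = s]) (auto intro: finite_subset)
      moreover have "card (A \<union> B') = card A + card B'"
        using fin disj B'(1) by (intro card_Un_disjoint) (auto intro: finite_subset)
      ultimately show ?thesis
        using False B' n card by (intro exI[of _ "A \<union> B'"]) auto
    qed
  qed
qed

text \<open>Six times the volume of a tetrahedron, up to sign; by convention \<open>0\<close> for a list that does
  not have four entries, so that it is nonzero only for the vertices of a proper tetrahedron.\<close>

fun tetra_det :: "(nat \<times> nat \<times> nat) list \<Rightarrow> int" where
  "tetra_det [(a0, b0, c0), (a1, b1, c1), (a2, b2, c2), (a3, b3, c3)] =
    (let u1 = int a1 - int a0; v1 = int b1 - int b0; w1 = int c1 - int c0;
         u2 = int a2 - int a0; v2 = int b2 - int b0; w2 = int c2 - int c0;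
         u3 = int a3 - int a0; v3 = int b3 - int b0; w3 = int c3 - int c0
     in u1 * (v2 * w3 - w2 * v3) - v1 * (u2 * w3 - w2 * u3) + w1 * (u2 * v3 - v2 * u3))"
| "tetra_det _ = 0"

lemma cramer3:
  fixes x y z :: "'k::idom"
  assumes "x * u1 + y * u2 + z * u3 = 0" "x * v1 + y * v2 + z * v3 = 0" "x * w1 + y * w2 + z * w3 = 0"
    and det: "u1 * (v2 * w3 - w2 * v3) - v1 * (u2 * w3 - w2 * u3) + w1 * (u2 * v3 - v2 * u3) \<noteq> 0"
      (is "?D \<noteq> 0")
  shows "x = 0" "y = 0" "z = 0"
proof -
  have "x * ?D = 0" using assms(1-3) by Groebner_Basis.algebra
  then show "x = 0" using det by simp
  have "y * ?D = 0" using assms(1-3) by Groebner_Basis.algebra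
  then show "y = 0" using det by simp
  have "z * ?D = 0" using assms(1-3) by Groebner_Basis.algebra
  then show "z = 0" using det by simp
qed

lemma tetra_det_affinely_independent:
  fixes c :: "_ \<Rightarrow> 'k::field_char_0"
  assumes "tetra_det T \<noteq> 0" "\<forall>j<4. (\<Sum>\<alpha>\<in>set T. c \<alpha> * of_nat (affine_coord j \<alpha>)) = 0"
  shows "card (set T) = 4 \<and> (\<forall>\<alpha>\<in>set T. c \<alpha> = 0)"
proof -
  obtain a0 b0 c0 a1 b1 c1 a2 b2 c2 a3 b3 c3
    where T: "T = [(a0, b0, c0), (a1, b1, c1), (a2, b2, c2), (a3, b3, c3)]"
    using assms(1) by (cases T rule: tetra_det.cases) auto
  let ?p0 = "(a0, b0, c0)" and ?p1 = "(a1, b1, c1)" and ?p2 = "(a2, b2, c2)" and ?p3 = "(a3, b3, c3)"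
  have d: "?p0 \<noteq> ?p1" "?p0 \<noteq> ?p2" "?p0 \<noteq> ?p3" "?p1 \<noteq> ?p2" "?p1 \<noteq> ?p3" "?p2 \<noteq> ?p3"
    using assms(1) unfolding T by (auto simp: algebra_simps)
  have eq: "c ?p0 * of_nat (affine_coord j ?p0) + c ?p1 * of_nat (affine_coord j ?p1) +
    c ?p2 * of_nat (affine_coord j ?p2) +
      c ?p3 * of_nat (affine_coord j ?p3) = 0" if "j < 4" for j
    using assms(2)[rule_format, OF that] d unfolding T by (simp add: add.assoc)
  have e: "c ?p0 + c ?p1 + c ?p2 + c ?p3 = 0"
    "c ?p0 * of_nat a0 + c ?p1 * of_nat a1 + c ?p2 * of_nat a2 + c ?p3 * of_nat a3 = 0"
    "c ?p0 * of_nat b0 + c ?p1 * of_nat b1 + c ?p2 * of_nat b2 + c ?p3 * of_nat b3 = 0"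
    "c ?p0 * of_nat c0 + c ?p1 * of_nat c1 + c ?p2 * of_nat c2 + c ?p3 * of_nat c3 = 0"
    using eq[of 0] eq[of 1] eq[of 2] eq[of 3] by (simp_all add: affine_coord_def numeral_eq_Suc)
  have p0: "c ?p0 = - (c ?p1 + c ?p2 + c ?p3)"
    using e(1) by Groebner_Basis.algebra
  have D: "of_int (tetra_det T) \<noteq> (0 :: 'k)" using assms(1) by simp
  let ?x = "\<lambda>a b. of_nat a - of_nat b :: 'k"
  have u: "c ?p1 * ?x a1 a0 + c ?p2 * ?x a2 a0 + c ?p3 * ?x a3 a0 = 0"
    using e(1,2) by Groebner_Basis.algebra
  have v: "c ?p1 * ?x b1 b0 + c ?p2 * ?x b2 b0 + c ?p3 * ?x b3 b0 = 0"
    using e(1,3) by Groebner_Basis.algebra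
  have w: "c ?p1 * ?x c1 c0 + c ?p2 * ?x c2 c0 + c ?p3 * ?x c3 c0 = 0"
    using e(1,4) by Groebner_Basis.algebra
  have "?x a1 a0 * (?x b2 b0 * ?x c3 c0 - ?x c2 c0 * ?x b3 b0)
    - ?x b1 b0 * (?x a2 a0 * ?x c3 c0 - ?x c2 c0 * ?x a3 a0) +
      ?x c1 c0 * (?x a2 a0 * ?x b3 b0 - ?x b2 b0 * ?x a3 a0) = of_int (tetra_det T)"
    unfolding T by (simp add: Let_def)
  then have "c ?p1 = 0 \<and> c ?p2 = 0 \<and> c ?p3 = 0"
    using cramer3[OF u v w] D by simp
  then show ?thesis using p0 d unfolding T by simp
qed

text \<open>At the point \<open>(1, 1, 1)\<close> all monomials are \<open>1\<close>, and the conditions to be singular there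
  say that the coefficients are an affine dependence of the exponents.\<close>

lemma nondefective_support_in_tetrahedron:
  assumes "tetra_det T \<noteq> 0" "S \<subseteq> set T"
  shows "nondefective_support TYPE('k::field_char_0) S"
proof -
  have fin: "finite S" using assms(2) by (rule finite_subset) simp
  have "card (set T) = 4"
    using tetra_det_affinely_independent[OF assms(1), of "\<lambda>_. 0 :: rat"] by simp
  then have card: "card S \<le> 4" using card_mono[OF _ assms(2)] by simp
  have ns: "none_singular_at (\<lambda>_. (1, 1, 1) :: 'k \<times> 'k \<times> 'k) k S" if "k > 0" for k
    unfolding none_singular_at_def
  proof (intro conjI allI impI)
    fix c :: "_ \<Rightarrow> 'k"
    assume c: "\<forall>i<k. \<forall>j<4. jet S c (1, 1, 1) j = 0"
    have "monomial3 (1, 1, 1) \<alpha> = (1 :: 'k)" for \<alpha> by (cases \<alpha>) simp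
    with c \<open>k > 0\<close> have c: "(\<Sum>\<alpha>\<in>S. c \<alpha> * of_nat (affine_coord j \<alpha>)) = 0" if "j < 4" for j
      using that by auto
    let ?c = "\<lambda>\<alpha>. if \<alpha> \<in> S then c \<alpha> else 0"
    have "(\<Sum>\<alpha>\<in>set T. ?c \<alpha> * of_nat (affine_coord j \<alpha>)) = (\<Sum>\<alpha>\<in>S. c \<alpha> * of_nat (affine_coord j \<alpha>))"
      for j
      using assms(2) by (intro sum.mono_neutral_cong_right) auto
    then have "\<forall>\<alpha>\<in>set T. ?c \<alpha> = 0"
      using tetra_det_affinely_independent[OF assms(1), of ?c] c by simp
    then show "\<forall>\<alpha>\<in>S. c \<alpha> = 0" using assms(2) by (auto split: if_splits)
  qed (simp add: torus_def)
  have "\<exists>A'\<subseteq>S. card A' = min (4 * k) (card S) \<and>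
      (\<exists>p :: nat \<Rightarrow> 'k \<times> 'k \<times> 'k. none_singular_at p k A')" for k
  proof (cases "k = 0")
    case True
    then show ?thesis by (intro exI[of _ "{}"]) (simp add: none_singular_at_def)
  next
    case False
    then show ?thesis using ns[of k] card by (intro exI[of _ S]) auto
  qed
  then show ?thesis using fin by (simp add: nondefective_support_def)
qed

text \<open>Checks a certificate for \<open>A\<close>. Each entry \<open>(l, m, n, s)\<close> cuts off by a plane a part that
  has to be a proper tetrahedron; what remains at the end must be contained in the tetrahedron
  \<open>T\<close>.\<close>

fun peel :: "(int \<times> int \<times> int \<times> int) list \<Rightarrow> (nat \<times> nat \<times> nat) list \<Rightarrow> (nat \<times> nat \<times> nat) list \<Rightarrow> bool"
  where
  "peel [] T A \<longleftrightarrow> tetra_det T \<noteq> 0 \<and> list_all (\<lambda>\<alpha>. list_ex (\<lambda>\<beta>. \<beta> = \<alpha>) T) A"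
| "peel ((l, m, n, s) # cs) T A \<longleftrightarrow>
     tetra_det (filter (\<lambda>\<alpha>. lform (l, m, n) \<alpha> < s) A) \<noteq> 0 \<and>
     peel cs T (filter (\<lambda>\<alpha>. \<not> lform (l, m, n) \<alpha> < s) A)"

lemma nondefective_support_peel: "peel cs T A \<Longrightarrow> nondefective_support TYPE('k::field_char_0) (set A)"
proof (induction cs T A rule: peel.induct)
  case (1 T A)
  then show ?case
    by (intro nondefective_support_in_tetrahedron[of T]) (auto simp: list_all_iff list_ex_iff)
next
  case (2 l m n s cs T A)
  let ?B = "filter (\<lambda>\<alpha>. lform (l, m, n) \<alpha> < s) A"
  let ?C = "filter (\<lambda>\<alpha>. \<not> lform (l, m, n) \<alpha> < s) A"
  have d: "tetra_det ?B \<noteq> 0" and C: "nondefective_support TYPE('k) (set ?C)"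
    using 2 by auto
  have "nondefective_support TYPE('k) (set ?B \<union> set ?C)"
  proof (rule nondefective_support_separated[where l = "(l, m, n)" and s = s])
    show "nondefective_support TYPE('k) (set ?B)"
      using d by (rule nondefective_support_in_tetrahedron) simp
    show "4 dvd card (set ?B)"
      using tetra_det_affinely_independent[OF d, of "\<lambda>_. 0 :: rat"] by simp
  qed (use C in auto)
  moreover have "set ?B \<union> set ?C = set A" by auto
  ultimately show ?case by simp
qed

section \<open>Cutting boxes into tetrahedra\<close>

definition box :: "nat \<Rightarrow> nat \<Rightarrow> nat \<Rightarrow> (nat \<times> nat \<times> nat) set" where
  "box a b c = {..<a} \<times> {..<b} \<times> {..<c}"

lemma finite_box [simp]: "finite (box a b c)" by (simp add: box_def)

lemma card_box: "card (box a b c) = a * b * c" by (simp add: box_def card_cartesian_product)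

definition box_list :: "nat \<Rightarrow> nat \<Rightarrow> nat \<Rightarrow> (nat \<times> nat \<times> nat) list" where
  "box_list a b c = List.product [0..<a] (List.product [0..<b] [0..<c])"

lemma set_box_list: "set (box_list a b c) = box a b c"
  by (auto simp: box_list_def box_def)

text \<open>The three symmetries used below, two transpositions of the variables and a translation of
  the exponents, are all instances: the conditions on \<open>f ` A\<close> imply those on \<open>A\<close> after renaming.\<close>

lemma none_singular_at_image:
  fixes p p' :: "nat \<Rightarrow> 'k::field \<times> 'k \<times> 'k"
  assumes p: "none_singular_at p k A" and inj: "inj_on f A"
    and torus: "\<And>i. i < k \<Longrightarrow> p' i \<in> torus"
    and rel: "\<And>i c. i < k \<Longrightarrow>
      (\<forall>j<4. (\<Sum>\<alpha>\<in>A. c \<alpha> * (monomial3 (p' i) (f \<alpha>) * of_nat (affine_coord j (f \<alpha>)))) = 0) \<Longrightarrow>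
      (\<forall>j<4. jet A c (p i) j = 0)"
  shows "none_singular_at p' k (f ` A)"
  unfolding none_singular_at_def
proof (intro conjI allI impI)
  fix c :: "_ \<Rightarrow> 'k"
  assume c: "\<forall>i<k. \<forall>j<4. (\<Sum>\<beta>\<in>f ` A. c \<beta> * (monomial3 (p' i) \<beta> * of_nat (affine_coord j \<beta>))) = 0"
  then have "\<forall>j<4. (\<Sum>\<alpha>\<in>A. c (f \<alpha>) * (monomial3 (p' i) (f \<alpha>) * of_nat (affine_coord j (f \<alpha>)))) = 0"
    if "i < k" for i
    using that inj by (auto simp: sum.reindex)
  then have "\<forall>i<k. \<forall>j<4. (\<Sum>\<alpha>\<in>A. c (f \<alpha>) * (monomial3 (p i) \<alpha> * of_nat (affine_coord j \<alpha>))) = 0"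
    using rel[where c = "\<lambda>\<alpha>. c (f \<alpha>)"] by simp
  moreover have "\<forall>c. (\<forall>i<k. \<forall>j<4. jet A c (p i) j = 0) \<longrightarrow>
      (\<forall>\<alpha>\<in>A. c \<alpha> = 0)"
    using p unfolding none_singular_at_def by (rule conjunct2)
  ultimately have "\<forall>\<alpha>\<in>A. c (f \<alpha>) = 0"
    by (auto dest: spec[where x = "\<lambda>\<alpha>. c (f \<alpha>)"])
  then show "\<forall>\<beta>\<in>f ` A. c \<beta> = 0" by blast
qed (use torus in blast)

lemma nondefective_support_image:
  assumes A: "nondefective_support TYPE('k::field) A" and inj: "inj f"
    and step: "\<And>(p :: nat \<Rightarrow> 'k \<times> 'k \<times> 'k) k B. none_singular_at p k B \<Longrightarrow>
      \<exists>p' :: nat \<Rightarrow> 'k \<times> 'k \<times> 'k. none_singular_at p' k (f ` B)"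
  shows "nondefective_support TYPE('k) (f ` A)"
  unfolding nondefective_support_def
proof (intro conjI allI)
  show "finite (f ` A)" using A by (simp add: nondefective_support_def)
  fix k
  obtain A' p where A': "A' \<subseteq> A" "card A' = min (4 * k) (card A)"
    "none_singular_at (p :: nat \<Rightarrow> 'k \<times> 'k \<times> 'k) k A'"
    using A unfolding nondefective_support_def by blast
  have "card (f ` A') = card A'" "card (f ` A) = card A"
    using inj by (auto intro!: card_image inj_on_subset[OF inj])
  then show "\<exists>B\<subseteq>f ` A. card B = min (4 * k) (card (f ` A)) \<and>
      (\<exists>p :: nat \<Rightarrow> 'k \<times> 'k \<times> 'k. none_singular_at p k B)"
    using A' step[OF A'(3)] by (intro exI[of _ "f ` A'"]) auto
qed

fun swap12 :: "'a \<times> 'a \<times> 'a \<Rightarrow> 'a \<times> 'a \<times> 'a" where "swap12 (x, y, z) = (y, x, z)"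
fun swap23 :: "'a \<times> 'a \<times> 'a \<Rightarrow> 'a \<times> 'a \<times> 'a" where "swap23 (x, y, z) = (x, z, y)"
fun shift :: "nat \<Rightarrow> nat \<times> nat \<times> nat \<Rightarrow> nat \<times> nat \<times> nat" where "shift n (x, y, z) = (n + x, y, z)"

lemma nondefective_support_permute:
  fixes g :: "'k::field \<times> 'k \<times> 'k \<Rightarrow> 'k \<times> 'k \<times> 'k"
  assumes A: "nondefective_support TYPE('k) A" and inj: "inj f" and g: "\<And>u. u \<in> torus \<Longrightarrow> g u \<in> torus"
    and monomial3: "\<And>u \<alpha>. monomial3 (g u) (f \<alpha>) = monomial3 u \<alpha>"
    and affine_coord: "\<And>j. j < 4 \<Longrightarrow> \<exists>j'<4. \<forall>\<alpha>. affine_coord j' (f \<alpha>) = affine_coord j \<alpha>"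
  shows "nondefective_support TYPE('k) (f ` A)"
proof (rule nondefective_support_image[OF A inj])
  fix p :: "nat \<Rightarrow> 'k \<times> 'k \<times> 'k" and k B
  assume p: "none_singular_at p k B"
  have "none_singular_at (\<lambda>i. g (p i)) k (f ` B)"
  proof (rule none_singular_at_image[OF p])
    show "inj_on f B" using inj by (rule inj_on_subset) simp
    show "g (p i) \<in> torus" if "i < k" for i
      using p that g unfolding none_singular_at_def by blast
    show "\<forall>j<4. jet B c (p i) j = 0"
      if c: "\<forall>j<4. (\<Sum>\<alpha>\<in>B. c \<alpha> * (monomial3 (g (p i)) (f \<alpha>) * of_nat (affine_coord j (f \<alpha>)))) = 0"
        for i c
    proof (intro allI impI)
      fix j :: nat assume "j < 4"
      then obtain j' where j': "j' < 4" "\<And>\<alpha>. affine_coord j' (f \<alpha>) = affine_coord j \<alpha>"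
        using affine_coord by blast
      then show "jet B c (p i) j = 0"
        using c[rule_format, OF j'(1)] by (simp add: monomial3)
    qed
  qed
  then show "\<exists>p' :: nat \<Rightarrow> 'k \<times> 'k \<times> 'k. none_singular_at p' k (f ` B)" by blast
qed

lemma nondefective_support_swap12:
  assumes "nondefective_support TYPE('k::field) A"
  shows "nondefective_support TYPE('k) (swap12 ` A)"
proof (rule nondefective_support_permute[OF assms, where g = swap12])
  show "\<exists>j'<4. \<forall>\<alpha>. affine_coord j' (swap12 \<alpha>) = affine_coord j \<alpha>" if "j < 4" for j
    using that by (intro exI[of _ "[0, 2, 1, 3] ! j"])
      (auto simp: affine_coord_def numeral_eq_Suc less_Suc_eq)
qed (auto simp: inj_def torus_def)

lemma nondefective_support_swap23:
  assumes "nondefective_support TYPE('k::field) A"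
  shows "nondefective_support TYPE('k) (swap23 ` A)"
proof (rule nondefective_support_permute[OF assms, where g = swap23])
  show "\<exists>j'<4. \<forall>\<alpha>. affine_coord j' (swap23 \<alpha>) = affine_coord j \<alpha>" if "j < 4" for j
    using that by (intro exI[of _ "[0, 1, 3, 2] ! j"])
      (auto simp: affine_coord_def numeral_eq_Suc less_Suc_eq)
qed (auto simp: inj_def torus_def)

text \<open>Translating the exponents multiplies the polynomial by a monomial, which is invertible on
  the torus.\<close>

lemma nondefective_support_shift:
  assumes "nondefective_support TYPE('k::field) A"
  shows "nondefective_support TYPE('k) (shift n ` A)"
proof (rule nondefective_support_image[OF assms])
  show inj: "inj (shift n)" by (auto simp: inj_def)
  fix p :: "nat \<Rightarrow> 'k \<times> 'k \<times> 'k" and k B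
  assume p: "none_singular_at p k B"
  have "none_singular_at p k (shift n ` B)"
  proof (rule none_singular_at_image[OF p])
    show "inj_on (shift n) B" using inj by (rule inj_on_subset) simp
    show torus: "p i \<in> torus" if "i < k" for i
      using p that unfolding none_singular_at_def by blast
    fix i and c :: "_ \<Rightarrow> 'k" assume i: "i < k"
      and c: "\<forall>j<4. (\<Sum>\<alpha>\<in>B. c \<alpha> * (monomial3 (p i) (shift n \<alpha>)
        * of_nat (affine_coord j (shift n \<alpha>)))) = 0"
    obtain x y z where xyz: "p i = (x, y, z)" "x \<noteq> 0"
      using torus[OF i] by (auto simp: torus_def)
    have lm: "monomial3 (p i) (shift n \<alpha>) = x ^ n * monomial3 (p i) \<alpha>" for \<alpha>
      by (cases \<alpha>) (simp add: xyz power_add mult_ac)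
    have c': "(\<Sum>\<alpha>\<in>B. c \<alpha> * (monomial3 (p i) \<alpha> * of_nat (affine_coord j (shift n \<alpha>)))) = 0"
      if "j < 4" for j
    proof -
      have "x ^ n * (\<Sum>\<alpha>\<in>B. c \<alpha> * (monomial3 (p i) \<alpha> * of_nat (affine_coord j (shift n \<alpha>)))) = 0"
        using c that by (simp add: lm sum_distrib_left mult_ac)
      then show ?thesis using xyz by simp
    qed
    have af: "affine_coord 0 (shift n \<alpha>) = 1" "affine_coord 1 (shift n \<alpha>) = n * affine_coord 0 \<alpha> +
      affine_coord 1 \<alpha>"
      "affine_coord 2 (shift n \<alpha>) = affine_coord 2 \<alpha>" "affine_coord 3 (shift n \<alpha>) =
        affine_coord 3 \<alpha>" "affine_coord 0 \<alpha> = 1" for \<alpha>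
      by (cases \<alpha>; simp add: affine_coord_def numeral_eq_Suc)+
    have 0: "(\<Sum>\<alpha>\<in>B. c \<alpha> * monomial3 (p i) \<alpha>) = 0"
      using c'[of 0] by (simp add: af)
    have "0 = (\<Sum>\<alpha>\<in>B. of_nat n * (c \<alpha> * monomial3 (p i) \<alpha>) + c \<alpha> * (monomial3 (p i)
      \<alpha> * of_nat (affine_coord 1 \<alpha>)))"
      using c'[of 1] by (simp add: af[unfolded One_nat_def] algebra_simps)
    also have "\<dots> = jet B c (p i) 1"
      by (simp add: sum.distrib 0 flip: sum_distrib_left)
    finally show "\<forall>j<4. jet B c (p i) j = 0"
      unfolding all_less_4 using 0 c'[of 2] c'[of 3] by (simp add: af)
  qed
  then show "\<exists>p' :: nat \<Rightarrow> 'k \<times> 'k \<times> 'k. none_singular_at p' k (shift n ` B)" by blast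
qed

lemma swap_box: "swap12 ` box a b c = box b a c" "swap23 ` box a b c = box a c b"
  by (force simp: box_def)+

lemma nondefective_box_swap:
  "nondefective_support TYPE('k::field) (box a b c) \<Longrightarrow> nondefective_support TYPE('k) (box b a c)"
  "nondefective_support TYPE('k) (box a b c) \<Longrightarrow> nondefective_support TYPE('k) (box a c b)"
  using nondefective_support_swap12 nondefective_support_swap23 swap_box by metis+

lemma nondefective_support_stack:
  assumes "nondefective_support TYPE('k::field_char_0) (box a b c)" "nondefective_support TYPE('k)
    A" "4 dvd a * b * c"
  shows "nondefective_support TYPE('k) (box a b c \<union> shift a ` A)"
proof (rule nondefective_support_separated[where l = "(1, 0, 0)" and s = "int a"])
  show "4 dvd card (box a b c)" using assms(3) by (simp add: card_box)
  show "lform (1, 0, 0) \<alpha> < int a" if "\<alpha> \<in> box a b c" for \<alpha>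
    using that by (cases \<alpha>) (simp add: box_def)
  show "lform (1, 0, 0) \<alpha> \<ge> int a" if "\<alpha> \<in> shift a ` A" for \<alpha>
    using that by (auto elim!: imageE)
qed (rule assms(1) nondefective_support_shift[OF assms(2)])+

lemma nondefective_box_stack:
  assumes "nondefective_support TYPE('k::field_char_0) (box a b c)" "nondefective_support TYPE('k)
    (box a' b c)"
    "4 dvd a * b * c"
  shows "nondefective_support TYPE('k) (box (a + a') b c)"
proof -
  have "box (a + a') b c = box a b c \<union> shift a ` box a' b c"
  proof (rule Set.set_eqI)
    fix \<alpha> :: "nat \<times> nat \<times> nat"
    obtain x y z where \<alpha>: "\<alpha> = (x, y, z)" by (cases \<alpha>)
    have "\<alpha> \<in> shift a ` box a' b c \<longleftrightarrow> a \<le> x \<and> x < a + a' \<and> y < b \<and> z < c"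
    proof
      assume "\<alpha> \<in> shift a ` box a' b c"
      then obtain u v w where "(u, v, w) \<in> box a' b c" "\<alpha> = shift a (u, v, w)"
        by (auto elim!: imageE)
      then show "a \<le> x \<and> x < a + a' \<and> y < b \<and> z < c" by (simp add: \<alpha> box_def)
    next
      assume "a \<le> x \<and> x < a + a' \<and> y < b \<and> z < c"
      then show "\<alpha> \<in> shift a ` box a' b c"
        by (intro image_eqI[of _ _ "(x - a, y, z)"]) (auto simp: \<alpha> box_def)
    qed
    moreover have "\<alpha> \<in> box n b c \<longleftrightarrow> x < n \<and> y < b \<and> z < c" for n
      by (simp add: \<alpha> box_def)
    ultimately show "\<alpha> \<in> box (a + a') b c \<longleftrightarrow> \<alpha> \<in> box a b c \<union> shift a ` box a' b c"
      by auto
  qed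
  then show ?thesis using nondefective_support_stack[OF assms] by simp
qed

lemma set_tl_box_list:
  assumes "a > 0" "b > 0" "c > 0"
  shows "set (tl (box_list a b c)) = box a b c - {(0, 0, 0)}"
proof -
  have "box_list a b c = (0, 0, 0) # tl (box_list a b c)"
    using assms by (simp add: box_list_def upt_conv_Cons)
  moreover have "distinct (box_list a b c)"
    by (simp add: box_list_def distinct_product)
  ultimately show ?thesis
    using set_box_list[of a b c] by (metis distinct.simps(2) list.simps(15) Diff_insert_absorb)
qed

text \<open>The certificates for the small boxes to which all others reduce, and for two boxes
  without a corner. The planes come from a randomized search that cuts off one tetrahedron at a
  time.\<close>

lemma nondefective_box_222: "nondefective_support TYPE('k::field_char_0) (box 2 2 2)"
  unfolding set_box_list[symmetric]
  by (rule nondefective_support_peel[of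
      "[(1, 1, -1, 1)]"
      "[(0, 1, 0), (1, 0, 0), (1, 1, 1), (1, 1, 0)]"])
     code_simp

lemma nondefective_box_332: "nondefective_support TYPE('k::field_char_0) (box 3 3 2)"
  unfolding set_box_list[symmetric]
  by (rule nondefective_support_peel[of
      "[(1, 1, -1, 1), (-1, -1, 1, -2), (1, -1, 0, 0), (-1, 1, 0, 0)]"
      "[(1, 1, 0), (1, 1, 1), (0, 0, 0), (0, 1, 0)]"])
     code_simp

lemma nondefective_box_432: "nondefective_support TYPE('k::field_char_0) (box 4 3 2)"
  unfolding set_box_list[symmetric]
  by (rule nondefective_support_peel[of
      "[(-1, 1, 1, -1), (-1, 2, 0, 0), (-1, 0, 1, -1), (0, 1, 1, 2), (-1, -1, 0, -2)]"
      "[(1, 1, 1), (0, 2, 0), (0, 2, 1), (0, 1, 1)]"])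
     code_simp

lemma nondefective_box_532: "nondefective_support TYPE('k::field_char_0) (box 5 3 2)"
  unfolding set_box_list[symmetric]
  by (rule nondefective_support_peel[of
      "[(1, -1, -1, -1), (1, -2, 0, -1), (1, 0, 1, 2), (-1, 1, -1, -3), (-2, -1, 1, -7),
        (-1, -2, -1, -4), (-1, 1, 1, 0)]"
      "[(1, 0, 1), (1, 1, 1), (0, 0, 0), (0, 0, 1)]"])
     code_simp

lemma nondefective_box_632: "nondefective_support TYPE('k::field_char_0) (box 6 3 2)"
  unfolding set_box_list[symmetric]
  by (rule nondefective_support_peel[of
      "[(1, 1, 1, 2), (-1, -1, -1, -6), (-1, -2, 0, -6), (-2, 0, -2, -8), (-1, 1, 0, -2),
        (-1, -2, -1, -5), (2, -1, 0, 1), (2, -1, -2, 2)]"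
      "[(2, 0, 1), (2, 1, 0), (2, 0, 0), (3, 1, 0)]"])
     code_simp

lemma nondefective_box_552: "nondefective_support TYPE('k::field_char_0) (box 5 5 2)"
  unfolding set_box_list[symmetric]
  by (rule nondefective_support_peel[of
      "[(-1, 1, -1, -3), (1, -1, 1, -2), (-1, -1, -1, -7), (-2, -1, 0, -9),
        (-1, -2, -1, -9), (1, 1, -1, 1), (2, 1, 0, 3), (1, -1, 2, 0), (1, -2, 0, -2),
        (2, 1, 2, 6), (0, 2, 2, 4), (-2, -1, -1, -6)]"
      "[(2, 2, 0), (2, 1, 1), (0, 0, 0), (0, 0, 1)]"])
     code_simp

lemma nondefective_box_433: "nondefective_support TYPE('k::field_char_0) (box 4 3 3)"
  unfolding set_box_list[symmetric]
  by (rule nondefective_support_peel[of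
      "[(-1, -1, -1, -5), (-1, 1, 1, -1), (1, -1, 1, 0), (-1, 0, 1, -1), (-1, -1, 1, -1),
        (1, 0, 1, 2), (1, 1, 0, 2), (-1, 0, 0, -1)]"
      "[(1, 1, 1), (1, 1, 2), (1, 2, 2), (0, 2, 2)]"])
     code_simp

lemma nondefective_box_533: "nondefective_support TYPE('k::field_char_0) (box 5 3 3)"
  unfolding set_box_list[symmetric]
  by (rule nondefective_support_peel[of
      "[(1, -1, 1, 0), (-1, -1, 1, -4), (1, 1, -1, 0), (-2, 2, -2, -8), (1, 1, 0, 2),
        (-1, 1, 0, -2), (2, 0, 1, 4), (2, 1, 1, 6), (2, 2, 0, 8), (1, 0, -1, 2),
        (2, 1, 0, 10)]"
      "[(4, 2, 2), (0, 0, 0), (0, 0, 1), (0, 1, 0)]"])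
     code_simp

lemma nondefective_box_733: "nondefective_support TYPE('k::field_char_0) (box 7 3 3)"
  unfolding set_box_list[symmetric]
  by (rule nondefective_support_peel[of
      "[(-1, 1, -1, -6), (1, -1, 1, 0), (-1, 2, -2, -6), (1, 1, -1, 0), (2, 2, 0, 4),
        (2, 0, 1, 4), (2, 1, 1, 6), (-1, 1, 0, -4), (2, -1, -1, 2), (-1, 2, 1, -2),
        (0, 2, 1, 3), (2, 1, 0, 8), (2, 1, -2, 7), (2, 0, 0, 10), (1, 2, -2, 8)]"
      "[(6, 2, 1), (5, 2, 0), (6, 2, 0), (0, 0, 0)]"])
     code_simp

lemma nondefective_box_553: "nondefective_support TYPE('k::field_char_0) (box 5 5 3)"
  unfolding set_box_list[symmetric]
  by (rule nondefective_support_peel[of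
      "[(2, -2, 2, -4), (-1, 1, -1, -4), (2, -1, 2, 0), (1, 1, -1, 0), (1, 1, 0, 2),
        (1, -1, 0, -2), (2, 1, 2, 5), (-1, -1, -1, -8), (-1, 2, 1, -1), (-2, 1, 2, -4),
        (-1, -1, 0, -6), (0, -1, 1, -2), (-1, -1, 2, -3), (-1, 2, 1, 1), (2, 1, 1, 6),
        (1, 2, 0, 6), (2, -2, 1, 0), (2, -1, -1, 2)]"
      "[(3, 2, 2), (3, 2, 1), (4, 2, 2), (0, 0, 0)]"])
     code_simp

lemma nondefective_box_555: "nondefective_support TYPE('k::field_char_0) (box 5 5 5)"
  unfolding set_box_list[symmetric]
  by (rule nondefective_support_peel[of
      "[(1, 1, -1, -2), (1, -1, 1, -2), (-1, -1, 1, -6), (2, 2, 2, 4), (-2, 2, 2, -4),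
        (2, -2, 1, -4), (-2, 2, 1, -4), (-2, -2, 1, -12), (-2, -1, 1, -8), (-1, 2, 1, 0),
        (0, -2, 2, -4), (1, 2, -2, -4), (1, 2, -1, 0), (-2, 2, -1, -8), (1, 2, 0, 3),
        (1, 0, 1, 2), (-2, 1, 1, -3), (-1, 2, -1, -3), (-2, -1, -1, -13), (-1, 1, 2, 2),
        (-2, 2, 1, 1), (-2, 1, 1, 0), (-1, 1, -1, -3), (1, 1, 1, 5), (1, 1, 2, 8),
        (2, 1, 1, 7), (2, 1, 0, 5), (2, 1, 1, 9), (2, -1, -2, -7), (-1, -1, 2, 0),
        (-1, 1, -1, -1)]"
      "[(2, 4, 3), (0, 0, 0), (0, 0, 1), (0, 1, 0)]"])
     code_simp

lemmas nondefective_base_boxes =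
  nondefective_box_222 nondefective_box_332 nondefective_box_432 nondefective_box_532
    nondefective_box_632 nondefective_box_552
  nondefective_box_433 nondefective_box_533 nondefective_box_733 nondefective_box_553
    nondefective_box_555

lemma nondefective_box_322_minus_corner:
  "nondefective_support TYPE('k::field_char_0) (box 3 2 2 - {(0, 0, 0)})"
  unfolding set_tl_box_list[of 3 2 2, simplified, symmetric]
  by (rule nondefective_support_peel[of
      "[(-1, -1, -1, -2), (-1, 0, 0, 0)]"
      "[(0, 1, 1), (0, 0, 1), (0, 1, 0), (1, 0, 0)]"])
     code_simp

lemma nondefective_box_333_minus_corner:
  "nondefective_support TYPE('k::field_char_0) (box 3 3 3 - {(0, 0, 0)})"
  unfolding set_tl_box_list[of 3 3 3, simplified, symmetric]
  by (rule nondefective_support_peel[of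
      "[(-1, 1, -1, -2), (-1, -1, 1, -2), (-1, 1, 0, 0), (0, 1, -1, 0), (1, 0, -1, 0),
       (-1, 0, 0, 0)]"
      "[(0, 1, 0), (0, 2, 0), (0, 0, 1), (1, 0, 0)]"])
     code_simp

text \<open>The numbers are the side lengths of the box of exponents, which exceed the degrees by
  one.\<close>

definition exceptional :: "nat \<Rightarrow> nat \<Rightarrow> nat \<Rightarrow> bool" where
  "exceptional a b c \<longleftrightarrow> b = 2 \<and> c = 2 \<and> odd a \<or> a = 2 \<and> c = 2 \<and> odd b \<or> a = 2 \<and> b = 2 \<and> odd c \<or>
     a = 3 \<and> b = 3 \<and> c = 3"

text \<open>A slab of width four, whose number of points is divisible by four, is cut off a box with
  a side of length at least six. The remaining box may be exceptional only for the side lengths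
  \<open>7, 3, 3\<close>, \<open>6, 3, 2\<close> and \<open>6, 5, 2\<close>; the first two have certificates, and a slab of width two is
  cut off the third. When all sides are at most five, a slab of width two is cut off if its number
  of points is divisible by four and no exceptional box arises; nine boxes are left.\<close>

theorem nondefective_box:
  assumes "a \<ge> 2" "b \<ge> 2" "c \<ge> 2" "\<not> exceptional a b c"
  shows "nondefective_support TYPE('k::field_char_0) (box a b c)"
  using assms
proof (induction "a + b + c" arbitrary: a b c rule: less_induct)
  case less
  let ?good = "\<lambda>a b c. nondefective_support TYPE('k) (box a b c)"
  have swap: "?good a b c = ?good b a c" "?good a b c = ?good a c b" for a b c
    using nondefective_box_swap by metis+
  have cut: "?good x y z" if "x + y + z = a + b + c" "4 dvd w * y * z" "2 \<le> w" "w + 2 \<le> x" "2 \<le> y"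
    "2 \<le> z"
    "\<not> exceptional w y z" "\<not> exceptional (x - w) y z" for w x y z
  proof -
    have "?good w y z" "?good (x - w) y z"
      using that by (intro less.hyps; simp)+
    from nondefective_box_stack[OF this that(2)] that(4) show ?thesis by simp
  qed
  have sorted: "?good x y z" if xyz: "x \<ge> y" "y \<ge> z" "z \<ge> 2" "\<not> exceptional x y z" "x + y + z = a +
    b + c"
    for x y z
  proof (cases "x \<ge> 6")
    case True
    show ?thesis
    proof (cases "exceptional (x - 4) y z")
      case False
      show ?thesis
        by (rule cut[of _ _ _ 4]) (use xyz True False in \<open>auto simp: exceptional_def\<close>)
    next
      case e: True
      have "x = 7 \<and> y = 3 \<and> z = 3 \<or> x = 6 \<and> z = 2 \<and> odd y"
        using e xyz True by (auto simp: exceptional_def)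
      moreover have "y = 3 \<or> y = 5" if "x = 6" "odd y"
      proof -
        have "y \<in> {2, 3, 4, 5, 6}" using that xyz by auto
        then show ?thesis using that by auto
      qed
      moreover have "?good 5 6 2" if "x = 6" "y = 5" "z = 2"
        by (rule cut[of _ _ _ 2]) (use that xyz in \<open>auto simp: exceptional_def\<close>)
      ultimately show ?thesis using nondefective_box_733 nondefective_box_632 swap by metis
    qed
  next
    case False
    then have "x = 2 \<or> x = 3 \<or> x = 4 \<or> x = 5" "y = 2 \<or> y = 3 \<or> y = 4 \<or> y = 5"
      "z = 2 \<or> z = 3 \<or> z = 4 \<or> z = 5"
      using xyz(1-3) by linarith+
    then have "(x, y, z) \<in> {(2, 2, 2), (3, 3, 2), (4, 3, 2), (5, 3, 2), (5, 5, 2), (4, 3, 3), (5, 3,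
      3),
        (5, 5, 3), (5, 5, 5)} \<or>
      4 \<le> x \<and> even (y * z) \<and> \<not> exceptional 2 y z \<and> \<not> exceptional (x - 2) y z"
      using xyz(1,2,4) by (elim disjE) (simp_all add: exceptional_def)
    then show ?thesis
    proof
      assume "(x, y, z) \<in> {(2, 2, 2), (3, 3, 2), (4, 3, 2), (5, 3, 2), (5, 5, 2), (4, 3, 3), (5, 3,
        3),
        (5, 5, 3), (5, 5, 5)}"
      then show ?thesis using nondefective_base_boxes by auto
    next
      assume h: "4 \<le> x \<and> even (y * z) \<and> \<not> exceptional 2 y z \<and> \<not> exceptional (x - 2) y z"
      then have "4 dvd 2 * y * z"
        using mult_dvd_mono[of 2 2 2 "y * z"] by (simp add: mult.assoc)
      then show ?thesis
        using h xyz by (intro cut[of _ _ _ 2]) auto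
    qed
  qed
  show ?case
  proof (cases rule: le_cases3[of a b c])
    case 1
    then have "?good c b a" using less.prems by (intro sorted) (auto simp: exceptional_def)
    then show ?thesis using swap by metis
  next
    case 2
    then have "?good c a b" using less.prems by (intro sorted) (auto simp: exceptional_def)
    then show ?thesis using swap by metis
  next
    case 3
    then have "?good b c a" using less.prems by (intro sorted) (auto simp: exceptional_def)
    then show ?thesis using swap by metis
  next
    case 4
    then have "?good a b c" using less.prems by (intro sorted) (auto simp: exceptional_def)
    then show ?thesis using swap by metis
  next
    case 5
    then have "?good a c b" using less.prems by (intro sorted) (auto simp: exceptional_def)
    then show ?thesis using swap by metis
  next
    case 6
    then have "?good b a c" using less.prems by (intro sorted) (auto simp: exceptional_def)
    then show ?thesis using swap by metis
  qed
qed

lemma card_box_minus_corner: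
  assumes "a > 0" "b > 0" "c > 0"
  shows "card (box a b c - {(0, 0, 0)}) + 1 = a * b * c"
proof -
  have "(0, 0, 0) \<in> box a b c" using assms by (simp add: box_def)
  then show ?thesis
    using assms by (simp add: card_Diff_singleton card_box)
qed

text \<open>The box itself is exceptional. Removing one point from a slab of width three makes that
  slab decomposable, and the other slab has even width.\<close>

lemma nondefective_odd_box:
  assumes "odd a" "a \<ge> 3"
  shows "\<exists>A\<subseteq>box a 2 2. card A + 1 = 4 * a \<and> nondefective_support TYPE('k::field_char_0) A"
proof (cases "a = 3")
  case True
  show ?thesis
    using nondefective_box_322_minus_corner card_box_minus_corner[of 3 2 2]
    by (intro exI[of _ "box 3 2 2 - {(0, 0, 0)}"]) (simp add: True)
next
  case False
  define n where "n = a - 3"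
  have n: "a = n + 3" "n \<ge> 2" "even n" using assms False unfolding n_def by presburger+
  define B where "B = box 3 2 2 - {(0, 0, 0)}"
  have B: "nondefective_support TYPE('k) B" "card B = 11"
    using nondefective_box_322_minus_corner card_box_minus_corner[of 3 2 2] by (simp_all add: B_def)
  have memB: "x < 3 \<and> y < 2 \<and> z < 2" if "(x, y, z) \<in> B" for x y z
    using that by (simp add: B_def box_def)
  let ?A = "box n 2 2 \<union> shift n ` B"
  have "nondefective_support TYPE('k) (box n 2 2)"
    by (rule nondefective_box) (use n in \<open>auto simp: exceptional_def\<close>)
  then have "nondefective_support TYPE('k) ?A"
    by (rule nondefective_support_stack[OF _ B(1)]) simp
  moreover have sub: "?A \<subseteq> box a 2 2"
    using memB by (fastforce simp: n(1) box_def)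
  moreover have "card ?A = 4 * n + 11"
  proof -
    have "box n 2 2 \<inter> shift n ` B = {}" by (auto simp: box_def)
    moreover have "card (shift n ` B) = card B"
      by (rule card_image) (auto simp: inj_on_def)
    ultimately show ?thesis
      using B by (subst card_Un_disjoint) (auto simp: card_box nondefective_support_def)
  qed
  ultimately show ?thesis by (intro exI[of _ ?A]) (simp add: n(1))
qed

section \<open>Parametrization of the secant varieties\<close>

definition binom3 :: "nat \<Rightarrow> nat \<Rightarrow> nat \<Rightarrow> nat \<times> nat \<times> nat \<Rightarrow> 'k::field" where
  "binom3 d e f = (\<lambda>(i, j, l). of_nat ((d choose i) * (e choose j) * (f choose l)))"

text \<open>The coordinates of the tensor product of powers of \<open>(1, x)\<close>, \<open>(1, y)\<close> and \<open>(1, z)\<close>.\<close>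

definition sv_vec :: "nat \<Rightarrow> nat \<Rightarrow> nat \<Rightarrow> 'k::field \<times> 'k \<times> 'k \<Rightarrow> nat \<times> nat \<times> nat \<Rightarrow> 'k" where
  "sv_vec d e f u \<alpha> = binom3 d e f \<alpha> * monomial3 u \<alpha>"

text \<open>The inverse of grouping the parameters by four: one scalar and one point of the chart for
  each summand.\<close>

definition pack4 :: "(nat \<Rightarrow> 'a) \<Rightarrow> (nat \<Rightarrow> 'a) \<Rightarrow> (nat \<Rightarrow> 'a) \<Rightarrow> (nat \<Rightarrow> 'a) \<Rightarrow> nat \<Rightarrow> 'a" where
  "pack4 a b c d n =
     (let i = n div 4; j = n mod 4 in if j = 0 then a i else if j = 1 then b i else if j =
       2 then c i else d i)"

lemma div_mod_4:
  "4 * i div 4 = i" "(4 * i + 1) div 4 = i" "(4 * i + 2) div 4 = i" "(4 * i + 3) div 4 = i"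
  "4 * i mod 4 = 0" "(4 * i + 1) mod 4 = 1" "(4 * i + 2) mod 4 = 2" "(4 * i + 3) mod 4 = (3::nat)"
  by presburger+

lemma pack4:
  "pack4 a b c d (4 * i) = a i" "pack4 a b c d (4 * i + 1) = b i"
  "pack4 a b c d (4 * i + 2) = c i" "pack4 a b c d (4 * i + 3) = d i"
  unfolding pack4_def div_mod_4 by simp_all

definition secant_param ::
  "nat \<Rightarrow> nat \<Rightarrow> nat \<Rightarrow> nat \<Rightarrow> (nat \<Rightarrow> 'k::field) \<Rightarrow> nat \<times> nat \<times> nat \<Rightarrow> 'k" where
  "secant_param d e f k x \<alpha> =
     (\<Sum>i<k. x (4 * i) * sv_vec d e f (x (4 * i + 1), x (4 * i + 2), x (4 * i + 3)) \<alpha>)"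

lemma binom3_nonzero: "\<alpha> \<in> box (Suc d) (Suc e) (Suc f) \<Longrightarrow> binom3 d e f \<alpha> \<noteq> (0 :: 'k::field_char_0)"
  by (cases \<alpha>) (auto simp: binom3_def box_def)

lemma sv_vec_eq_tensor3:
  "sv_vec d e f (x, y, z) = tensor3 (sym_pow_elem d (1, x)) (sym_pow_elem e (1, y))
    (sym_pow_elem f (1, z))"
  by (auto simp: sv_vec_def binom3_def tensor3_def sym_pow_elem_def fun_eq_iff mult_ac)

lemma sym_pow_elem_outside: "i > d \<Longrightarrow> sym_pow_elem d u i = 0"
  by (simp add: sym_pow_elem_def binomial_eq_0)

lemma tensor3_in_sv_space:
  "tensor3 (sym_pow_elem d u) (sym_pow_elem e v) (sym_pow_elem f w) \<in> sv_space d e f"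
  by (auto simp: sv_space_def tensor3_def sym_pow_elem_outside not_le)

lemma sym_pow_elem_nonzero:
  assumes "u \<noteq> (0, 0)"
  shows "\<exists>i. sym_pow_elem d u i \<noteq> (0 :: 'k::field)"
proof (cases "fst u = 0")
  case True
  then have "snd u \<noteq> 0" using assms by (cases u) auto
  then show ?thesis by (intro exI[of _ d]) (simp add: sym_pow_elem_def)
next
  case False
  then show ?thesis by (intro exI[of _ 0]) (simp add: sym_pow_elem_def)
qed

lemma tensor3_nonzero:
  fixes u v w :: "'k::field \<times> 'k"
  assumes "u \<noteq> (0, 0)" "v \<noteq> (0, 0)" "w \<noteq> (0, 0)"
  shows "tensor3 (sym_pow_elem d u) (sym_pow_elem e v) (sym_pow_elem f w) \<noteq> 0"
proof -
  obtain i j l where "sym_pow_elem d u i \<noteq> 0" "sym_pow_elem e v j \<noteq> 0" "sym_pow_elem f w l \<noteq> 0"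
    using sym_pow_elem_nonzero assms by metis
  then have "tensor3 (sym_pow_elem d u) (sym_pow_elem e v) (sym_pow_elem f w) (i, j, l) \<noteq> 0"
    by (simp add: tensor3_def)
  then show ?thesis by (metis zero_fun_apply)
qed

lemma segre_veronese_subset: "segre_veronese d e f \<subseteq> proj_space (sv_space d e f)"
  unfolding segre_veronese_def proj_space_def
  using tensor3_in_sv_space tensor3_nonzero by blast

lemma subspace_sv_space: "coord.subspace (sv_space d e f)"
  by (auto simp: coord.subspace_def sv_space_def vec_scale_def)

lemma secant_param_in_sv_space: "secant_param d e f k x \<in> sv_space d e f"
proof -
  have "secant_param d e f k x = (\<Sum>i<k. vec_scale (x (4 * i)) (sv_vec d e f (x (4 * i + 1),
    x (4 * i + 2), x (4 * i + 3))))"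
    by (simp add: fun_eq_iff secant_param_def sum_fun_apply vec_scale_def)
  then show ?thesis
    by (simp only: sv_vec_eq_tensor3)
       (intro coord.subspace_sum coord.subspace_scale subspace_sv_space tensor3_in_sv_space)
qed

lemma secant_param_poly: "polyfun (4 * k) (\<lambda>x. secant_param d e f k x \<alpha>)"
proof -
  obtain a b c where \<alpha>: "\<alpha> = (a, b, c)" by (cases \<alpha>)
  show ?thesis
    unfolding secant_param_def sv_vec_def \<alpha> monomial3.simps
    by (intro polyfun_sum polyfun_mult polyfun_power polyfun_const polyfun_var) auto
qed

definition span_union ::
  "('i \<Rightarrow> 'k::field) set \<Rightarrow> ('i \<Rightarrow> 'k) set set \<Rightarrow> nat \<Rightarrow> ('i \<Rightarrow> 'k) set set" where
  "span_union V Y k = \<Union>{proj_span V (p ` {..<k}) | p. \<forall>j<k. p j \<in> Y}"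

lemma secant_variety_eq: "secant_variety V Y k = zariski V closure_of span_union V Y k"
  by (simp add: secant_variety_def span_union_def)

lemma span_union_subset: "span_union V Y k \<subseteq> proj_space V"
  by (auto simp: span_union_def proj_span_def)

lemma secant_variety_subset: "secant_variety V Y k \<subseteq> proj_space V"
  unfolding secant_variety_eq using closure_of_subset_topspace[of "zariski V"] by simp

lemma span_union_in_secant: "span_union V Y k \<subseteq> secant_variety V Y k"
  unfolding secant_variety_eq by (rule closure_of_subset) (simp add: span_union_subset)

lemma sv_vec_point: "proj_point (sv_vec d e f u) \<in> segre_veronese d e f"
proof -
  obtain x y z where u: "u = (x, y, z)" by (cases u)
  show ?thesis
    unfolding segre_veronese_def u
    by (intro CollectI exI[of _ "(1, x)"] exI[of _ "(1, y)"] exI[of _ "(1, z)"])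
      (simp add: sv_vec_eq_tensor3)
qed

lemma in_proj_point: "v \<in> proj_point v"
  by (simp add: proj_point_def coord.span_base)

lemma secant_param_in_span_union:
  "image_points (secant_param d e f k) \<subseteq> span_union (sv_space d e f) (segre_veronese d e f) k"
proof
  fix q assume "q \<in> image_points (secant_param d e f k :: _ \<Rightarrow> _ \<Rightarrow> 'a)"
  then obtain x :: "nat \<Rightarrow> 'a" where x: "q = proj_point (secant_param d e f k x)"
    "secant_param d e f k x \<noteq> 0"
    by (auto simp: image_points_def)
  let ?T = "\<lambda>i. sv_vec d e f (x (4 * i + 1), x (4 * i + 2), x (4 * i + 3))"
  let ?p = "\<lambda>i. proj_point (?T i)"
  have "secant_param d e f k x = (\<Sum>i<k. vec_scale (x (4 * i)) (?T i))"
    by (simp add: fun_eq_iff secant_param_def sum_fun_apply vec_scale_def)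
  moreover have "?T i \<in> \<Union>(?p ` {..<k})" if "i < k" for i
    using that in_proj_point by blast
  ultimately have "secant_param d e f k x \<in> coord_span (\<Union>(?p ` {..<k}))"
    by (auto intro!: coord.span_sum coord.span_scale intro: coord.span_base)
  then have "q \<subseteq> coord_span (\<Union>(?p ` {..<k}))"
    unfolding x(1) proj_point_def by (intro coord.span_minimal) auto
  moreover have "q \<in> proj_space (sv_space d e f)"
    unfolding x(1) proj_space_def using x(2) secant_param_in_sv_space by blast
  ultimately have "q \<in> proj_span (sv_space d e f) (?p ` {..<k})"
    by (simp add: proj_span_def)
  then show "q \<in> span_union (sv_space d e f) (segre_veronese d e f) k"
    unfolding span_union_def using sv_vec_point by blast
qed

lemma sym_pow_elem_normalize:
  assumes "u \<noteq> (0 :: 'k::field)"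
  shows "sym_pow_elem d (u, v) i = u ^ d * sym_pow_elem d (1, v / u) i"
proof (cases "i \<le> d")
  case True
  then have "u ^ d = u ^ (d - i) * u ^ i" by (simp flip: power_add)
  then show ?thesis using assms by (simp add: sym_pow_elem_def power_divide)
qed (simp add: sym_pow_elem_outside)

text \<open>The points may repeat, so the linear combinations are indexed by the numbers below \<open>k\<close>
  and not by the points.\<close>

lemma span_union_elem:
  assumes "q \<in> span_union V (segre_veronese d e f) k" "v \<in> q"
  obtains c u1 u2 u3 where
    "v = (\<Sum>i<k. vec_scale (c i) (tensor3 (sym_pow_elem d (u1 i)) (sym_pow_elem e (u2 i))
      (sym_pow_elem f (u3 i))))"
proof -
  obtain p where p: "\<forall>i<k. p i \<in> segre_veronese d e f" "q \<subseteq> coord_span (\<Union>(p ` {..<k}))"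
    using assms(1) by (auto simp: span_union_def proj_span_def)
  have "\<forall>i. \<exists>u v w. i < k \<longrightarrow> p i = proj_point (tensor3 (sym_pow_elem d u) (sym_pow_elem e v)
    (sym_pow_elem f w))"
    using p(1) unfolding segre_veronese_def by blast
  then obtain u1 u2 u3 where u: "\<And>i. i < k \<Longrightarrow>
      p i = proj_point (tensor3 (sym_pow_elem d (u1 i)) (sym_pow_elem e (u2 i))
        (sym_pow_elem f (u3 i)))"
    by metis
  let ?T = "\<lambda>i. tensor3 (sym_pow_elem d (u1 i)) (sym_pow_elem e (u2 i)) (sym_pow_elem f (u3 i))"
  let ?W = "coord_span (?T ` {..<k})"
  have "\<Union>(p ` {..<k}) \<subseteq> ?W"
    using u by (auto simp: proj_point_def intro: coord.span_mono[THEN subsetD, rotated])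
  then have "v \<in> ?W"
    using p(2) assms(2) coord.span_minimal[OF _ coord.subspace_span, of "\<Union>(p ` {..<k})"] by blast
  then have "\<exists>c. v = (\<Sum>i<k. vec_scale (c i) (?T i))"
  proof (induction rule: coord.span_induct_alt)
    case base
    show ?case by (intro exI[of _ "\<lambda>_. 0"]) simp
  next
    case (step a x y)
    then obtain c j where c: "y = (\<Sum>i<k. vec_scale (c i) (?T i))" "j < k" "x = ?T j" by blast
    have "vec_scale a x + y = (\<Sum>i<k. vec_scale (if i = j then a else 0) (?T i) + vec_scale (c i)
      (?T i))"
      using c(2) by (simp add: sum.distrib c(1,3) if_distrib[where f =
        "\<lambda>x. vec_scale x _"] cong: if_cong)
    also have "\<dots> = (\<Sum>i<k. vec_scale ((if i = j then a else 0) + c i) (?T i))"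
      by (simp add: coord.scale_left_distrib)
    finally show ?case
      by (intro exI[of _ "\<lambda>i. (if i = j then a else 0) + c i"])
  qed
  then show ?thesis using that by blast
qed

text \<open>The parametrization reaches only points on the chart where no first coordinate vanishes.
  Adding \<open>t\<close> to all the first coordinates moves an arbitrary combination into this chart for all
  but finitely many \<open>t\<close>, and \<open>G\<close> is a polynomial in \<open>t\<close> along this curve.\<close>

lemma secant_param_dense:
  fixes G :: "(nat \<times> nat \<times> nat, 'k::field_char_0) cpoly"
  assumes G: "\<And>x. cpoly_eval G (secant_param d e f k x) = 0"
  shows "vanishes G (\<Union>(span_union V (segre_veronese d e f) k))"
  unfolding vanishes_def
proof
  fix v assume "v \<in> \<Union>(span_union V (segre_veronese d e f) k :: (_ \<Rightarrow> 'k) set set)"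
  then obtain q where "q \<in> span_union V (segre_veronese d e f) k" "v \<in> q" by blast
  then obtain c and u1 u2 u3 :: "nat \<Rightarrow> 'k \<times> 'k" where v:
    "v = (\<Sum>i<k. vec_scale (c i) (tensor3 (sym_pow_elem d (u1 i)) (sym_pow_elem e (u2 i))
      (sym_pow_elem f (u3 i))))"
    by (rule span_union_elem)
  define w where "w t \<alpha> = (case \<alpha> of (a, b, l) \<Rightarrow> \<Sum>i<k. c i * (sym_pow_elem d (fst (u1 i) + t,
    snd (u1 i)) a *
     sym_pow_elem e (fst (u2 i) + t, snd (u2 i)) b * sym_pow_elem f (fst (u3 i) + t, snd (u3 i))
       l))" for t \<alpha>
  have v0: "v = w 0"
    by (auto simp: v w_def fun_eq_iff sum_fun_apply vec_scale_def tensor3_def)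
  have "polyfun 1 (\<lambda>x. cpoly_eval G (w (x 0)))"
  proof (rule polyfun_cpoly_eval)
    fix \<alpha> :: "nat \<times> nat \<times> nat"
    obtain a b l where \<alpha>: "\<alpha> = (a, b, l)" by (cases \<alpha>)
    show "polyfun 1 (\<lambda>x. w (x 0) \<alpha>)"
      unfolding w_def \<alpha> sym_pow_elem_def prod.case fst_conv snd_conv
      by (intro polyfun_sum polyfun_mult polyfun_power polyfun_add polyfun_const polyfun_var) auto
  qed
  from polyfun_on_line[OF this, of "\<lambda>_. 0" "\<lambda>_. 1"] obtain h where h: "\<And>t. cpoly_eval G (w t) =
    poly h t"
    by auto
  \<comment> \<open>The values of \<open>t\<close> for which some first coordinate vanishes.\<close>
  let ?E = "(\<lambda>i. - fst (u1 i)) ` {..<k} \<union> (\<lambda>i. - fst (u2 i)) ` {..<k} \<union> (\<lambda>i. - fst (u3 i)) ` {..<k}"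
  have "poly h t = 0" if t: "t \<notin> ?E" for t
  proof -
    have nz: "fst (u1 i) + t \<noteq> 0" "fst (u2 i) + t \<noteq> 0" "fst (u3 i) + t \<noteq> 0" if "i < k" for i
    proof -
      have "t \<noteq> - fst (u1 i)" "t \<noteq> - fst (u2 i)" "t \<noteq> - fst (u3 i)"
        using t that by blast+
      then show "fst (u1 i) + t \<noteq> 0" "fst (u2 i) + t \<noteq> 0" "fst (u3 i) + t \<noteq> 0"
        by (simp_all add: add_eq_0_iff)
    qed
    define x where "x = pack4
      (\<lambda>i. c i * ((fst (u1 i) + t) ^ d * (fst (u2 i) + t) ^ e * (fst (u3 i) + t) ^ f))
      (\<lambda>i. snd (u1 i) / (fst (u1 i) + t)) (\<lambda>i. snd (u2 i) / (fst (u2 i) + t))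
      (\<lambda>i. snd (u3 i) / (fst (u3 i) + t))"
    note x = pack4[of "\<lambda>i. c i * ((fst (u1 i) + t) ^ d * (fst (u2 i) + t) ^ e * (fst (u3 i) + t) ^ f)"
      "\<lambda>i. snd (u1 i) / (fst (u1 i) + t)" "\<lambda>i. snd (u2 i) / (fst (u2 i) + t)"
      "\<lambda>i. snd (u3 i) / (fst (u3 i) + t)", folded x_def]
    have "w t = secant_param d e f k x"
    proof
      fix \<alpha> :: "nat \<times> nat \<times> nat"
      obtain a b l where \<alpha>: "\<alpha> = (a, b, l)" by (cases \<alpha>)
      show "w t \<alpha> = secant_param d e f k x \<alpha>"
        unfolding w_def secant_param_def \<alpha> prod.case x sv_vec_eq_tensor3 tensor3_def
      proof (intro sum.cong refl)
        fix i assume "i \<in> {..<k}"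
        then have "i < k" by simp
        show "c i * (sym_pow_elem d (fst (u1 i) + t, snd (u1 i)) a * sym_pow_elem e (fst (u2 i) + t,
          snd (u2 i)) b *
            sym_pow_elem f (fst (u3 i) + t, snd (u3 i)) l) =
          c i * ((fst (u1 i) + t) ^ d * (fst (u2 i) + t) ^ e * (fst (u3 i) + t) ^ f) *
            (sym_pow_elem d (1, snd (u1 i) / (fst (u1 i) + t)) a * sym_pow_elem e (1, snd (u2 i)
              / (fst (u2 i) + t)) b *
             sym_pow_elem f (1, snd (u3 i) / (fst (u3 i) + t)) l)"
          unfolding sym_pow_elem_normalize[OF nz(1)[OF \<open>i < k\<close>]] sym_pow_elem_normalize[OF nz(2)[OF
            \<open>i < k\<close>]]
            sym_pow_elem_normalize[OF nz(3)[OF \<open>i < k\<close>]] by (simp only: mult_ac)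
      qed
    qed
    then show ?thesis using G h by metis
  qed
  then have "- ?E \<subseteq> {t. poly h t = 0}" by blast
  moreover have "infinite (- ?E)"
    unfolding Compl_eq_Diff_UNIV by (intro Diff_infinite_finite infinite_UNIV_char_0) simp
  ultimately have "h = 0"
    using poly_roots_finite finite_subset by blast
  then show "cpoly_eval G v = 0" using h[of 0] v0 by simp
qed

lemma secant_dim_le_parameters:
  "proj_dim (sv_space d e f) (secant_variety (sv_space d e f)
    (segre_veronese d e f :: (_ \<Rightarrow> 'k::field_char_0) set set) k)
    \<le> enat (4 * k - 1)"
  unfolding proj_dim_def
proof (rule krull_dim_le_parameters[OF secant_variety_subset secant_param_poly[of k d e f]])
  fix G :: "(nat \<times> nat \<times> nat, 'k) cpoly"
  assume "\<And>x. cpoly_eval G (\<lambda>t. secant_param d e f k x t) = 0"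
  then show "vanishes G (\<Union>(secant_variety (sv_space d e f) (segre_veronese d e f) k))"
    unfolding secant_variety_eq by (intro vanishes_closure span_union_subset secant_param_dense)
qed

lemma segre_veronese_in_span_union:
  "segre_veronese d e f \<subseteq> span_union (sv_space d e f) (segre_veronese d e f) 1"
proof
  fix q assume q: "q \<in> segre_veronese d e f"
  then have "q \<in> proj_span (sv_space d e f) ((\<lambda>_. q) ` {..<1::nat})"
    using segre_veronese_subset by (auto simp: proj_span_def intro: coord.span_base)
  then show "q \<in> span_union (sv_space d e f) (segre_veronese d e f) 1"
    unfolding span_union_def using q by (intro UnionI CollectI exI[of _ "\<lambda>_. q"]) auto
qed

lemma segre_veronese_dim_le:
  "proj_dim (sv_space d e f) (segre_veronese d e f :: (_ \<Rightarrow> 'k::field_char_0) set set) \<le> enat 3"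
proof -
  have "proj_dim (sv_space d e f) (segre_veronese d e f :: (_ \<Rightarrow> 'k) set set) \<le> enat (4 * 1 - 1)"
    unfolding proj_dim_def
  proof (rule krull_dim_le_parameters[OF segre_veronese_subset secant_param_poly[of 1 d e f]])
    fix G :: "(nat \<times> nat \<times> nat, 'k) cpoly"
    assume "\<And>x. cpoly_eval G (\<lambda>t. secant_param d e f 1 x t) = 0"
    then have "vanishes G (\<Union>(span_union (sv_space d e f) (segre_veronese d e f) 1))"
      by (rule secant_param_dense)
    then show "vanishes G (\<Union>(segre_veronese d e f))"
      by (rule vanishes_mono) (rule Union_mono[OF segre_veronese_in_span_union])
  qed
  then show ?thesis by simp
qed

section \<open>The ambient projective space\<close>

lemma sv_space_box: "v \<in> sv_space d e f \<longleftrightarrow> (\<forall>\<alpha>. \<alpha> \<notin> box (Suc d) (Suc e) (Suc f) \<longrightarrow> v \<alpha> = 0)"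
  by (simp add: sv_space_def box_def lessThan_Suc_atMost)

lemma coord_dim_sv_space:
  "coord_dim (sv_space d e f :: (_ \<Rightarrow> 'k::field) set) = Suc d * Suc e * Suc f"
proof -
  let ?I = "box (Suc d) (Suc e) (Suc f)"
  let ?u = "\<lambda>\<alpha> \<beta>. if \<beta> = \<alpha> then 1 else 0 :: 'k"
  have inj: "inj_on ?u ?I"
  proof (rule inj_onI)
    fix a b assume "?u a = ?u b"
    then have "?u a a = ?u b a" by (rule fun_cong)
    then show "a = b" by (simp split: if_splits)
  qed
  have eval: "(\<Sum>\<alpha>\<in>?I. vec_scale (c \<alpha>) (?u \<alpha>)) \<beta> = (if \<beta> \<in> ?I then c \<beta> else 0)" for c \<beta>
    by (simp add: sum_fun_apply vec_scale_def if_distrib[where f = "\<lambda>x. _ * x"] cong: if_cong)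
  have "coord.independent (?u ` ?I)"
  proof (rule coord.independent_if_scalars_zero)
    fix g x assume s: "(\<Sum>x\<in>?u ` ?I. vec_scale (g x) x) = 0" and "x \<in> ?u ` ?I"
    then obtain \<alpha> where \<alpha>: "\<alpha> \<in> ?I" "x = ?u \<alpha>" by blast
    have "(\<Sum>\<alpha>\<in>?I. vec_scale (g (?u \<alpha>)) (?u \<alpha>)) = 0"
      using s by (simp add: sum.reindex[OF inj])
    then show "g x = 0" using eval[of "\<lambda>\<alpha>. g (?u \<alpha>)" \<alpha>] \<alpha> by simp
  qed simp
  moreover have "coord_span (?u ` ?I) = sv_space d e f"
  proof
    show "coord_span (?u ` ?I) \<subseteq> sv_space d e f"
      by (rule coord.span_minimal) (auto simp: sv_space_box subspace_sv_space)
    show "sv_space d e f \<subseteq> coord_span (?u ` ?I)"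
    proof
      fix v :: "_ \<Rightarrow> 'k" assume "v \<in> sv_space d e f"
      then have "v = (\<Sum>\<alpha>\<in>?I. vec_scale (v \<alpha>) (?u \<alpha>))"
        unfolding fun_eq_iff eval by (auto simp: sv_space_box)
      also have "\<dots> \<in> coord_span (?u ` ?I)"
        by (intro coord.span_sum coord.span_scale coord.span_base) auto
      finally show "v \<in> coord_span (?u ` ?I)" .
    qed
  qed
  ultimately have "coord_dim (sv_space d e f :: (_ \<Rightarrow> 'k) set) = card (?u ` ?I)"
    by (metis coord.dim_span coord.dim_eq_card_independent)
  then show ?thesis
    by (simp add: card_image[OF inj] card_box)
qed

text \<open>The ambient space as the image of a linear map. Thereby the bounds for images of
  polynomial maps and the irreducibility of such images apply to it.\<close>

lemma sv_space_param:
  obtains \<iota> :: "(nat \<Rightarrow> 'k::field) \<Rightarrow> nat \<times> nat \<times> nat \<Rightarrow> 'k" where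
    "\<And>\<alpha>. polyfun (Suc d * Suc e * Suc f) (\<lambda>x. \<iota> x \<alpha>)" "range \<iota> = sv_space d e f"
proof -
  let ?I = "box (Suc d) (Suc e) (Suc f)" and ?N = "Suc d * Suc e * Suc f"
  obtain h where h: "bij_betw h ?I {..<?N}"
    using ex_bij_betw_finite_nat[of ?I] by (auto simp: card_box atLeast0LessThan)
  define \<iota> where "\<iota> x \<alpha> = (if \<alpha> \<in> ?I then x (h \<alpha>) else 0)" for x :: "nat \<Rightarrow> 'k" and \<alpha>
  show ?thesis
  proof (rule that[of \<iota>])
    show "polyfun ?N (\<lambda>x. \<iota> x \<alpha>)" for \<alpha>
    proof (cases "\<alpha> \<in> ?I")
      case True
      then have "h \<alpha> < ?N" using bij_betwE[OF h] by blast
      then show ?thesis using True by (simp add: \<iota>_def polyfun_var)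
    qed (simp add: \<iota>_def)
    have "v \<in> range \<iota>" if "v \<in> sv_space d e f" for v
    proof (rule range_eqI)
      show "v = \<iota> (\<lambda>n. v (inv_into ?I h n))"
        using that h by (auto simp: \<iota>_def fun_eq_iff sv_space_box bij_betw_def)
    qed
    moreover have "\<iota> x \<in> sv_space d e f" for x by (simp add: sv_space_box \<iota>_def)
    ultimately show "range \<iota> = sv_space d e f" by blast
  qed
qed

lemma proj_dim_le_ambient:
  assumes "Y \<subseteq> proj_space (sv_space d e f :: (_ \<Rightarrow> 'k::field_char_0) set)"
  shows "proj_dim (sv_space d e f) Y \<le> enat (Suc d * Suc e * Suc f - 1)"
proof -
  obtain \<iota> :: "(nat \<Rightarrow> 'k) \<Rightarrow> nat \<times> nat \<times> nat \<Rightarrow> 'k" where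
    \<iota>: "\<And>\<alpha>. polyfun (Suc d * Suc e * Suc f) (\<lambda>x. \<iota> x \<alpha>)" "range \<iota> = sv_space d e f"
    by (rule sv_space_param[of d e f]) blast
  show ?thesis unfolding proj_dim_def
  proof (rule krull_dim_le_parameters[OF assms \<iota>(1)])
    fix G :: "(nat \<times> nat \<times> nat, 'k) cpoly"
    assume "\<And>x. cpoly_eval G (\<lambda>t. \<iota> x t) = 0"
    then have "cpoly_eval G v = 0" if "v \<in> sv_space d e f" for v
      using that \<iota>(2) by (metis (no_types) imageE)
    moreover have "\<Union>Y \<subseteq> sv_space d e f"
      using assms unfolding proj_space_def proj_point_def
      by (auto dest!: subsetD intro: coord.span_minimal[OF _ subspace_sv_space, THEN subsetD,
        rotated])
    ultimately show "vanishes G (\<Union>Y)" unfolding vanishes_def by blast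
  qed
qed

lemma irreducible_ambient:
  "irreducible_space (zariski (sv_space d e f :: (_ \<Rightarrow> 'k::field_char_0) set))"
proof -
  let ?V = "sv_space d e f :: (_ \<Rightarrow> 'k) set"
  obtain \<iota> :: "(nat \<Rightarrow> 'k) \<Rightarrow> nat \<times> nat \<times> nat \<Rightarrow> 'k" where
    \<iota>: "\<And>\<alpha>. polyfun (Suc d * Suc e * Suc f) (\<lambda>x. \<iota> x \<alpha>)" "range \<iota> = ?V"
    by (rule sv_space_param[of d e f]) blast
  have P: "image_points \<iota> = proj_space ?V"
    using \<iota>(2) unfolding image_points_def proj_space_def by (metis (no_types, opaque_lifting)
      rangeE rangeI)
  have "(\<lambda>\<alpha>. if \<alpha> = (0, 0, 0) then 1 else 0) \<in> ?V"
    by (simp add: sv_space_def)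
  then obtain x0 where "\<iota> x0 = (\<lambda>\<alpha>. if \<alpha> = (0, 0, 0) then 1 else 0)"
    using \<iota>(2) by (metis (no_types, lifting) rangeE)
  then have "\<iota> x0 \<noteq> 0" by (auto simp: fun_eq_iff)
  have "irreducible_space (subtopology (zariski ?V) (proj_space ?V))"
  proof (rule irreducible_image[OF \<iota>(1) _ \<open>\<iota> x0 \<noteq> 0\<close>])
    show "\<iota> x \<in> ?V" for x using \<iota>(2) by blast
    show "proj_space ?V \<subseteq> zariski ?V closure_of image_points \<iota>"
      unfolding P by (rule closure_of_subset) simp
  qed (simp add: P)
  then show ?thesis
    by (metis subtopology_topspace topspace_zariski)
qed

section \<open>Tangent spaces to the secant varieties\<close>

text \<open>Linearly independent rows have a right inverse. In the induction the new row minus its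
  projection to the span of the old ones has a nonzero entry \<open>j0\<close>, and the unit vector at \<open>j0\<close>,
  made orthogonal to the old rows, gives the new dual vector.\<close>

lemma dual_vectors:
  fixes R :: "'a \<Rightarrow> 'j \<Rightarrow> 'k::field"
  assumes "finite A" "finite J"
    "\<And>c. (\<forall>j\<in>J. (\<Sum>\<alpha>\<in>A. c \<alpha> * R \<alpha> j) = 0) \<Longrightarrow> (\<forall>\<alpha>\<in>A. c \<alpha> = 0)"
  shows "\<exists>w. \<forall>\<alpha>\<in>A. \<forall>\<beta>\<in>A. (\<Sum>j\<in>J. R \<alpha> j * w \<beta> j) = (if \<alpha> = \<beta> then 1 else 0)"
  using assms(1,3)
proof (induction A rule: finite_induct)
  case (insert a A)
  have "\<exists>w. \<forall>\<alpha>\<in>A. \<forall>\<beta>\<in>A. (\<Sum>j\<in>J. R \<alpha> j * w \<beta> j) = (if \<alpha> = \<beta> then 1 else 0)"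
  proof (rule insert.IH)
    fix c assume c: "\<forall>j\<in>J. (\<Sum>\<alpha>\<in>A. c \<alpha> * R \<alpha> j) = 0"
    have "(\<Sum>\<alpha>\<in>insert a A. (if \<alpha> = a then 0 else c \<alpha>) * R \<alpha> j) = (\<Sum>\<alpha>\<in>A. c \<alpha> * R \<alpha> j)" for j
      using insert.hyps by (auto intro!: sum.cong)
    then have "\<forall>\<alpha>\<in>insert a A. (if \<alpha> = a then 0 else c \<alpha>) = 0"
      using c by (intro insert.prems) simp
    then show "\<forall>\<alpha>\<in>A. c \<alpha> = 0" using insert.hyps by (metis insertCI)
  qed
  then obtain w where w: "\<And>\<alpha> \<beta>. \<alpha> \<in> A \<Longrightarrow> \<beta> \<in> A \<Longrightarrow> (\<Sum>j\<in>J. R \<alpha> j * w \<beta> j) = (if \<alpha> = \<beta> then 1 else 0)"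
    by blast
  define g where "g \<beta> = (\<Sum>j\<in>J. R a j * w \<beta> j)" for \<beta>
  define r where "r j = R a j - (\<Sum>\<beta>\<in>A. g \<beta> * R \<beta> j)" for j
  have "\<exists>j\<in>J. r j \<noteq> 0"
  proof (rule ccontr)
    assume n: "\<not> (\<exists>j\<in>J. r j \<noteq> 0)"
    have "(\<Sum>\<alpha>\<in>insert a A. (if \<alpha> = a then 1 else - g \<alpha>) * R \<alpha> j) = r j" for j
    proof -
      have "(\<Sum>\<alpha>\<in>A. (if \<alpha> = a then 1 else - g \<alpha>) * R \<alpha> j) = (\<Sum>\<alpha>\<in>A. - (g \<alpha> * R \<alpha> j))"
        using insert.hyps by (intro sum.cong) auto
      then show ?thesis using insert.hyps by (simp add: r_def sum_negf)
    qed
    then have "\<forall>\<alpha>\<in>insert a A. (if \<alpha> = a then 1 else - g \<alpha>) = 0"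
      using n by (intro insert.prems) simp
    then show False by simp
  qed
  then obtain j0 where j0: "j0 \<in> J" "r j0 \<noteq> 0" by blast
  define u where "u j = ((if j = j0 then 1 else 0) - (\<Sum>\<beta>\<in>A. R \<beta> j0 * w \<beta> j)) / r j0" for j
  have Ru: "(\<Sum>j\<in>J. R \<alpha> j * u j) = (R \<alpha> j0 - (\<Sum>\<beta>\<in>A. R \<beta> j0 * (\<Sum>j\<in>J. R \<alpha> j * w \<beta> j))) / r j0" for \<alpha>
  proof -
    have "(\<Sum>j\<in>J. R \<alpha> j * (\<Sum>\<beta>\<in>A. R \<beta> j0 * w \<beta> j)) = (\<Sum>\<beta>\<in>A. R \<beta> j0 * (\<Sum>j\<in>J. R \<alpha> j * w \<beta> j))"
      unfolding sum_distrib_left by (subst sum.swap) (simp add: mult_ac)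
    moreover have "(\<Sum>j\<in>J. R \<alpha> j * (if j = j0 then 1 else 0)) = (\<Sum>j\<in>J. if j = j0 then R \<alpha> j else 0)"
      by (intro sum.cong) auto
    moreover have "(\<Sum>j\<in>J. if j = j0 then R \<alpha> j else 0) = R \<alpha> j0"
      using j0 assms(2) by simp
    ultimately show ?thesis
      by (simp add: u_def right_diff_distrib sum_subtractf flip: sum_divide_distrib)
  qed
  have uA: "(\<Sum>j\<in>J. R \<alpha> j * u j) = 0" if "\<alpha> \<in> A" for \<alpha>
  proof -
    have "(\<Sum>\<beta>\<in>A. R \<beta> j0 * (\<Sum>j\<in>J. R \<alpha> j * w \<beta> j)) = (\<Sum>\<beta>\<in>A. if \<beta> = \<alpha> then R \<beta> j0 else 0)"
      using that by (intro sum.cong) (auto simp: w)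
    then show ?thesis using that insert.hyps by (simp add: Ru)
  qed
  have ua: "(\<Sum>j\<in>J. R a j * u j) = 1"
    using j0(2) unfolding Ru by (simp add: r_def g_def mult.commute)
  let ?w = "\<lambda>\<beta> j. if \<beta> = a then u j else w \<beta> j - g \<beta> * u j"
  have sub: "(\<Sum>j\<in>J. R \<alpha> j * (w \<beta> j - g \<beta> * u j)) =
      (\<Sum>j\<in>J. R \<alpha> j * w \<beta> j) - g \<beta> * (\<Sum>j\<in>J. R \<alpha> j * u j)" for \<alpha> \<beta>
    by (simp add: right_diff_distrib sum_subtractf sum_distrib_left mult_ac)
  have "(\<Sum>j\<in>J. R \<alpha> j * ?w \<beta> j) = (if \<alpha> = \<beta> then 1 else 0)"
    if "\<alpha> \<in> insert a A" "\<beta> \<in> insert a A" for \<alpha> \<beta>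
    using that insert.hyps by (cases "\<beta> = a") (auto simp: sub uA ua w g_def[symmetric])
  then show ?case by (intro exI[of _ ?w] ballI)
qed simp

text \<open>Moving each coordinate by a multiple of itself gives the logarithmic derivative, which is
  the monomial times a linear form in the exponents.\<close>

lemma first_order_monomial3:
  "first_order (\<lambda>t. monomial3 (x + t * (x * \<xi>), y + t * (y * \<eta>), z + t * (z * \<zeta>)) (a, b, c))
    (monomial3 (x, y, z) (a, b, c))
    (monomial3 (x, y, z) (a, b, c) * (of_nat a * \<xi> + of_nat b * \<eta> + of_nat c * \<zeta> :: 'k::field))"
proof -
  have pow: "first_order (\<lambda>t. (x + t * (x * \<xi>)) ^ n) (x ^ n) (x ^ n * (of_nat n * \<xi>))"
    for x \<xi> :: 'k and n
  proof -
    have "of_nat n * x ^ (n - 1) * (x * \<xi>) = x ^ n * (of_nat n * \<xi>)"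
      by (cases n) (simp_all add: mult_ac)
    then show ?thesis
      using first_order_power[OF first_order_linear[of x "x * \<xi>"], of n] by (simp only:)
  qed
  from first_order_mult[OF first_order_mult[OF pow[of x \<xi> a] pow[of y \<eta> b]] pow[of z \<zeta> c]]
  show ?thesis by (simp add: algebra_simps)
qed

text \<open>The matrix of the conditions to be singular at the points \<open>p i\<close> is the transpose of the
  derivative of the parametrization, up to binomial coefficients and scaling. As their only
  solution on \<open>A\<close> is zero, dual vectors exist, and they provide the tangent directions.\<close>

lemma secant_param_tangent:
  fixes A :: "(nat \<times> nat \<times> nat) set" and p :: "nat \<Rightarrow> 'k::field_char_0 \<times> 'k \<times> 'k"
  assumes ns: "none_singular_at p k A" and A: "A \<subseteq> box (Suc d) (Suc e) (Suc f)" "A \<noteq> {}"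
    and k: "k > 0"
    and X: "image_points (secant_param d e f k) \<subseteq> X"
  shows "enat (card A - 1) \<le> proj_dim (sv_space d e f) (X :: (_ \<Rightarrow> 'k) set set)"
proof -
  have fin: "finite A" using A(1) finite_box by (rule finite_subset)
  obtain \<alpha>0 where \<alpha>0: "\<alpha>0 \<in> A" using A(2) by blast
  let ?B = "binom3 d e f :: _ \<Rightarrow> 'k"
  have B: "?B \<alpha> \<noteq> 0" if "\<alpha> \<in> A" for \<alpha> using that A(1) binom3_nonzero by blast
  define R where "R \<alpha> = (\<lambda>(i, j). monomial3 (p i) \<alpha> * of_nat (affine_coord j \<alpha>))" for \<alpha>
  let ?J = "{..<k} \<times> {..<4::nat}"
  obtain w where w: "\<And>\<alpha> \<beta>. \<alpha> \<in> A \<Longrightarrow> \<beta> \<in> A \<Longrightarrow> (\<Sum>ij\<in>?J. R \<alpha> ij * w \<beta> ij) = (if \<alpha> = \<beta> then 1 else 0)"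
    using dual_vectors[of A ?J R] fin ns unfolding none_singular_at_def R_def by auto
  have p: "p i \<in> torus" if "i < k" for i using ns that by (auto simp: none_singular_at_def)
  have lm0: "monomial3 (p 0) \<alpha>0 \<noteq> 0"
    using p[OF k] by (cases \<alpha>0) (auto simp: torus_def)
  \<comment> \<open>The scalars of the summands must be nonzero for the derivative not to degenerate, and
      the resulting point needs a nonzero coordinate. If equal scalars fail, doubling one of them
      helps.\<close>
  obtain c :: "nat \<Rightarrow> 'k" where c: "\<And>i. c i \<noteq> 0" "(\<Sum>i<k. c i * monomial3 (p i) \<alpha>0) \<noteq> 0"
  proof (cases "(\<Sum>i<k. monomial3 (p i) \<alpha>0) = 0")
    case False
    then show ?thesis by (intro that[of "\<lambda>_. 1"]) auto
  next
    case True
    have "(\<Sum>i<k. (if i = 0 then 2 else 1) * monomial3 (p i) \<alpha>0) =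
        (\<Sum>i<k. monomial3 (p i) \<alpha>0 + (if i = 0 then monomial3 (p i) \<alpha>0 else 0))"
      by (intro sum.cong) auto
    also have "\<dots> = monomial3 (p 0) \<alpha>0" using k True by (simp add: sum.distrib)
    finally show ?thesis using lm0 by (intro that[of "\<lambda>i. if i = 0 then 2 else 1"]) auto
  qed
  define P where "P = pack4 c (\<lambda>i. fst (p i)) (\<lambda>i. fst (snd (p i))) (\<lambda>i. snd (snd (p i)))"
  define W where "W \<beta> = pack4 (\<lambda>i. w \<beta> (i, 0) / ?B \<beta>)
      (\<lambda>i. fst (p i) * (w \<beta> (i, 1) / c i) / ?B \<beta>) (\<lambda>i. fst (snd (p i)) * (w \<beta> (i, 2) / c i) / ?B \<beta>)
      (\<lambda>i. snd (snd (p i)) * (w \<beta> (i, 3) / c i) / ?B \<beta>)" for \<beta>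
  note P = pack4[of c "\<lambda>i. fst (p i)" "\<lambda>i. fst (snd (p i))" "\<lambda>i. snd (snd (p i))", folded P_def]
  note W = pack4[of "\<lambda>i. w \<beta> (i, 0) / ?B \<beta>" "\<lambda>i. fst (p i) * (w \<beta> (i, 1) / c i) / ?B \<beta>"
      "\<lambda>i. fst (snd (p i)) * (w \<beta> (i, 2) / c i) / ?B \<beta>" "\<lambda>i. snd (snd (p i)) * (w \<beta> (i, 3) / c i)
        / ?B \<beta>" for \<beta>,
      folded W_def]
  have param_P: "secant_param d e f k P \<alpha> = ?B \<alpha> * (\<Sum>i<k. c i * monomial3 (p i) \<alpha>)" for \<alpha>
    unfolding secant_param_def P sv_vec_def by (simp add: sum_distrib_left mult_ac)
  show ?thesis
    unfolding proj_dim_def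
  proof (rule krull_dim_ge_tangent[where \<phi> = "secant_param d e f k" and p = P and w = W and ?\<alpha>0.0 = \<alpha>0
        and \<sigma> = "\<lambda>c x n. if n mod 4 = 0 then c * x n else x n"])
    show "polyfun (4 * k) (\<lambda>x. secant_param d e f k x t)" for t by (rule secant_param_poly)
    show "secant_param d e f k x \<in> sv_space d e f" for x by (rule secant_param_in_sv_space)
    show "secant_param d e f k P \<alpha>0 \<noteq> 0"
      using c(2) B[OF \<alpha>0] by (simp add: param_P)
    show "vec_scale a (secant_param d e f k x) = secant_param d e f k (\<lambda>n. if n mod 4 =
      0 then a * x n else x n)"
      for a :: 'k and x
      unfolding fun_eq_iff vec_scale_def secant_param_def div_mod_4 sum_distrib_left by (simp add:
        mult.assoc)
  next
    fix s :: "_ \<Rightarrow> 'k" and \<alpha> assume \<alpha>: "\<alpha> \<in> A"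
    define S where "S i j = (\<Sum>\<beta>\<in>A. s \<beta> * (w \<beta> (i, j) / ?B \<beta>))" for i j
    let ?x = "\<lambda>t n. P n + t * (\<Sum>\<beta>\<in>A. s \<beta> * W \<beta> n)"
    have x: "?x t (4 * i) = c i + t * S i 0" "?x t (4 * i + 1) = fst (p i) + t * (fst (p i)
      * (S i 1 / c i))"
      "?x t (4 * i + 2) = fst (snd (p i)) + t * (fst (snd (p i)) * (S i 2 / c i))"
      "?x t (4 * i + 3) = snd (snd (p i)) + t * (snd (snd (p i)) * (S i 3 / c i))" for t i
      unfolding P W S_def by (simp_all add: sum_distrib_left sum_divide_distrib mult_ac)
    obtain a b l where abl: "\<alpha> = (a, b, l)" by (cases \<alpha>)
    let ?D = "\<lambda>i. of_nat a * (S i 1 / c i) + of_nat b * (S i 2 / c i) + of_nat l * (S i 3 / c i)"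
    have fo: "first_order (\<lambda>t. secant_param d e f k (?x t) \<alpha>)
      (\<Sum>i<k. c i * (?B \<alpha> * monomial3 (p i) \<alpha>))
      (\<Sum>i<k. c i * (?B \<alpha> * (monomial3 (p i) \<alpha> * ?D i) + 0 * monomial3 (p i) \<alpha>) +
        S i 0 * (?B \<alpha> * monomial3 (p i) \<alpha>))"
      unfolding secant_param_def x sv_vec_def
    proof (intro first_order_sum first_order_mult first_order_linear first_order_const)
      fix i
      show "first_order (\<lambda>t. monomial3 (fst (p i) + t * (fst (p i) * (S i 1 / c i)),
          fst (snd (p i)) + t * (fst (snd (p i)) * (S i 2 / c i)),
          snd (snd (p i)) + t * (snd (snd (p i)) * (S i 3 / c i))) \<alpha>) (monomial3 (p i) \<alpha>)
            (monomial3 (p i) \<alpha> * ?D i)"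
        using first_order_monomial3[of "fst (p i)" "S i 1 / c i" "fst (snd (p i))" "S i 2 / c i"
          "snd (snd (p i))" "S i 3 / c i" a b l]
        unfolding abl by simp
    qed
    have "(\<Sum>i<k. c i * (?B \<alpha> * (monomial3 (p i) \<alpha> * ?D i) + 0 * monomial3 (p i) \<alpha>) +
      S i 0 * (?B \<alpha> * monomial3 (p i) \<alpha>)) =
        (\<Sum>i<k. ?B \<alpha> * (\<Sum>j<4. R \<alpha> (i, j) * S i j))"
    proof (intro sum.cong refl)
      fix i
      have "(\<Sum>j<4. R \<alpha> (i, j) * S i j) =
          monomial3 (p i) \<alpha> * (S i 0 + of_nat a * S i 1 + of_nat b * S i 2 + of_nat l * S i 3)"
        by (simp add: R_def affine_coord_def abl numeral_eq_Suc algebra_simps)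
      moreover have "c i * ?D i = of_nat a * S i 1 + of_nat b * S i 2 + of_nat l * S i 3"
        using c(1)[of i] by (simp add: field_simps)
      ultimately show "c i * (?B \<alpha> * (monomial3 (p i) \<alpha> * ?D i) + 0 * monomial3 (p i) \<alpha>) +
        S i 0 * (?B \<alpha> * monomial3 (p i) \<alpha>) =
          ?B \<alpha> * (\<Sum>j<4. R \<alpha> (i, j) * S i j)"
        by Groebner_Basis.algebra
    qed
    also have "\<dots> = ?B \<alpha> * (\<Sum>ij\<in>?J. R \<alpha> ij * (case ij of (i, j) \<Rightarrow> S i j))"
      by (simp add: sum.cartesian_product sum_distrib_left case_prod_unfold)
    also have "(\<Sum>ij\<in>?J. R \<alpha> ij * (case ij of (i, j) \<Rightarrow> S i j)) =
        (\<Sum>\<beta>\<in>A. s \<beta> / ?B \<beta> * (\<Sum>ij\<in>?J. R \<alpha> ij * w \<beta> ij))"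
      unfolding S_def case_prod_unfold sum_distrib_left by (subst sum.swap) (simp add: mult_ac)
    also have "\<dots> = (\<Sum>\<beta>\<in>A. if \<beta> = \<alpha> then s \<beta> / ?B \<beta> else 0)"
      using \<alpha> by (intro sum.cong) (auto simp: w)
    also have "\<dots> = s \<alpha> / ?B \<alpha>"
      using \<alpha> fin by simp
    finally have der: "(\<Sum>i<k. c i * (?B \<alpha> * (monomial3 (p i) \<alpha> * ?D i) + 0 * monomial3 (p i) \<alpha>) +
        S i 0 * (?B \<alpha> * monomial3 (p i) \<alpha>)) = s \<alpha>"
      using B[OF \<alpha>] by simp
    show "first_order (\<lambda>t. secant_param d e f k (?x t) \<alpha>) (secant_param d e f k P \<alpha>) (s \<alpha>)"
      using fo unfolding der by (simp add: param_P sum_distrib_left mult_ac)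
  qed (use X \<alpha>0 fin in auto)
qed

lemma secant_dim_ge:
  fixes p :: "nat \<Rightarrow> 'k::field_char_0 \<times> 'k \<times> 'k"
  assumes "none_singular_at p k A" "A \<subseteq> box (Suc d) (Suc e) (Suc f)" "A \<noteq> {}" "k > 0"
  shows "enat (card A - 1) \<le> proj_dim (sv_space d e f)
    (secant_variety (sv_space d e f) (segre_veronese d e f :: (_ \<Rightarrow> 'k) set set) k)"
  using assms
  by (rule secant_param_tangent)
     (use secant_param_in_span_union span_union_in_secant in blast)

lemma segre_veronese_dim:
  assumes "d \<ge> 1" "e \<ge> 1" "f \<ge> 1"
  shows "proj_dim (sv_space d e f) (segre_veronese d e f :: (_ \<Rightarrow> 'k::field_char_0) set set) = enat 3"
proof (rule antisym[OF segre_veronese_dim_le])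
  let ?T = "[(0, 0, 0), (1, 0, 0), (0, 1, 0), (0, 0, 1)] :: (nat \<times> nat \<times> nat) list"
  have "nondefective_support TYPE('k) (set ?T)"
    by (rule nondefective_support_in_tetrahedron[of ?T]) simp_all
  then obtain A p where A: "A \<subseteq> set ?T" "card A = min (4 * 1) (card (set ?T))"
    "none_singular_at (p :: nat \<Rightarrow> 'k \<times> 'k \<times> 'k) 1 A"
    unfolding nondefective_support_def by blast
  then have card: "card A = 4" by simp
  have "image_points (secant_param d e f 1) \<subseteq> (segre_veronese d e f :: (_ \<Rightarrow> 'k) set set)"
  proof
    fix q assume "q \<in> image_points (secant_param d e f 1 :: _ \<Rightarrow> _ \<Rightarrow> 'k)"
    then obtain x :: "nat \<Rightarrow> 'k" where x: "q = proj_point (secant_param d e f 1 x)"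
      "secant_param d e f 1 x \<noteq> 0"
      by (auto simp: image_points_def)
    have eq: "secant_param d e f 1 x = vec_scale (x 0) (sv_vec d e f (x 1, x 2, x 3))"
      by (simp add: fun_eq_iff secant_param_def vec_scale_def numeral_2_eq_2)
    have "x 0 \<noteq> 0" using x(2) unfolding eq by (auto simp: vec_scale_def fun_eq_iff)
    then have "q = proj_point (sv_vec d e f (x 1, x 2, x 3))"
      unfolding x(1) eq proj_point_def by (rule coord.span_image_scale[of "{_}" "\<lambda>_. x 0",
        simplified])
    then show "q \<in> segre_veronese d e f" by (simp add: sv_vec_point)
  qed
  moreover have "A \<subseteq> box (Suc d) (Suc e) (Suc f)" using A(1) assms by (force simp: box_def)
  ultimately have "enat (card A - 1) \<le> proj_dim (sv_space d e f) (segre_veronese d e f :: (_ \<Rightarrow> 'k)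
    set set)"
    using card by (intro secant_param_tangent[OF A(3)]) auto
  then show "enat 3 \<le> proj_dim (sv_space d e f) (segre_veronese d e f :: (_ \<Rightarrow> 'k) set set)"
    by (simp add: card)
qed

section \<open>Flattenings\<close>

fun padd :: "nat \<times> nat \<times> nat \<Rightarrow> nat \<times> nat \<times> nat \<Rightarrow> nat \<times> nat \<times> nat" where
  "padd (a, b, c) (a', b', c') = (a + a', b + b', c + c')"

lemma monomial3_padd: "monomial3 u (padd \<alpha> \<beta>) = monomial3 u \<alpha> * monomial3 u \<beta>"
  by (cases u; cases \<alpha>; cases \<beta>) (simp add: power_add mult_ac)

text \<open>Dividing by binomial coefficients turns the coordinates of \<open>u\<^sup>d \<otimes> v\<^sup>e \<otimes> w\<^sup>f\<close> into
  monomials, and the monomial of a sum of exponents is a product; so these matrices have rank one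
  at such points.\<close>

definition flattening ::
  "nat \<Rightarrow> nat \<Rightarrow> nat \<Rightarrow> nat \<Rightarrow> (nat \<Rightarrow> nat \<times> nat \<times> nat) \<Rightarrow> (nat \<Rightarrow> nat \<times> nat \<times> nat) \<Rightarrow>
    (nat \<times> nat \<times> nat \<Rightarrow> 'k::field) \<Rightarrow> 'k mat" where
  "flattening d e f n r s v = mat n n (\<lambda>(i, j). v (padd (r i) (s j)) / binom3 d e f (padd (r i)
    (s j)))"

lemma flattening_det_poly:
  "\<exists>Q. \<forall>v. cpoly_eval Q v = det (flattening d e f n r s v :: 'k::field mat)"
proof -
  let ?M = "mat n n (\<lambda>(i, j). cconst (1 / binom3 d e f (padd (r i) (s j))) * cvar (padd (r i) (s j)))
    :: (nat \<times> nat \<times> nat, 'k) cpoly mat"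
  have "cpoly_eval (det ?M) v = det (flattening d e f n r s v)" for v :: "_ \<Rightarrow> 'k"
  proof -
    interpret comm_ring_hom "\<lambda>F :: (nat \<times> nat \<times> nat, 'k) cpoly. cpoly_eval F v"
      by unfold_locales (auto simp: cpoly_eval_add cpoly_eval_mult)
    have "map_mat (\<lambda>F. cpoly_eval F v) ?M = flattening d e f n r s v"
      by (rule eq_matI) (auto simp: flattening_def cpoly_eval_mult)
    then show ?thesis using hom_det[of ?M] by simp
  qed
  then show ?thesis by blast
qed

text \<open>More vectors \<open>(b l j)\<^sub>l\<close> than their length \<open>k\<close> are linearly dependent, which gives a
  vector in the kernel of the sum of \<open>k\<close> matrices of rank one.\<close>

lemma det_low_rank:
  fixes a b :: "nat \<Rightarrow> nat \<Rightarrow> 'k::field"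
  assumes "k < n"
  shows "det (mat n n (\<lambda>(i, j). \<Sum>l<k. a l i * b l j)) = 0"
proof -
  let ?f = "\<lambda>j l. if l < k then b l j else 0"
  let ?B = "(\<lambda>l m. if m = l then 1 else 0 :: 'k) ` {..<k}"
  have "?f ` {..<n} \<subseteq> coord_span ?B"
  proof clarify
    fix j
    have "?f j = (\<Sum>l<k. vec_scale (b l j) (\<lambda>m. if m = l then 1 else 0))"
      by (auto simp: fun_eq_iff sum_fun_apply vec_scale_def if_distrib[where f =
        "\<lambda>x. _ * x"] cong: if_cong)
    then show "?f j \<in> coord_span ?B"
      by (auto intro!: coord.span_sum coord.span_scale intro: coord.span_base)
  qed
  moreover have "card ?B < card {..<n}"
    using card_image_le[of "{..<k}" "\<lambda>l m. if m = l then 1 else 0 :: 'k"] assms by simp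
  ultimately obtain y where y: "\<exists>j\<in>{..<n}. y j \<noteq> 0" "\<And>l. (\<Sum>j<n. y j * ?f j l) = 0"
    using family_dependent[of "{..<n}" ?B ?f] by auto
  have by0: "(\<Sum>j<n. b l j * y j) = 0" if "l < k" for l
    using y(2)[of l] that by (simp add: mult.commute)
  let ?M = "mat n n (\<lambda>(i, j). \<Sum>l<k. a l i * b l j)" and ?y = "vec n y"
  have "(\<Sum>j<n. (\<Sum>l<k. a l i * b l j) * y j) = 0" for i
  proof -
    have "(\<Sum>j<n. (\<Sum>l<k. a l i * b l j) * y j) = (\<Sum>l<k. a l i * (\<Sum>j<n. b l j * y j))"
      unfolding sum_distrib_left sum_distrib_right by (subst sum.swap) (simp add: mult_ac)
    then show ?thesis by (simp add: by0)
  qed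
  then have "?M *\<^sub>v ?y = 0\<^sub>v n"
    by (intro eq_vecI) (auto simp: scalar_prod_def atLeast0LessThan)
  moreover have "?y \<noteq> 0\<^sub>v n" using y(1) by (auto simp: vec_eq_iff)
  moreover have "?M \<in> carrier_mat n n" "?y \<in> carrier_vec n" by auto
  ultimately show ?thesis using det_0_iff_vec_prod_zero[of ?M n] by blast
qed

lemma det_flattening_secant:
  fixes x :: "nat \<Rightarrow> 'k::field_char_0"
  assumes "k < n" and box: "\<And>i j. i < n \<Longrightarrow> j < n \<Longrightarrow> padd (r i) (s j) \<in> box (Suc d) (Suc e) (Suc f)"
  shows "det (flattening d e f n r s (secant_param d e f k x)) = 0"
proof -
  let ?u = "\<lambda>l. (x (4 * l + 1), x (4 * l + 2), x (4 * l + 3))"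
  have "flattening d e f n r s (secant_param d e f k x) =
      mat n n (\<lambda>(i, j). \<Sum>l<k. (x (4 * l) * monomial3 (?u l) (r i)) * monomial3 (?u l) (s j))"
  proof (rule eq_matI)
    fix i j assume "i < dim_row (mat n n (\<lambda>(i, j). \<Sum>l<k. (x (4 * l) * monomial3 (?u l) (r i))
      * monomial3 (?u l) (s j)))"
      "j < dim_col (mat n n (\<lambda>(i, j). \<Sum>l<k. (x (4 * l) * monomial3 (?u l) (r i)) * monomial3 (?u l)
        (s j)))"
    then have ij: "i < n" "j < n" by auto
    let ?B = "binom3 d e f (padd (r i) (s j)) :: 'k"
    have "?B \<noteq> 0" using box[OF ij] by (rule binom3_nonzero)
    moreover have "secant_param d e f k x (padd (r i) (s j)) =
        ?B * (\<Sum>l<k. x (4 * l) * monomial3 (?u l) (r i) * monomial3 (?u l) (s j))"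
      unfolding secant_param_def sv_vec_def monomial3_padd by (simp add: sum_distrib_left mult_ac)
    ultimately show "flattening d e f n r s (secant_param d e f k x) $$ (i, j) =
      mat n n (\<lambda>(i, j). \<Sum>l<k. (x (4 * l) * monomial3 (?u l) (r i)) * monomial3 (?u l) (s j)) $$ (i,
        j)"
      using ij by (simp add: flattening_def)
  qed (simp_all add: flattening_def)
  then show ?thesis using det_low_rank[OF assms(1)] by simp
qed

lemma det_antidiagonal:
  assumes M: "M \<in> carrier_mat n n"
    and anti: "\<And>i j. i < n \<Longrightarrow> j < n \<Longrightarrow> M $$ (i, j) = (if j = n - 1 - i then 1 else 0 :: 'k::field)"
  shows "det M \<noteq> 0"
proof
  assume "det M = 0"
  then obtain y where y: "y \<in> carrier_vec n" "y \<noteq> 0\<^sub>v n" "M *\<^sub>v y = 0\<^sub>v n"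
    using det_0_iff_vec_prod_zero[OF M] by blast
  have "y $ j = 0" if j: "j < n" for j
  proof -
    let ?i = "n - 1 - j"
    have i: "?i < n" "n - 1 - ?i = j" using j by auto
    have "0 = (M *\<^sub>v y) $ ?i" using y(3) i by simp
    also have "\<dots> = (\<Sum>l<n. (if l = j then 1 else 0) * y $ l)"
      using M y(1) i anti[OF i(1)] by (auto simp: scalar_prod_def atLeast0LessThan intro!: sum.cong)
    also have "\<dots> = y $ j" using j by (simp add: if_distrib[where f = "\<lambda>x. x * _"] cong: if_cong)
    finally show ?thesis by simp
  qed
  then have "y = 0\<^sub>v n" using y(1) by (intro eq_vecI) auto
  then show False using y(2) by blast
qed

text \<open>The determinant of the flattening vanishes on the secant variety, but not at \<open>v\<close>, where
  the flattening is the antidiagonal permutation matrix.\<close>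

lemma secant_dim_le_flattening:
  fixes v :: "nat \<times> nat \<times> nat \<Rightarrow> 'k::field_char_0"
  assumes k: "k < n" and box: "\<And>i j. i < n \<Longrightarrow> j < n \<Longrightarrow> padd (r i) (s j) \<in> box (Suc d) (Suc e) (Suc f)"
    and N: "Suc d * Suc e * Suc f = N + 2"
    and v: "v \<in> sv_space d e f" and anti: "\<And>i j. i < n \<Longrightarrow> j < n \<Longrightarrow>
      v (padd (r i) (s j)) = (if j = n - 1 - i then binom3 d e f (padd (r i) (s j)) else 0)"
  shows "proj_dim (sv_space d e f) (secant_variety (sv_space d e f)
    (segre_veronese d e f :: (_ \<Rightarrow> 'k) set set) k)
    \<le> enat N"
proof -
  let ?V = "sv_space d e f :: (_ \<Rightarrow> 'k) set"
  let ?S = "secant_variety ?V (segre_veronese d e f) k"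
  obtain Q where Q: "\<And>v :: _ \<Rightarrow> 'k. cpoly_eval Q v = det (flattening d e f n r s v)"
    using flattening_det_poly by metis
  have "vanishes Q (\<Union>?S)"
    unfolding secant_variety_eq
    by (intro vanishes_closure span_union_subset secant_param_dense)
      (simp add: Q det_flattening_secant k box)
  moreover have "cpoly_eval Q v \<noteq> 0"
    unfolding Q
  proof (rule det_antidiagonal)
    show "flattening d e f n r s v \<in> carrier_mat n n" by (simp add: flattening_def)
    fix i j assume "i < n" "j < n"
    then show "flattening d e f n r s v $$ (i, j) = (if j = n - 1 - i then 1 else 0)"
      using anti[of i j] binom3_nonzero[OF box[of i j], where 'k = 'k]
      by (cases "j = n - 1 - i") (auto simp: flattening_def)
  qed
  ultimately have "proj_point v \<notin> ?S"
    using in_proj_point unfolding vanishes_def by blast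
  moreover have "v \<noteq> 0"
  proof
    assume "v = 0"
    have n: "0 < n" "n - 1 < n" using k by auto
    have "v (padd (r 0) (s (n - 1))) = binom3 d e f (padd (r 0) (s (n - 1)))"
      using anti[OF n] by simp
    then show False
      using \<open>v = 0\<close> binom3_nonzero[OF box[OF n], where 'k = 'k] by simp
  qed
  then have "proj_point v \<in> proj_space ?V"
    using v by (auto simp: proj_space_def)
  ultimately have ne: "?S \<noteq> topspace (zariski ?V)" by auto
  have "krull_dim (zariski ?V) = proj_dim ?V (proj_space ?V)"
    unfolding proj_dim_def by (metis subtopology_topspace topspace_zariski)
  also have "\<dots> \<le> enat (Suc N)"
    using proj_dim_le_ambient[of "proj_space ?V" d e f] N by simp
  finally show ?thesis
    unfolding proj_dim_def using ne
    by (intro krull_dim_closed_proper[OF _ irreducible_ambient]) (simp_all add: secant_variety_def)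
qed

text \<open>A form of degree \<open>d = 2m\<close> is polarized to a bilinear form on forms of degree \<open>m\<close>; each of
  the two other factors is put on one side. This gives square matrices of size
  \<open>2 (m + 1) = d + 2\<close>, with the rows and columns numbered by the exponent and a binary digit.\<close>

lemma even_degree_secant_dim_le:
  assumes "even d"
  shows "proj_dim (sv_space d 1 1)
      (secant_variety (sv_space d 1 1) (segre_veronese d 1 1 :: (_ \<Rightarrow> 'k::field_char_0) set set) (d +
        1))
    \<le> enat (4 * d + 2)"
proof -
  obtain m where d: "d = 2 * m" using assms by (auto elim: evenE)
  define r :: "nat \<Rightarrow> nat \<times> nat \<times> nat" where "r i = (i div 2, i mod 2, 0)" for i
  define s :: "nat \<Rightarrow> nat \<times> nat \<times> nat" where "s j = (j div 2, 0, j mod 2)" for j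
  define v :: "nat \<times> nat \<times> nat \<Rightarrow> 'k" where
    "v = (\<lambda>(p, q, t). if p = m \<and> q + t = 1 then of_nat (d choose m) else 0)"
  have half: "i div 2 \<le> m" if "i < d + 2" for i using that by (simp add: d)
  show ?thesis
  proof (rule secant_dim_le_flattening[where n = "d + 2" and r = r and s = s and v = v])
    show "padd (r i) (s j) \<in> box (Suc d) (Suc 1) (Suc 1)" if "i < d + 2" "j < d + 2" for i j
    proof -
      have "i mod 2 < Suc 1" "j mod 2 < Suc 1" by simp_all
      then show ?thesis
        using half[OF that(1)] half[OF that(2)] by (simp add: r_def s_def box_def d)
    qed
    show "v \<in> sv_space d 1 1"
    proof -
      have "v (p, q, t) = 0" if "(p, q, t) \<notin> {..d} \<times> {..1} \<times> {..1}" for p q t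
      proof -
        have "\<not> (p = m \<and> q + t = 1)"
          using that unfolding d mem_Times_iff fst_conv snd_conv atMost_iff by linarith
        then show ?thesis by (simp only: v_def prod.case if_False)
      qed
      then show ?thesis unfolding sv_space_def by (simp only: mem_Collect_eq split_paired_All) blast
    qed
    fix i j assume ij: "i < d + 2" "j < d + 2"
    have "(i div 2 + j div 2 = m \<and> i mod 2 + j mod 2 = 1) \<longleftrightarrow> j = d + 2 - 1 - i"
    proof -
      have digits: "a + a' = m \<and> b + b' = 1 \<longleftrightarrow> 2 * a' + b' = 2 * m + 2 - 1 - (2 * a + b)"
        if "b = 0 \<or> b = 1" "b' = 0 \<or> b' = 1" "2 * a + b < 2 * m + 2" for a a' b b' :: nat
        using that by presburger
      have bit: "k mod 2 = 0 \<or> k mod 2 = 1" for k :: nat by auto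
      have "2 * (i div 2) + i mod 2 < 2 * m + 2"
        using ij(1) unfolding mult_div_mod_eq d .
      from digits[OF bit bit this, of "j div 2" j] show ?thesis unfolding mult_div_mod_eq d .
    qed
    moreover have "(1 choose (i mod 2)) = 1" for i :: nat
      by (cases "even i") (auto simp: even_iff_mod_2_eq_zero odd_iff_mod_2_eq_one)
    ultimately show "v (padd (r i) (s j)) = (if j = d + 2 - 1 - i then binom3 d 1 1 (padd (r i)
      (s j)) else 0)"
      by (auto simp: v_def r_def s_def binom3_def)
  qed auto
qed

text \<open>A form of degree \<open>(2, 2, 2)\<close> is polarized to a bilinear form on the eight-dimensional
  space of forms of degree \<open>(1, 1, 1)\<close>, whose monomials are numbered in binary.\<close>

lemma cube_secant_dim_le:
  "proj_dim (sv_space 2 2 2)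
      (secant_variety (sv_space 2 2 2) (segre_veronese 2 2 2 :: (_ \<Rightarrow> 'k::field_char_0) set set) 7)
    \<le> enat 25"
proof -
  define r :: "nat \<Rightarrow> nat \<times> nat \<times> nat" where "r i = (i div 4, i div 2 mod 2, i mod 2)" for i
  define v :: "nat \<times> nat \<times> nat \<Rightarrow> 'k" where
    "v = (\<lambda>\<alpha>. if \<alpha> = (1, 1, 1) then binom3 2 2 2 \<alpha> else 0)"
  show ?thesis
  proof (rule secant_dim_le_flattening[where n = 8 and r = r and s = r and v = v])
    show "padd (r i) (r j) \<in> box (Suc 2) (Suc 2) (Suc 2)" if "i < 8" "j < 8" for i j
    proof -
      have "a mod 2 + b mod 2 < Suc 2" for a b :: nat by presburger
      moreover have "i div 4 + j div 4 < Suc 2" using that by presburger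
      ultimately show ?thesis by (simp add: r_def box_def)
    qed
    show "v \<in> sv_space 2 2 2"
      by (auto simp: v_def sv_space_def)
    fix i j :: nat assume ij: "i < 8" "j < 8"
    have "\<forall>i\<in>set [0..<8]. \<forall>j\<in>set [0..<8].
        padd (i div 4, i div 2 mod 2, i mod 2) (j div 4, j div 2 mod 2, j mod 2) = (1, 1, 1) \<longleftrightarrow> j =
          8 - 1 - i"
      by code_simp
    then have "padd (r i) (r j) = (1, 1, 1) \<longleftrightarrow> j = 8 - 1 - i"
      using ij by (simp add: r_def del: padd.simps)
    then show "v (padd (r i) (r j)) = (if j = 8 - 1 - i then binom3 2 2 2 (padd (r i) (r j)) else 0)"
      by (simp add: v_def)
  qed auto
qed

section \<open>The dimensions of the secant varieties\<close>

lemma secant_dim_ge_nondefective_support: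
  fixes A
  assumes good: "nondefective_support TYPE('k::field_char_0) A" and A: "A \<subseteq> box (Suc d) (Suc e)
    (Suc f)" "A \<noteq> {}"
    and k: "k > 0"
  shows "enat (min (4 * k) (card A) - 1) \<le> proj_dim (sv_space d e f)
    (secant_variety (sv_space d e f) (segre_veronese d e f :: (_ \<Rightarrow> 'k) set set) k)"
proof -
  obtain A' p where A': "A' \<subseteq> A" "card A' = min (4 * k) (card A)"
    "none_singular_at (p :: nat \<Rightarrow> 'k \<times> 'k \<times> 'k) k A'"
    using good unfolding nondefective_support_def by blast
  have "card A > 0" using good A(2) by (simp add: nondefective_support_def card_gt_0_iff)
  then have "A' \<noteq> {}" using A'(2) k by auto
  then show ?thesis
    using secant_dim_ge[OF A'(3), of d e f] A' A(1) k by auto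
qed

theorem theorem1p2:
  fixes d e f :: nat
    and V :: "(nat \<times> nat \<times> nat \<Rightarrow> 'k::{alg_closed_field, field_char_0}) set"
    and Y :: "(nat \<times> nat \<times> nat \<Rightarrow> 'k) set set"
  assumes "d \<ge> e" and "e \<ge> f" and "f \<ge> 1"
    and "V = sv_space d e f" and "Y = segre_veronese d e f"
  shows "(\<not> (e = 1 \<and> f = 1 \<and> even d) \<and> \<not> (d = 2 \<and> e = 2 \<and> f = 2) \<longrightarrow> nondefective V Y) \<and>
    (e = 1 \<and> f = 1 \<and> even d \<longrightarrow>
       secant_codim V Y (d + 1) = 1 \<and> expected_codim V Y (d + 1) = 0) \<and>
    (d = 2 \<and> e = 2 \<and> f = 2 \<longrightarrow>
       secant_codim V Y 7 = 1 \<and> expected_codim V Y 7 = 0)"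
proof -
  let ?N = "Suc d * Suc e * Suc f"
  have dimY: "proj_dim V Y = enat 3"
    unfolding assms(4,5) by (rule segre_veronese_dim) (use assms in auto)
  have dimV: "coord_dim V = ?N"
    unfolding assms(4) by (rule coord_dim_sv_space)
  have expected: "expected_dim V Y k = enat (min (4 * k) ?N - 1)" for k
  proof -
    have "enat k * (enat 3 + 1) - 1 = enat (4 * k - 1)"
      by (simp add: one_enat_def mult.commute)
    then show ?thesis
      unfolding expected_dim_def dimY dimV by (simp add: min_diff)
  qed
  have ge: "enat (min (4 * k) (card A) - 1) \<le> proj_dim V (secant_variety V Y k)"
    if "nondefective_support TYPE('k) A" "A \<subseteq> box (Suc d) (Suc e) (Suc f)" "A \<noteq> {}" "k > 0" for A k
    unfolding assms(4,5) using that by (rule secant_dim_ge_nondefective_support)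
  have "nondefective V Y" if "\<not> (e = 1 \<and> f = 1 \<and> even d)" "\<not> (d = 2 \<and> e = 2 \<and> f = 2)"
    unfolding nondefective_def
  proof (intro allI impI antisym)
    fix k :: nat assume k: "k \<ge> 1"
    have "nondefective_support TYPE('k) (box (Suc d) (Suc e) (Suc f))"
      by (rule nondefective_box) (use assms that in \<open>auto simp: exceptional_def\<close>)
    moreover have "box (Suc d) (Suc e) (Suc f) \<noteq> {}"
      using card_box[of "Suc d" "Suc e" "Suc f"] by (metis card.empty mult_is_0 nat.distinct(1))
    ultimately have "enat (min (4 * k) (card (box (Suc d) (Suc e) (Suc f))) - 1)
      \<le> proj_dim V (secant_variety V Y k)"
      using k by (intro ge) auto
    then show "expected_dim V Y k \<le> proj_dim V (secant_variety V Y k)"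
      unfolding expected card_box .
    have "proj_dim V (secant_variety V Y k) \<le> enat (4 * k - 1)"
      unfolding assms(4,5) by (rule secant_dim_le_parameters)
    moreover have "proj_dim V (secant_variety V Y k) \<le> enat (?N - 1)"
      unfolding assms(4,5) by (rule proj_dim_le_ambient[OF secant_variety_subset])
    ultimately show "proj_dim V (secant_variety V Y k) \<le> expected_dim V Y k"
      unfolding expected by (simp add: min_def)
  qed
  moreover have "secant_codim V Y (d + 1) = 1 \<and> expected_codim V Y (d + 1) = 0"
    if ef: "e = 1" "f = 1" "even d"
  proof -
    have "d \<ge> 2" using ef assms(1) by presburger
    then obtain A where A: "A \<subseteq> box (Suc d) 2 2" "card A + 1 = 4 * Suc d"
      "nondefective_support TYPE('k) A"
      using nondefective_odd_box[of "Suc d", where 'k = 'k] ef(3) by auto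
    have "A \<noteq> {}" using A(2) by auto
    then have "enat (min (4 * (d + 1)) (card A) - 1) \<le> proj_dim V (secant_variety V Y (d + 1))"
      using A ef by (intro ge) (auto simp: numeral_2_eq_2)
    then have "enat (4 * d + 2) \<le> proj_dim V (secant_variety V Y (d + 1))"
      using A(2) by (simp add: min_def split: if_splits)
    moreover have "proj_dim V (secant_variety V Y (d + 1)) \<le> enat (4 * d + 2)"
      unfolding assms(4,5) ef(1,2) by (rule even_degree_secant_dim_le[OF ef(3)])
    ultimately have "proj_dim V (secant_variety V Y (d + 1)) = enat (4 * d + 2)"
      by (rule antisym[rotated])
    then show ?thesis
      unfolding secant_codim_def expected_codim_def expected dimV ef
      by (simp add: one_enat_def zero_enat_def min_def)
  qed
  moreover have "secant_codim V Y 7 = 1 \<and> expected_codim V Y 7 = 0" if def: "d = 2" "e = 2" "f = 2"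
  proof -
    let ?A = "box 3 3 3 - {(0, 0, 0)}"
    have card: "card ?A = 26" using card_box_minus_corner[of 3 3 3] by simp
    then have "?A \<noteq> {}" by (metis card.empty zero_neq_numeral)
    then have "enat (min (4 * 7) (card ?A) - 1) \<le> proj_dim V (secant_variety V Y 7)"
      using nondefective_box_333_minus_corner def by (intro ge)
        (auto simp: numeral_3_eq_3 numeral_2_eq_2)
    then have "enat 25 \<le> proj_dim V (secant_variety V Y 7)"
      by (simp add: card)
    moreover have "proj_dim V (secant_variety V Y 7) \<le> enat 25"
      unfolding assms(4,5) def by (rule cube_secant_dim_le)
    ultimately have "proj_dim V (secant_variety V Y 7) = enat 25"
      by (rule antisym[rotated])
    then show ?thesis
      unfolding secant_codim_def expected_codim_def expected dimV def
      by (simp add: one_enat_def zero_enat_def)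
  qed
  ultimately show ?thesis by blast
qed

end
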